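(* Let $R>1$, let $\Sigma\subset B_1(0)\subset\mathbb{R}^2$ be measurable, and let $A:\mathbb{R}^2\to\mathbb{R}$ be given by $A=+1$ outside $B_R(0)$, $A=-1$ in $B_R(0)\setminus\Sigma$, $A=+1$ in $\Sigma$. Let $\eta>0$ and $a_\eta=A+i\eta$. Let $f\in H^{-1}(\mathbb{R}^2)$ be a fixed real-valued source with compact support and with vanishing average. For real-valued $v,w\in\dot H^1(\mathbb{R}^2)$ set $I_\eta(v,w)=\frac{\eta}{2}\int|\nabla v|^2+\frac{1}{2\eta}\int|\nabla w|^2$. Then: 1. The infimum $$\inf\left\{I_\eta(\tilde v,\tilde w)\ \middle|\ (\tilde v,\tilde w)\in\dot H^1(\mathbb{R}^2)\times\dot H^1(\mathbb{R}^2),\ \nabla\cdot(A\nabla\tilde v)-\Delta\tilde w=f\right\}$$ is attained at a pair $(v_\eta,w_\eta)\in\dot H^1(\mathbb{R}^2)\times\dot H^1(\mathbb{R}^2)$. 2. The minimizing pair $(v_\eta,w_\eta)$ is unique up to an additive constant (in each component). The function $u_\eta:=v_\eta+i\eta^{-1}w_\eta$ is the unique (up to an additive constant) solution of $\nabla\cdot(a_\eta\nabla u_\eta)=f$ on $\mathbb{R}^2$. 3. For the solutions, the energies coincide: $E_\eta(u_\eta)=I_\eta(v_\eta,w_\eta)$.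
   Context: $\dot H^1(\mathbb{R}^2)=\{U\in L^2_{\mathrm{loc}}(\mathbb{R}^2):\nabla U\in L^2(\mathbb{R}^2)\}$ (real- or complex-valued), with norm $\|U\|^2=\int_{\mathbb{R}^2}|\nabla U|^2+\int_{B_1(0)}|U|^2$. All PDEs (including the constraint) are understood in the weak (distributional) sense, and solutions $u_\eta$ are sought among complex-valued functions in $\dot H^1(\mathbb{R}^2)$. "Vanishing average" means $\langle f,\mathbf{1}\rangle=0$, where $\mathbf{1}$ is the constant function $1$; since $f$ has compact support it can be applied to functions that are only locally $H^1$. The energy is $E_\eta(u_\eta)=\frac{\eta}{2}\int_{\mathbb{R}^2}|\nabla u_\eta|^2\,dx$. Integrals are over $\mathbb{R}^2$ and $B_r(x_0)$ denotes the disk of radius $r$ centered at $x_0$. *)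

theory Defs
  imports "HOL-Analysis.Analysis"
begin

type_synonym plane = "real ^ 2"

definition grad :: "(plane \<Rightarrow> real) \<Rightarrow> plane \<Rightarrow> plane" where
  "grad \<phi> x = (\<chi> i. frechet_derivative \<phi> (at x) (axis i 1))"

primrec Ck :: "nat \<Rightarrow> (plane \<Rightarrow> real) \<Rightarrow> bool" where
  "Ck 0 \<phi> \<longleftrightarrow> continuous_on UNIV \<phi>"
| "Ck (Suc k) \<phi> \<longleftrightarrow> \<phi> differentiable_on UNIV \<and> (\<forall>i. Ck k (\<lambda>x. grad \<phi> x $ i))"

definition supp :: "(plane \<Rightarrow> real) \<Rightarrow> plane set" where
  "supp \<phi> = closure {x. \<phi> x \<noteq> 0}"

definition test_functions :: "(plane \<Rightarrow> real) set" where
  "test_functions = {\<phi>. (\<forall>k. Ck k \<phi>) \<and> compact (supp \<phi>)}"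

(* Functions are genuine functions, not classes modulo null sets; equality in the function
   spaces below is equality almost everywhere. *)

definition L2 :: "(plane \<Rightarrow> 'a::euclidean_space) set" where
  "L2 = {U \<in> borel_measurable lebesgue. integrable lebesgue (\<lambda>x. (norm (U x))\<^sup>2)}"

definition L2_loc :: "(plane \<Rightarrow> 'a::euclidean_space) set" where
  "L2_loc = {U \<in> borel_measurable lebesgue.
     \<forall>K. compact K \<longrightarrow> set_integrable lebesgue K (\<lambda>x. (norm (U x))\<^sup>2)}"

definition L1_loc :: "(plane \<Rightarrow> 'a::euclidean_space) set" where
  "L1_loc = {U \<in> borel_measurable lebesgue. \<forall>K. compact K \<longrightarrow> set_integrable lebesgue K U}"

definition has_weak_grad ::
    "(plane \<Rightarrow> 'a::euclidean_space) \<Rightarrow> (plane \<Rightarrow> 'a ^ 2) \<Rightarrow> bool" where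
  "has_weak_grad U G \<longleftrightarrow> U \<in> L1_loc \<and> G \<in> L1_loc \<and>
     (\<forall>\<phi>\<in>test_functions. \<forall>i.
        (LINT x|lebesgue. (grad \<phi> x $ i) *\<^sub>R U x) = - (LINT x|lebesgue. \<phi> x *\<^sub>R (G x $ i)))"

(* The weak gradient is unique up to a null set; any representative serves. *)
definition wgrad :: "(plane \<Rightarrow> 'a::euclidean_space) \<Rightarrow> plane \<Rightarrow> 'a ^ 2" where
  "wgrad U = (SOME G. has_weak_grad U G)"

definition H1 :: "(plane \<Rightarrow> 'a::euclidean_space) set" where
  "H1 = {U \<in> L2. \<exists>G\<in>L2. has_weak_grad U G}"

definition H1_norm :: "(plane \<Rightarrow> 'a::euclidean_space) \<Rightarrow> real" where
  "H1_norm U = sqrt ((LINT x|lebesgue. (norm (U x))\<^sup>2) + (LINT x|lebesgue. (norm (wgrad U x))\<^sup>2))"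

definition H1_dot :: "(plane \<Rightarrow> 'a::euclidean_space) set" where
  "H1_dot = {U \<in> L2_loc. \<exists>G\<in>L2. has_weak_grad U G}"

definition eq_up_to_const :: "(plane \<Rightarrow> 'a::euclidean_space) \<Rightarrow> (plane \<Rightarrow> 'a) \<Rightarrow> bool" where
  "eq_up_to_const U V \<longleftrightarrow> (\<exists>c. AE x in lebesgue. U x = V x + c)"

(* The dual of the real space H1: bounded linear functionals. Only the values on H1 matter;
   boundedness forces them to respect equality almost everywhere. *)
definition H_minus1 :: "((plane \<Rightarrow> real) \<Rightarrow> real) set" where
  "H_minus1 = {f. (\<forall>u\<in>H1. \<forall>v\<in>H1. f (\<lambda>x. u x + v x) = f u + f v) \<and>
     (\<forall>c. \<forall>u\<in>H1. f (\<lambda>x. c * u x) = c * f u) \<and>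
     (\<exists>C. \<forall>u\<in>H1. \<bar>f u\<bar> \<le> C * H1_norm u)}"

definition supported_in :: "((plane \<Rightarrow> real) \<Rightarrow> real) \<Rightarrow> plane set \<Rightarrow> bool" where
  "supported_in f K \<longleftrightarrow> (\<forall>\<phi>\<in>test_functions. supp \<phi> \<inter> K = {} \<longrightarrow> f \<phi> = 0)"

definition compactly_supported :: "((plane \<Rightarrow> real) \<Rightarrow> real) \<Rightarrow> bool" where
  "compactly_supported f \<longleftrightarrow> (\<exists>K. compact K \<and> supported_in f K)"

definition cutoff_for :: "((plane \<Rightarrow> real) \<Rightarrow> real) \<Rightarrow> (plane \<Rightarrow> real) \<Rightarrow> bool" where
  "cutoff_for f \<theta> \<longleftrightarrow> \<theta> \<in> test_functions \<and>
     (\<exists>K W. compact K \<and> supported_in f K \<and> open W \<and> K \<subseteq> W \<and> (\<forall>x\<in>W. \<theta> x = 1))"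

(* Extension of a compactly supported f to functions that are only locally H1, such as
   constants: multiply by a cutoff that is 1 near the support of f.  The value does not
   depend on the cutoff. *)
definition pairing :: "((plane \<Rightarrow> real) \<Rightarrow> real) \<Rightarrow> (plane \<Rightarrow> real) \<Rightarrow> real" where
  "pairing f U = f (\<lambda>x. (SOME \<theta>. cutoff_for f \<theta>) x * U x)"

(* The distributional divergence of a vector field, as a functional on test functions. *)
definition weak_div :: "(plane \<Rightarrow> 'a::euclidean_space ^ 2) \<Rightarrow> (plane \<Rightarrow> real) \<Rightarrow> 'a" where
  "weak_div F \<phi> = - (LINT x|lebesgue. (\<Sum>i\<in>UNIV. (grad \<phi> x $ i) *\<^sub>R (F x $ i)))"

definition coeff_A :: "real \<Rightarrow> plane set \<Rightarrow> plane \<Rightarrow> real" where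
  "coeff_A R S x = (if x \<in> ball 0 R - S then - 1 else 1)"

definition coeff_a :: "real \<Rightarrow> plane set \<Rightarrow> real \<Rightarrow> plane \<Rightarrow> complex" where
  "coeff_a R S \<eta> x = complex_of_real (coeff_A R S x) + \<i> * complex_of_real \<eta>"

definition I_fun :: "real \<Rightarrow> (plane \<Rightarrow> real) \<times> (plane \<Rightarrow> real) \<Rightarrow> real" where
  "I_fun \<eta> = (\<lambda>(v, w). \<eta> / 2 * (LINT x|lebesgue. (norm (wgrad v x))\<^sup>2)
     + 1 / (2 * \<eta>) * (LINT x|lebesgue. (norm (wgrad w x))\<^sup>2))"

definition E_fun :: "real \<Rightarrow> (plane \<Rightarrow> complex) \<Rightarrow> real" where
  "E_fun \<eta> u = \<eta> / 2 * (LINT x|lebesgue. (norm (wgrad u x))\<^sup>2)"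

definition admissible ::
    "real \<Rightarrow> plane set \<Rightarrow> ((plane \<Rightarrow> real) \<Rightarrow> real) \<Rightarrow> ((plane \<Rightarrow> real) \<times> (plane \<Rightarrow> real)) set" where
  "admissible R S f = {(v, w). v \<in> H1_dot \<and> w \<in> H1_dot \<and>
     (\<forall>\<phi>\<in>test_functions.
        weak_div (\<lambda>x. coeff_A R S x *\<^sub>R wgrad v x) \<phi> - weak_div (wgrad w) \<phi> = f \<phi>)}"

definition minimizer ::
    "real \<Rightarrow> real \<Rightarrow> plane set \<Rightarrow> ((plane \<Rightarrow> real) \<Rightarrow> real) \<Rightarrow> (plane \<Rightarrow> real) \<Rightarrow> (plane \<Rightarrow> real) \<Rightarrow> bool" where
  "minimizer \<eta> R S f v w \<longleftrightarrow> (v, w) \<in> admissible R S f \<and>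
     I_fun \<eta> (v, w) = (INF p \<in> admissible R S f. I_fun \<eta> p)"

(* Real test functions suffice: both sides are linear in the test function. *)
definition solution ::
    "real \<Rightarrow> real \<Rightarrow> plane set \<Rightarrow> ((plane \<Rightarrow> real) \<Rightarrow> real) \<Rightarrow> (plane \<Rightarrow> complex) \<Rightarrow> bool" where
  "solution \<eta> R S f u \<longleftrightarrow> u \<in> H1_dot \<and>
     (\<forall>\<phi>\<in>test_functions.
        weak_div (\<lambda>x. coeff_a R S \<eta> x *s wgrad u x) \<phi> = complex_of_real (f \<phi>))"

end

theory Submission
  imports Defs
begin

text \<open>
  Write \<open>F = \<nabla>v\<close> and \<open>H = \<nabla>w\<close>. The real and imaginary parts of \<open>\<nabla>\<cdot>(a \<nabla>u) = f\<close> for \<open>u = v + \<i> w/\<eta>\<close> are the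
  constraint \<open>\<nabla>\<cdot>(A F - H) = f\<close> and the Euler equation \<open>\<nabla>\<cdot>(\<eta> F + A H/\<eta>) = 0\<close> of the minimisation, so everything
  reduces to solving this system for \<open>(F, H)\<close> in the Hilbert space of square integrable gradients. A solution
  exists by Riesz representation, the source being bounded by the gradient norm because it has compact support
  and vanishing average (Poincare). The energy of any admissible pair is that of the solution plus the energy of
  the difference, which gives attainment, uniqueness and equality of the energies; uniqueness for the
  complex equation follows by testing it with the conjugate of the difference of two solutions.

  All of this needs that gradients of test functions are dense among square integrable gradients. A gradient
  \<open>\<nabla>U\<close> orthogonal to them is weakly harmonic; its averages over annuli around a point do not depend on the
  radius, and they tend to 0 as the radius grows since \<open>\<nabla>U\<close> is square integrable, so \<open>\<nabla>U = 0\<close>.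
\<close>

subsection \<open>Square integrable functions on the plane\<close>

text \<open>In the plane the gradient norm does not control the function itself: constants are
  invisible to it, and there are cutoffs of arbitrarily small energy that equal 1 on large discs.
  Limits of potentials are therefore taken only after subtracting a mean and multiplying by a
  decaying weight; the vanishing average is what makes the source blind to the subtracted constant.
  The coefficient \<open>A\<close> changes sign, so the equation for \<open>v\<close> alone has no
  coercive form. Coupling it to \<open>w\<close> gives a positive definite energy, and when the two
  equations are tested crosswise, each with the unknown of the other, the terms containing
  \<open>A\<close> cancel. Crosswise testing is where density is needed: the equations hold against
  compactly supported functions, whereas the functions inserted are general elements of
  \<open>H1_dot\<close>. Density is reached by projecting onto the closure of test gradients. The
  remainder is again a gradient, because elements of the closure have potentials, and a Liouville
  argument removes it. That argument rests on the scaling of the plane: unit mass spread over an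
  annulus of area s has an L2 norm of order s^(-1/2), which tends to 0.\<close>

lemma L2I:
  assumes "U \<in> borel_measurable lebesgue" "integrable lebesgue (\<lambda>x. (norm (U x))\<^sup>2)"
  shows "U \<in> L2"
  using assms by (simp add: L2_def)

lemma L2_measurable: "U \<in> L2 \<Longrightarrow> U \<in> borel_measurable lebesgue"
  and L2_integrable: "U \<in> L2 \<Longrightarrow> integrable lebesgue (\<lambda>x. (norm (U x))\<^sup>2)"
  by (auto simp: L2_def)

text \<open>Functions are not identified modulo null sets, so this form is only positive
  semidefinite; the degenerate directions are described by \<open>nrm_eq_0_AE\<close>.\<close>

definition ip :: "(plane \<Rightarrow> 'a::euclidean_space) \<Rightarrow> (plane \<Rightarrow> 'a) \<Rightarrow> real" where
  "ip F G = (LINT x|lebesgue. F x \<bullet> G x)"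

definition nrm :: "(plane \<Rightarrow> 'a::euclidean_space) \<Rightarrow> real" where
  "nrm F = sqrt (ip F F)"

lemma ip_self: "ip F F = (LINT x|lebesgue. (norm (F x))\<^sup>2)"
  by (simp add: ip_def power2_norm_eq_inner)

lemma ip_commute: "ip F G = ip G F"
  by (simp add: ip_def inner_commute)

lemma ip_self_nonneg: "ip F F \<ge> 0"
  by (simp add: ip_self)

lemma nrm_nonneg: "nrm F \<ge> 0"
  by (simp add: nrm_def ip_self_nonneg)

lemma nrm_power2: "(nrm F)\<^sup>2 = ip F F"
  by (simp add: nrm_def ip_self_nonneg)

lemma L2_cmult:
  assumes "F \<in> L2" shows "(\<lambda>x. c *\<^sub>R F x) \<in> L2"
  using assms by (auto simp: L2_def power_mult_distrib)

lemma integrable_inner_L2: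
  assumes "F \<in> L2" "G \<in> L2"
  shows "integrable lebesgue (\<lambda>x. F x \<bullet> G x)"
proof (rule Bochner_Integration.integrable_bound)
  show "integrable lebesgue (\<lambda>x. (norm (F x))\<^sup>2 + (norm (G x))\<^sup>2)"
    using assms by (auto simp: L2_def)
  show "(\<lambda>x. F x \<bullet> G x) \<in> borel_measurable lebesgue"
    using assms by (auto simp: L2_def)
  have "\<bar>F x \<bullet> G x\<bar> \<le> (norm (F x))\<^sup>2 + (norm (G x))\<^sup>2" for x
  proof -
    have "\<bar>F x \<bullet> G x\<bar> \<le> norm (F x) * norm (G x)" by (rule Cauchy_Schwarz_ineq2)
    also have "\<dots> \<le> (norm (F x))\<^sup>2 + (norm (G x))\<^sup>2"
      using sum_squares_bound[of "norm (F x)" "norm (G x)"]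
        mult_nonneg_nonneg[OF norm_ge_zero[of "F x"] norm_ge_zero[of "G x"]] by linarith
    finally show ?thesis .
  qed
  then show "AE x in lebesgue. norm (F x \<bullet> G x) \<le> norm ((norm (F x))\<^sup>2 + (norm (G x))\<^sup>2)"
    by (auto intro!: AE_I2)
qed

lemma L2_add:
  assumes "F \<in> L2" "G \<in> L2" shows "(\<lambda>x. F x + G x) \<in> L2"
proof (rule L2I)
  show "integrable lebesgue (\<lambda>x. (norm (F x + G x))\<^sup>2)"
    using assms integrable_inner_L2[OF assms]
    by (simp add: power2_norm_eq_inner inner_add_left inner_add_right L2_def inner_commute)
qed (use assms in \<open>auto simp: L2_def\<close>)

lemma L2_diff:
  assumes "F \<in> L2" "G \<in> L2" shows "(\<lambda>x. F x - G x) \<in> L2"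
  using L2_add[OF assms(1) L2_cmult[OF assms(2), of "-1"]] by simp

lemma ip_add_left: "F \<in> L2 \<Longrightarrow> G \<in> L2 \<Longrightarrow> H \<in> L2 \<Longrightarrow> ip (\<lambda>x. F x + G x) H = ip F H + ip G H"
  by (simp add: ip_def inner_add_left integrable_inner_L2)

lemma ip_diff_left: "F \<in> L2 \<Longrightarrow> G \<in> L2 \<Longrightarrow> H \<in> L2 \<Longrightarrow> ip (\<lambda>x. F x - G x) H = ip F H - ip G H"
  by (simp add: ip_def inner_diff_left integrable_inner_L2)

lemma ip_cmult_left: "ip (\<lambda>x. c *\<^sub>R F x) H = c * ip F H"
  by (simp add: ip_def)

lemma ip_add_right: "F \<in> L2 \<Longrightarrow> G \<in> L2 \<Longrightarrow> H \<in> L2 \<Longrightarrow> ip H (\<lambda>x. F x + G x) = ip H F + ip H G"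
  by (simp add: ip_def inner_add_right integrable_inner_L2)

lemma ip_cmult_right: "ip H (\<lambda>x. c *\<^sub>R F x) = c * ip H F"
  by (simp add: ip_def)

lemma ip_sum_square:
  assumes "F \<in> L2" "G \<in> L2"
  shows "ip (\<lambda>x. F x + c *\<^sub>R G x) (\<lambda>x. F x + c *\<^sub>R G x) = ip F F + 2 * c * ip F G + c\<^sup>2 * ip G G"
  using assms
  by (simp add: ip_add_left ip_add_right L2_add L2_cmult ip_cmult_left ip_cmult_right ip_commute[of G F]
      power2_eq_square algebra_simps)

lemma ip_Cauchy_Schwarz_square:
  assumes "F \<in> L2" "G \<in> L2"
  shows "(ip F G)\<^sup>2 \<le> ip F F * ip G G"
proof -
  have *: "0 \<le> ip F F + 2 * c * ip F G + c\<^sup>2 * ip G G" for c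
    using ip_self_nonneg[of "\<lambda>x. F x + c *\<^sub>R G x"] ip_sum_square[OF assms, of c] by simp
  show ?thesis
  proof (cases "ip G G = 0")
    case True
    have "ip F G = 0"
    proof (rule ccontr)
      assume "ip F G \<noteq> 0"
      \<comment> \<open>With \<open>ip G G = 0\<close> the quadratic is affine in \<open>c\<close>;
        this \<open>c\<close> gives it the value -1.\<close>
      then show False
        using *[of "- (ip F F + 1) / (2 * ip F G)"] True by (simp add: field_simps)
    qed
    then show ?thesis using True by simp
  next
    case False
    then have pos: "ip G G > 0" using ip_self_nonneg[of G] by linarith
    \<comment> \<open>The minimiser of the quadratic in \<open>c\<close> is inserted, and the
      inequality is multiplied by \<open>ip G G\<close>.\<close>
    have "0 \<le> ip G G * (ip F F + 2 * (- ip F G / ip G G) * ip F G + (- ip F G / ip G G)\<^sup>2 * ip G G)"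
      using *[of "- ip F G / ip G G"] pos by (intro mult_nonneg_nonneg) auto
    also have "\<dots> = ip F F * ip G G - (ip F G)\<^sup>2"
      using False by (simp add: field_simps power2_eq_square)
    finally show ?thesis by linarith
  qed
qed

lemma ip_Cauchy_Schwarz:
  assumes "F \<in> L2" "G \<in> L2"
  shows "\<bar>ip F G\<bar> \<le> nrm F * nrm G"
  using real_sqrt_le_mono[OF ip_Cauchy_Schwarz_square[OF assms]]
  by (simp add: nrm_def real_sqrt_mult)

lemma nrm_triangle:
  assumes "F \<in> L2" "G \<in> L2"
  shows "nrm (\<lambda>x. F x + G x) \<le> nrm F + nrm G"
proof -
  have "ip (\<lambda>x. F x + G x) (\<lambda>x. F x + G x) \<le> (nrm F + nrm G)\<^sup>2"
    using ip_sum_square[OF assms, of 1] ip_Cauchy_Schwarz[OF assms]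
    by (simp add: power2_sum nrm_power2)
  then show ?thesis
    unfolding nrm_def[of "\<lambda>x. F x + G x"] by (intro real_le_lsqrt) (simp_all add: nrm_nonneg)
qed

lemma nrm_cmult: "nrm (\<lambda>x. c *\<^sub>R F x) = \<bar>c\<bar> * nrm F"
  by (simp add: nrm_def ip_cmult_left ip_cmult_right real_sqrt_mult flip: mult.assoc)

lemma nrm_eq_0_AE:
  assumes "F \<in> L2" "ip F F = 0"
  shows "AE x in lebesgue. F x = 0"
proof -
  have "AE x in lebesgue. (norm (F x))\<^sup>2 = 0"
    using assms by (subst integral_nonneg_eq_0_iff_AE[symmetric]) (auto simp: ip_self L2_def)
  then show ?thesis by auto
qed

lemma nn_integral_norm_L2:
  assumes "F \<in> L2"
  shows "(\<integral>\<^sup>+x. ennreal ((norm (F x))\<^sup>2) \<partial>lebesgue) = ennreal (ip F F)"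
  unfolding ip_self using assms by (intro nn_integral_eq_integral) (auto simp: L2_def)

lemma L2_nn_integral:
  assumes "F \<in> borel_measurable lebesgue"
    and "(\<integral>\<^sup>+x. ennreal ((norm (F x))\<^sup>2) \<partial>lebesgue) \<le> ennreal c" "c \<ge> 0"
  shows "F \<in> L2" "ip F F \<le> c"
proof -
  have "integrable lebesgue (\<lambda>x. (norm (F x))\<^sup>2)"
    using assms by (intro integrableI_nonneg) (auto simp: less_top[symmetric] top_unique)
  with assms show *: "F \<in> L2" by (simp add: L2_def)
  show "ip F F \<le> c"
    using assms(2,3) nn_integral_norm_L2[OF *] by (simp)
qed

text \<open>Riesz-Fischer. Along a subsequence whose squared increments decay like 8^-k, the
  increments are summable at almost every point, which produces \<open>L\<close>. Fatou's lemma
  along that subsequence bounds the distance from each late \<open>F n\<close> to \<open>L\<close>,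
  so the whole sequence converges, and \<open>L\<close> is square integrable because it differs from
  one \<open>F n\<close> by a square integrable function.\<close>

lemma L2_complete:
  fixes F :: "nat \<Rightarrow> plane \<Rightarrow> 'a::euclidean_space"
  assumes F: "\<And>n. F n \<in> L2"
    and cauchy: "\<And>e. e > 0 \<Longrightarrow> \<exists>N. \<forall>m\<ge>N. \<forall>n\<ge>N. ip (\<lambda>x. F m x - F n x) (\<lambda>x. F m x - F n x) < e"
  shows "\<exists>L\<in>L2. (\<lambda>n. nrm (\<lambda>x. F n x - L x)) \<longlonglongrightarrow> 0"
proof -
  have [measurable]: "F n \<in> borel_measurable lebesgue" for n using F by (simp add: L2_def)
  let ?d = "\<lambda>m n. ip (\<lambda>x. F m x - F n x) (\<lambda>x. F m x - F n x)"
  have "\<forall>k. \<exists>N. \<forall>m\<ge>N. \<forall>n\<ge>N. ?d m n < 1 / 8 ^ k"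
    using cauchy by simp
  then obtain N where N: "\<And>k m n. m \<ge> N k \<Longrightarrow> n \<ge> N k \<Longrightarrow> ?d m n < 1 / 8 ^ k"
    by metis
  \<comment> \<open>The maximum puts \<open>r k\<close> beyond all thresholds up to the k-th; the
    summand \<open>k\<close> makes the indices tend to infinity.\<close>
  define r where "r k = Max (N ` {..k}) + k" for k
  have rN: "r k \<ge> N j" if "j \<le> k" for j k
  proof -
    have "N j \<le> Max (N ` {..k})" using that by (intro Max_ge) auto
    then show ?thesis by (simp add: r_def)
  qed
  have rk: "r k \<ge> k" for k by (simp add: r_def)
  have [measurable]: "F (r k) \<in> borel_measurable lebesgue" for k by simp
  \<comment> \<open>The factor 2^k still leaves the summable bound 4^-k after integration, and
    finiteness of the weighted sum at a point forces the increments there below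
    \<open>sqrt (1/2) ^ k\<close> eventually.\<close>
  have int: "(\<integral>\<^sup>+x. ennreal (2^k * (norm (F (r (Suc k)) x - F (r k) x))\<^sup>2) \<partial>lebesgue) \<le> ennreal ((1/4)^k)" for k
  proof -
    have "(\<integral>\<^sup>+x. ennreal (2^k * (norm (F (r (Suc k)) x - F (r k) x))\<^sup>2) \<partial>lebesgue)
       = 2^k * (\<integral>\<^sup>+x. ennreal ((norm (F (r (Suc k)) x - F (r k) x))\<^sup>2) \<partial>lebesgue)"
      by (subst nn_integral_cmult[symmetric]) (auto simp: ennreal_mult ennreal_power[symmetric])
    also have "\<dots> = ennreal (2^k * ?d (r (Suc k)) (r k))"
      by (subst nn_integral_norm_L2) (auto simp: F L2_diff ennreal_mult ip_self_nonneg ennreal_power[symmetric])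
    also have "\<dots> \<le> ennreal (2^k * (1/8^k))"
      using N[of k "r (Suc k)" "r k"] rN[of k "Suc k"] rN[of k k]
      by (intro ennreal_leI mult_left_mono) (auto intro: less_imp_le)
    also have "2^k * (1/8^k) = ((1/4)^k :: real)"
      by (simp add: power_divide flip: power_mult_distrib) (simp add: field_simps flip: power_mult_distrib)
    finally show ?thesis .
  qed
  have "(\<integral>\<^sup>+x. (\<Sum>k. ennreal (2^k * (norm (F (r (Suc k)) x - F (r k) x))\<^sup>2)) \<partial>lebesgue)
     = (\<Sum>k. \<integral>\<^sup>+x. ennreal (2^k * (norm (F (r (Suc k)) x - F (r k) x))\<^sup>2) \<partial>lebesgue)"
    by (rule nn_integral_suminf) auto
  also have "\<dots> \<le> (\<Sum>k. ennreal ((1/4)^k))"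
    using int by (intro suminf_le) auto
  also have "\<dots> = ennreal (\<Sum>k. (1/4)^k)"
    by (intro suminf_ennreal2) (auto intro: summable_geometric)
  finally have fin: "(\<integral>\<^sup>+x. (\<Sum>k. ennreal (2^k * (norm (F (r (Suc k)) x - F (r k) x))\<^sup>2)) \<partial>lebesgue) \<noteq> \<infinity>"
    by (auto simp: top_unique)
  have "AE x in lebesgue. (\<Sum>k. ennreal (2^k * (norm (F (r (Suc k)) x - F (r k) x))\<^sup>2)) \<noteq> \<infinity>"
    by (rule nn_integral_noteq_infinite[OF _ fin]) measurable
  then have conv: "AE x in lebesgue. convergent (\<lambda>k. F (r k) x)"
  proof eventually_elim
    case (elim x)
    let ?a = "\<lambda>k. norm (F (r (Suc k)) x - F (r k) x)"
    have "summable (\<lambda>k. 2^k * (?a k)\<^sup>2)"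
      by (rule summable_suminf_not_top) (use elim in auto)
    then have "(\<lambda>k. 2^k * (?a k)\<^sup>2) \<longlonglongrightarrow> 0" by (rule summable_LIMSEQ_zero)
    then have "\<forall>\<^sub>F k in sequentially. 2^k * (?a k)\<^sup>2 < 1"
      by (rule order_tendstoD) simp
    then have ev: "\<forall>\<^sub>F k in sequentially. norm (F (r (Suc k)) x - F (r k) x) \<le> (sqrt (1/2)) ^ k"
    proof eventually_elim
      case (elim k)
      have "((sqrt (1/2)) ^ k)\<^sup>2 = (sqrt (1/2) * sqrt (1/2)) ^ k"
        by (simp only: power2_eq_square power_mult_distrib)
      also have "\<dots> = 1 / 2 ^ k" by (simp add: power_divide)
      finally have eq: "((sqrt (1/2)) ^ k)\<^sup>2 = 1 / 2 ^ k" .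
      have "(?a k)\<^sup>2 \<le> ((sqrt (1/2)) ^ k)\<^sup>2"
        unfolding eq using elim by (simp add: field_simps)
      then show ?case by (rule power2_le_imp_le) simp
    qed
    have "summable (\<lambda>k. F (r (Suc k)) x - F (r k) x)"
    proof (rule summable_comparison_test_ev[OF ev])
      show "summable (\<lambda>k. (sqrt (1/2)) ^ k)"
        by (rule summable_geometric) (simp add: real_sqrt_divide)
    qed
    then have "convergent (\<lambda>n. \<Sum>k<n. F (r (Suc k)) x - F (r k) x)"
      by (simp add: summable_iff_convergent)
    then have "convergent (\<lambda>n. F (r n) x - F (r 0) x)"
      using sum_lessThan_telescope[of "\<lambda>k. F (r k) x"] by simp
    then show ?case
      using convergent_add_const_right_iff[of "\<lambda>n. F (r n) x" "- F (r 0) x"] by simp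
  qed
  define L where "L x = lim (\<lambda>k. F (r k) x)" for x
  have [measurable]: "L \<in> borel_measurable lebesgue"
    unfolding L_def by measurable
  have lim: "AE x in lebesgue. (\<lambda>k. F (r k) x) \<longlonglongrightarrow> L x"
    using conv by eventually_elim (simp add: L_def convergent_LIMSEQ_iff)
  \<comment> \<open>Fatou's lemma with \<open>n\<close> fixed and the second index running through
    the subsequence.\<close>
  have bound: "(\<integral>\<^sup>+x. ennreal ((norm (F n x - L x))\<^sup>2) \<partial>lebesgue) \<le> ennreal e"
    if e: "e > 0" and M: "\<And>m. m \<ge> M \<Longrightarrow> ?d n m < e" for n M e
  proof -
    have "(\<integral>\<^sup>+x. ennreal ((norm (F n x - L x))\<^sup>2) \<partial>lebesgue)
      = (\<integral>\<^sup>+x. liminf (\<lambda>k. ennreal ((norm (F n x - F (r k) x))\<^sup>2)) \<partial>lebesgue)"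
    proof (rule nn_integral_cong_AE, use lim in eventually_elim)
      case (elim x)
      have "(\<lambda>k. ennreal ((norm (F n x - F (r k) x))\<^sup>2)) \<longlonglongrightarrow> ennreal ((norm (F n x - L x))\<^sup>2)"
        by (intro tendsto_intros elim)
      then show ?case by (intro lim_imp_Liminf[symmetric]) auto
    qed
    also have "\<dots> \<le> liminf (\<lambda>k. \<integral>\<^sup>+x. ennreal ((norm (F n x - F (r k) x))\<^sup>2) \<partial>lebesgue)"
      by (rule nn_integral_liminf) measurable
    also have "\<dots> = liminf (\<lambda>k. ennreal (?d n (r k)))"
      by (subst nn_integral_norm_L2) (auto simp: F L2_diff)
    also have "\<dots> \<le> liminf (\<lambda>k. ennreal e)"
    proof (rule Liminf_mono)
      show "\<forall>\<^sub>F k in sequentially. ennreal (?d n (r k)) \<le> ennreal e"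
        using eventually_ge_at_top[of M]
        by eventually_elim (use M rk in \<open>meson ennreal_leI less_imp_le order_trans\<close>)
    qed
    finally show ?thesis by (simp add: Liminf_const)
  qed
  have inL2: "(\<lambda>x. F n x - L x) \<in> L2" if "\<And>m. m \<ge> M \<Longrightarrow> ?d n m < e" "e > 0" for n M e
    by (rule L2_nn_integral(1)[OF _ bound[OF that(2,1)]]) (use that in auto)
  obtain N1 where N1: "\<And>m n. m \<ge> N1 \<Longrightarrow> n \<ge> N1 \<Longrightarrow> ?d m n < 1" using cauchy[of 1] by auto
  have "(\<lambda>x. F N1 x - L x) \<in> L2" using inL2[of N1 N1 1] N1 by auto
  then have "L \<in> L2" using L2_diff[OF F[of N1]] by fastforce
  moreover have "(\<lambda>n. nrm (\<lambda>x. F n x - L x)) \<longlonglongrightarrow> 0"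
  proof (rule LIMSEQ_I)
    fix e :: real assume e: "e > 0"
    then obtain M where M: "\<And>m n. m \<ge> M \<Longrightarrow> n \<ge> M \<Longrightarrow> ?d m n < (e/2)\<^sup>2" using cauchy[of "(e/2)\<^sup>2"] by auto
    have "nrm (\<lambda>x. F n x - L x) < e" if "n \<ge> M" for n
    proof -
      have "ip (\<lambda>x. F n x - L x) (\<lambda>x. F n x - L x) \<le> (e/2)\<^sup>2"
        by (rule L2_nn_integral(2)[OF _ bound]) (use M that e in auto)
      then have "nrm (\<lambda>x. F n x - L x) \<le> e / 2" unfolding nrm_def using e
        by (intro real_le_lsqrt) (auto simp: ip_self_nonneg)
      then show ?thesis using e by simp
    qed
    then show "\<exists>no. \<forall>n\<ge>no. norm (nrm (\<lambda>x. F n x - L x) - 0) < e"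
      by (auto simp: nrm_nonneg)
  qed
  ultimately show ?thesis by auto
qed

lemma ip_tendsto:
  assumes "\<And>n. F n \<in> L2" "L \<in> L2" "G \<in> L2" and lim: "(\<lambda>n. nrm (\<lambda>x. F n x - L x)) \<longlonglongrightarrow> 0"
  shows "(\<lambda>n. ip (F n) G) \<longlonglongrightarrow> ip L G"
proof -
  have "(\<lambda>n. ip (F n) G - ip L G) \<longlonglongrightarrow> 0"
  proof (rule Lim_null_comparison)
    show "\<forall>\<^sub>F n in sequentially. norm (ip (F n) G - ip L G) \<le> nrm (\<lambda>x. F n x - L x) * nrm G"
      using ip_Cauchy_Schwarz[OF L2_diff[OF assms(1,2)] assms(3)]
      by (auto simp: ip_diff_left assms(1-3))
    show "(\<lambda>n. nrm (\<lambda>x. F n x - L x) * nrm G) \<longlonglongrightarrow> 0"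
      using tendsto_mult_right[OF lim, of "nrm G"] by simp
  qed
  then show ?thesis using LIM_zero_iff by blast
qed

text \<open>The functional \<open>ip (D t) (D t) / 2 - l t\<close> is minimised over \<open>T\<close>; by the parallelogram
  law its minimising sequences are Cauchy, and the limit satisfies the Euler equation.\<close>

lemma riesz_L2:
  fixes D :: "'t \<Rightarrow> plane \<Rightarrow> 'a::euclidean_space" and l :: "'t \<Rightarrow> real"
  assumes ne: "T \<noteq> {}" and D: "\<And>t. t \<in> T \<Longrightarrow> D t \<in> L2"
    and lin: "\<And>s t c. s \<in> T \<Longrightarrow> t \<in> T \<Longrightarrow> \<exists>r\<in>T. D r = (\<lambda>x. D s x + c *\<^sub>R D t x) \<and> l r = l s + c * l t"
    and bd: "\<And>t. t \<in> T \<Longrightarrow> \<bar>l t\<bar> \<le> C * nrm (D t)"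
  obtains F X where "F \<in> L2" "\<And>n::nat. X n \<in> T" "(\<lambda>n. nrm (\<lambda>x. D (X n) x - F x)) \<longlonglongrightarrow> 0"
    "\<And>t. t \<in> T \<Longrightarrow> ip F (D t) = l t"
proof -
  define J where "J t = ip (D t) (D t) / 2 - l t" for t
  have lower: "J t \<ge> - C\<^sup>2 / 2" if "t \<in> T" for t
  proof -
    have "l t \<le> C * nrm (D t)" using bd[OF that] by simp
    moreover have "0 \<le> (nrm (D t) - C)\<^sup>2" by simp
    ultimately show ?thesis by (simp add: J_def power2_diff nrm_power2[symmetric] mult.commute)
  qed
  define m where "m = Inf (J ` T)"
  have bdd: "bdd_below (J ` T)" using lower by (auto intro!: bdd_belowI)
  have m: "m \<le> J t" if "t \<in> T" for t unfolding m_def using bdd that by (auto intro: cInf_lower)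
  have "\<exists>t\<in>T. J t < m + 1 / real (Suc n)" for n
  proof -
    have "Inf (J ` T) < m + 1 / real (Suc n)" by (simp add: m_def)
    from cInf_lessD[OF _ this] ne show ?thesis by auto
  qed
  then obtain X where X: "\<And>n. X n \<in> T" "\<And>n. J (X n) < m + 1 / real (Suc n)" by metis
  have par: "ip (\<lambda>x. D s x - D t x) (\<lambda>x. D s x - D t x) \<le> 4 * ((J s - m) + (J t - m))" if st: "s \<in> T" "t \<in> T" for s t
  proof -
    \<comment> \<open>The midpoint of \<open>s\<close> and \<open>t\<close> is needed, but
      \<open>lin\<close> only offers sums s + c t. It is reached in two moves, as \<open>r\<close>
      minus half of \<open>r\<close> with \<open>r\<close> the sum.\<close>
    obtain r where r: "r \<in> T" "D r = (\<lambda>x. D s x + 1 *\<^sub>R D t x)" "l r = l s + 1 * l t" using lin[OF st] by blast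
    obtain q where q: "q \<in> T" "D q = (\<lambda>x. D r x + (-1/2) *\<^sub>R D r x)" "l q = l r + (-1/2) * l r" using lin[OF r(1) r(1)] by blast
    have "D q = (\<lambda>x. (1/2) *\<^sub>R (D s x + 1 *\<^sub>R D t x))"
      unfolding q(2) r(2) by (rule ext) (simp add: algebra_simps flip: scaleR_left.add scaleR_add_left)
    then have "ip (D q) (D q) = (ip (D s) (D s) + 2 * ip (D s) (D t) + ip (D t) (D t)) / 4"
      using ip_sum_square[OF D[OF st(1)] D[OF st(2)], of 1] by (simp only: ip_cmult_left ip_cmult_right) simp
    moreover have "ip (\<lambda>x. D s x - D t x) (\<lambda>x. D s x - D t x) = ip (D s) (D s) - 2 * ip (D s) (D t) + ip (D t) (D t)"
      using ip_sum_square[OF D[OF st(1)] D[OF st(2)], of "-1"] by simp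
    moreover have "l q = (l s + l t) / 2" using q(3) r(3) by (simp add: field_simps)
    ultimately show ?thesis using m[OF q(1)] by (simp add: J_def field_simps)
  qed
  have "\<exists>F\<in>L2. (\<lambda>n. nrm (\<lambda>x. D (X n) x - F x)) \<longlonglongrightarrow> 0"
  proof (rule L2_complete)
    show "D (X n) \<in> L2" for n using X D by simp
    fix e :: real assume e: "e > 0"
    \<comment> \<open>The 8 is the factor 4 of \<open>par\<close> times two excesses, each at most
      \<open>1 / real (Suc N)\<close>.\<close>
    obtain N where N: "8 / real (Suc N) < e"
      using reals_Archimedean[of "e/8"] e by (auto simp: field_simps)
    have "ip (\<lambda>x. D (X i) x - D (X j) x) (\<lambda>x. D (X i) x - D (X j) x) < e" if "i \<ge> N" "j \<ge> N" for i j
    proof -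
      have "1 / real (Suc i) \<le> 1 / real (Suc N)" "1 / real (Suc j) \<le> 1 / real (Suc N)"
        using that by (auto simp: field_simps)
      moreover have "8 * (1 / real (Suc N)) < e" using N by simp
      moreover have "ip (\<lambda>x. D (X i) x - D (X j) x) (\<lambda>x. D (X i) x - D (X j) x) \<le> 4 * (J (X i) - m) + 4 * (J (X j) - m)"
        using par[OF X(1)[of i] X(1)[of j]] by (simp only: distrib_left)
      moreover have "J (X i) - m < 1 / real (Suc i)" "J (X j) - m < 1 / real (Suc j)"
        using X(2)[of i] X(2)[of j] by simp_all
      ultimately show ?thesis by simp
    qed
    then show "\<exists>N. \<forall>i\<ge>N. \<forall>j\<ge>N. ip (\<lambda>x. D (X i) x - D (X j) x) (\<lambda>x. D (X i) x - D (X j) x) < e" by blast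
  qed
  then obtain F where F: "F \<in> L2" "(\<lambda>n. nrm (\<lambda>x. D (X n) x - F x)) \<longlonglongrightarrow> 0" by auto
  have "ip F (D t) = l t" if t: "t \<in> T" for t
  proof -
    have ge: "0 \<le> c * (ip F (D t) - l t) + c\<^sup>2 / 2 * ip (D t) (D t)" for c
    proof -
      \<comment> \<open>\<open>X n\<close> minimises only up to \<open>1 / real (Suc n)\<close>, so
        the variational inequality holds with this defect, which disappears in the limit.\<close>
      have "- (1 / real (Suc n)) \<le> c * (ip (D (X n)) (D t) - l t) + c\<^sup>2 / 2 * ip (D t) (D t)" for n
      proof -
        obtain r where r: "r \<in> T" "D r = (\<lambda>x. D (X n) x + c *\<^sub>R D t x)" "l r = l (X n) + c * l t"
          using lin[OF X(1) t] by blast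
        have "m \<le> J r" using m r by auto
        moreover have "J r = J (X n) + (c * (ip (D (X n)) (D t) - l t) + c\<^sup>2 / 2 * ip (D t) (D t))"
          unfolding J_def r(2,3) ip_sum_square[OF D[OF X(1)] D[OF t]] by (simp add: field_simps)
        ultimately show ?thesis using X(2)[of n] by linarith
      qed
      moreover have "(\<lambda>n. c * (ip (D (X n)) (D t) - l t) + c\<^sup>2 / 2 * ip (D t) (D t))
         \<longlonglongrightarrow> c * (ip F (D t) - l t) + c\<^sup>2 / 2 * ip (D t) (D t)"
        by (intro tendsto_intros ip_tendsto F D X t)
      moreover have "(\<lambda>n. - (1 / real (Suc n))) \<longlonglongrightarrow> 0"
        using tendsto_minus[OF LIMSEQ_inverse_real_of_nat] by (simp add: inverse_eq_divide)
      ultimately show ?thesis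
        by (intro LIMSEQ_le) auto
    qed
    define a where "a = ip F (D t) - l t"
    define b where "b = ip (D t) (D t)"
    have b: "b \<ge> 0" by (simp add: b_def ip_self_nonneg)
    \<comment> \<open>A step proportional to \<open>- a\<close> makes the linear term negative; the
      denominator \<open>b + 1\<close> avoids division by zero and keeps the quadratic term
      smaller.\<close>
    have "0 \<le> (- a / (b + 1)) * a + (- a / (b + 1))\<^sup>2 / 2 * b" using ge[of "- a / (b+1)"] by (simp add: a_def b_def)
    also have "\<dots> = - a\<^sup>2 * (b + 2) / (2 * (b+1)\<^sup>2)"
      using b by (simp add: divide_simps) (simp add: algebra_simps power2_eq_square)
    finally have "a\<^sup>2 * (b + 2) \<le> 0" using b by (simp add: field_simps)
    then have "a = 0" using b by (smt (verit) mult_pos_pos zero_less_power2)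
    then show ?thesis by (simp add: a_def)
  qed
  then show ?thesis using that F X by blast
qed

subsection \<open>Smooth functions\<close>

lemma grad_nth: "(\<phi> has_derivative D) (at x) \<Longrightarrow> grad \<phi> x $ i = D (axis i 1)"
  by (simp add: grad_def frechet_derivative_at[symmetric])

lemma Ck_SucD: "Ck (Suc k) \<phi> \<Longrightarrow> Ck k \<phi>"
  by (induction k arbitrary: \<phi>) (auto intro: differentiable_imp_continuous_on)

lemma Ck_differentiable: "Ck (Suc k) \<phi> \<Longrightarrow> \<phi> differentiable (at x)"
  by (auto simp: differentiable_on_def)

lemma Ck_has_derivative: "Ck (Suc k) \<phi> \<Longrightarrow> (\<phi> has_derivative frechet_derivative \<phi> (at x)) (at x)"
  using Ck_differentiable frechet_derivative_works by blast

lemma Ck_const: "Ck k (\<lambda>x. c)"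
proof (induction k arbitrary: c)
  case (Suc k)
  have "grad (\<lambda>x. c) x $ i = 0" for x i
    using grad_nth[OF has_derivative_const] by simp
  then show ?case using Suc by simp
qed simp

lemma grad_add:
  assumes "\<phi> differentiable (at x)" "\<psi> differentiable (at x)"
  shows "grad (\<lambda>x. \<phi> x + \<psi> x) x = grad \<phi> x + grad \<psi> x"
  by (rule vec_eq_iff[THEN iffD2])
    (use assms in \<open>auto simp: grad_nth[OF has_derivative_add] grad_nth frechet_derivative_works\<close>)

lemma grad_cmult:
  assumes "\<phi> differentiable (at x)"
  shows "grad (\<lambda>x. c * \<phi> x) x = c *\<^sub>R grad \<phi> x"
  by (rule vec_eq_iff[THEN iffD2])
    (use assms in \<open>auto simp: grad_nth[OF has_derivative_mult_right] grad_nth frechet_derivative_works\<close>)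

lemma grad_mult:
  assumes "\<phi> differentiable (at x)" "\<psi> differentiable (at x)"
  shows "grad (\<lambda>x. \<phi> x * \<psi> x) x = \<phi> x *\<^sub>R grad \<psi> x + \<psi> x *\<^sub>R grad \<phi> x"
  by (rule vec_eq_iff[THEN iffD2])
    (use assms in \<open>auto simp: grad_nth[OF has_derivative_mult] grad_nth frechet_derivative_works algebra_simps\<close>)

lemma grad_comp:
  assumes "\<phi> differentiable (at x)" "(a has_real_derivative a') (at (\<phi> x))"
  shows "grad (\<lambda>x. a (\<phi> x)) x = a' *\<^sub>R grad \<phi> x"
proof -
  have "((\<lambda>x. a (\<phi> x)) has_derivative (\<lambda>h. a' * frechet_derivative \<phi> (at x) h)) (at x)"
    using has_derivative_compose[OF assms(1)[unfolded frechet_derivative_works] assms(2)[unfolded has_field_derivative_def]]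
    by simp
  from grad_nth[OF this] show ?thesis
    by (simp add: vec_eq_iff grad_def)
qed

lemma Ck_add: "Ck k \<phi> \<Longrightarrow> Ck k \<psi> \<Longrightarrow> Ck k (\<lambda>x. \<phi> x + \<psi> x)"
proof (induction k arbitrary: \<phi> \<psi>)
  case (Suc k)
  have "(\<lambda>x. grad (\<lambda>x. \<phi> x + \<psi> x) x $ i) = (\<lambda>x. grad \<phi> x $ i + grad \<psi> x $ i)" for i
    using Suc.prems by (auto simp: grad_add differentiable_on_def)
  then show ?case using Suc by (auto simp: differentiable_on_def)
qed (auto intro: continuous_intros)

lemma Ck_mult: "Ck k \<phi> \<Longrightarrow> Ck k \<psi> \<Longrightarrow> Ck k (\<lambda>x. \<phi> x * \<psi> x)"
proof (induction k arbitrary: \<phi> \<psi>)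
  case (Suc k)
  have "(\<lambda>x. grad (\<lambda>x. \<phi> x * \<psi> x) x $ i) = (\<lambda>x. \<phi> x * grad \<psi> x $ i + \<psi> x * grad \<phi> x $ i)" for i
    using Suc.prems by (auto simp: grad_mult differentiable_on_def)
  moreover have "Ck k (\<lambda>x. \<phi> x * grad \<psi> x $ i + \<psi> x * grad \<phi> x $ i)" for i
    using Suc Ck_SucD[of k] by (intro Ck_add Suc.IH) auto
  ultimately show ?case using Suc.prems by (auto simp: differentiable_on_def)
qed (auto intro: continuous_intros)

lemma Ck_nth: "Ck k (\<lambda>x. x $ j)"
proof (cases k)
  case (Suc k)
  have d: "((\<lambda>x::plane. x $ j) has_derivative (\<lambda>x. x $ j)) (at x)" for x
    by (intro bounded_linear.has_derivative[OF bounded_linear_vec_nth] has_derivative_ident)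
  have "(\<lambda>x. grad (\<lambda>x. x $ j) x $ i) = (\<lambda>x. axis i 1 $ j)" for i
    using grad_nth[OF d] by auto
  then show ?thesis unfolding Suc using d Ck_const by (auto simp: differentiable_on_def differentiable_def)
qed (auto intro: continuous_intros)

section \<open>Smooth functions of one real variable\<close>

primrec Ck_real :: "nat \<Rightarrow> (real \<Rightarrow> real) \<Rightarrow> bool" where
  "Ck_real 0 a \<longleftrightarrow> continuous_on UNIV a"
| "Ck_real (Suc k) a \<longleftrightarrow> (\<exists>a'. (\<forall>t. (a has_real_derivative a' t) (at t)) \<and> Ck_real k a')"

lemma Ck_real_SucD: "Ck_real (Suc k) a \<Longrightarrow> Ck_real k a"
proof (induction k arbitrary: a)
  case 0
  then obtain a' where "\<And>t. (a has_real_derivative a' t) (at t)" by auto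
  then show ?case by (auto intro!: continuous_at_imp_continuous_on intro: DERIV_isCont)
next
  case (Suc k)
  then obtain a' where a: "\<forall>t. (a has_real_derivative a' t) (at t)" "Ck_real (Suc k) a'"
    by (metis Ck_real.simps(2))
  then have "Ck_real k a'" using Suc.IH by blast
  then show ?case using a by auto
qed

lemma Ck_real_const: "Ck_real k (\<lambda>t. c)"
proof (induction k arbitrary: c)
  case (Suc k) then show ?case by (auto intro!: exI[of _ "\<lambda>t. 0"])
qed simp

lemma Ck_real_add: "Ck_real k a \<Longrightarrow> Ck_real k b \<Longrightarrow> Ck_real k (\<lambda>t. a t + b t)"
proof (induction k arbitrary: a b)
  case (Suc k)
  then obtain a' b' where "\<forall>t. (a has_real_derivative a' t) (at t)" "Ck_real k a'"
     "\<forall>t. (b has_real_derivative b' t) (at t)" "Ck_real k b'" by auto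
  then show ?case using Suc.IH by (auto intro!: exI[of _ "\<lambda>t. a' t + b' t"] derivative_eq_intros)
qed (auto intro: continuous_intros)

lemma Ck_real_mult: "Ck_real k a \<Longrightarrow> Ck_real k b \<Longrightarrow> Ck_real k (\<lambda>t. a t * b t)"
proof (induction k arbitrary: a b)
  case (Suc k)
  then obtain a' b' where d: "\<forall>t. (a has_real_derivative a' t) (at t)" "Ck_real k a'"
     "\<forall>t. (b has_real_derivative b' t) (at t)" "Ck_real k b'" by auto
  have "Ck_real k (\<lambda>t. a t * b' t + a' t * b t)"
    using d Ck_real_SucD[OF Suc.prems(1)] Ck_real_SucD[OF Suc.prems(2)] by (intro Ck_real_add Suc.IH)
  moreover have "((\<lambda>t. a t * b t) has_real_derivative a t * b' t + a' t * b t) (at t)" for t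
    using d by (auto intro!: derivative_eq_intros)
  ultimately show ?case by (auto intro!: exI[of _ "\<lambda>t. a t * b' t + a' t * b t"])
qed (auto intro: continuous_intros)

lemma Ck_real_affine: "Ck_real k (\<lambda>t. c * t + d)"
proof (cases k)
  case (Suc k)
  have "((\<lambda>t. c * t + d) has_real_derivative c) (at t)" for t by (auto intro!: derivative_eq_intros)
  then show ?thesis using Ck_real_const by (auto simp: Suc intro!: exI[of _ "\<lambda>t. c"])
qed (auto intro!: continuous_intros)

lemma Ck_real_compose_affine: "Ck_real k a \<Longrightarrow> Ck_real k (\<lambda>t. a (c * t + d))"
proof (induction k arbitrary: a)
  case 0 then show ?case
    by (auto intro!: continuous_on_compose2[of UNIV a] continuous_intros)
next
  case (Suc k)
  then obtain a' where d: "\<forall>t. (a has_real_derivative a' t) (at t)" "Ck_real k a'" by auto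
  have "((\<lambda>t. a (c * t + d)) has_real_derivative a' (c * t + d) * c) (at t)" for t
    by (rule DERIV_chain2[where f=a]) (use d in \<open>auto intro!: derivative_eq_intros\<close>)
  then show ?case using Ck_real_mult[OF Suc.IH[OF d(2)] Ck_real_const[of k c]]
    by (auto intro!: exI[of _ "\<lambda>t. a' (c * t + d) * c"])
qed

lemma Ck_comp: "Ck_real k a \<Longrightarrow> Ck k \<phi> \<Longrightarrow> Ck k (\<lambda>x. a (\<phi> x))"
proof (induction k arbitrary: a)
  case 0 then show ?case by (auto intro!: continuous_on_compose2[of UNIV a])
next
  case (Suc k)
  then obtain a' where d: "\<And>t. (a has_real_derivative a' t) (at t)" "Ck_real k a'" by auto
  have g: "(\<lambda>x. grad (\<lambda>x. a (\<phi> x)) x $ i) = (\<lambda>x. a' (\<phi> x) * grad \<phi> x $ i)" for i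
    using grad_comp[OF Ck_differentiable[OF Suc.prems(2)] d(1)] by simp
  have "Ck k (\<lambda>x. a' (\<phi> x) * grad \<phi> x $ i)" for i
  proof (rule Ck_mult)
    show "Ck k (\<lambda>x. a' (\<phi> x))" using Suc.IH[OF d(2) Ck_SucD[OF Suc.prems(2)]] .
    show "Ck k (\<lambda>x. grad \<phi> x $ i)" using Suc.prems(2) by simp
  qed
  moreover have "(\<lambda>x. a (\<phi> x)) differentiable (at x)" for x
    using has_derivative_compose[OF Ck_has_derivative[OF Suc.prems(2)] d(1)[unfolded has_field_derivative_def]]
    by (auto simp: differentiable_def)
  ultimately show ?case by (simp add: g differentiable_on_def)
qed

definition smooth_real :: "(real \<Rightarrow> real) \<Rightarrow> bool" where
  "smooth_real a \<longleftrightarrow> (\<forall>k. Ck_real k a)"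

text \<open>Each order k comes with its own derivative; uniqueness identifies all of them with
  \<open>deriv a\<close>, so one derivative serves for every order.\<close>

lemma smooth_real_deriv:
  assumes "smooth_real a"
  obtains a' where "\<And>t. (a has_real_derivative a' t) (at t)" "smooth_real a'"
proof -
  have d: "(a has_real_derivative deriv a t) (at t)" for t
  proof -
    obtain a' where "\<And>t. (a has_real_derivative a' t) (at t)"
      using assms[unfolded smooth_real_def, rule_format, of "Suc 0"] by auto
    then show ?thesis using DERIV_imp_deriv by metis
  qed
  have "Ck_real k (deriv a)" for k
  proof -
    obtain a' where a': "\<And>t. (a has_real_derivative a' t) (at t)" "Ck_real k a'"
      using assms[unfolded smooth_real_def, rule_format, of "Suc k"] by auto
    then have "a' = deriv a" by (intro ext) (metis DERIV_imp_deriv)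
    with a' show ?thesis by simp
  qed
  then show ?thesis using that d by (auto simp: smooth_real_def)
qed

lemma smooth_real_antideriv:
  assumes "\<And>t. (a has_real_derivative a' t) (at t)" "smooth_real a'"
  shows "smooth_real a"
  unfolding smooth_real_def
proof
  fix k show "Ck_real k a"
  proof (cases k)
    case 0 then show ?thesis using assms by (auto intro!: continuous_at_imp_continuous_on DERIV_isCont)
  next
    case (Suc k) then show ?thesis using assms by (auto simp: smooth_real_def)
  qed
qed

lemma smooth_real_const: "smooth_real (\<lambda>t. c)"
  and smooth_real_add: "smooth_real a \<Longrightarrow> smooth_real b \<Longrightarrow> smooth_real (\<lambda>t. a t + b t)"
  and smooth_real_mult: "smooth_real a \<Longrightarrow> smooth_real b \<Longrightarrow> smooth_real (\<lambda>t. a t * b t)"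
  and smooth_real_compose_affine: "smooth_real a \<Longrightarrow> smooth_real (\<lambda>t. a (c * t + d))"
  by (auto simp: smooth_real_def Ck_real_const Ck_real_add Ck_real_mult Ck_real_compose_affine)

lemma smooth_real_continuous: "smooth_real a \<Longrightarrow> continuous_on UNIV a"
  unfolding smooth_real_def by (metis Ck_real.simps(1))

text \<open>The classical flat function exp(-1/t), together with its quotients by powers of t: the
  whole family is needed because differentiation maps it into itself, which lets the induction on
  the order of smoothness close.\<close>

definition expinv :: "nat \<Rightarrow> real \<Rightarrow> real" where
  "expinv m t = (if t > 0 then exp (- 1 / t) / t ^ m else 0)"

lemma power_div_fact_le_exp: "x \<ge> 0 \<Longrightarrow> x ^ n / fact n \<le> exp (x::real)"
proof -
  assume x: "x \<ge> 0"
  have s: "(\<lambda>n. x ^ n /\<^sub>R fact n) sums exp x" by (rule exp_converges)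
  have "sum (\<lambda>n. x ^ n /\<^sub>R fact n) {n} \<le> suminf (\<lambda>n. x ^ n /\<^sub>R fact n)"
    using s x by (intro sum_le_suminf) (auto simp: sums_iff)
  then show ?thesis using s by (simp add: sums_iff divide_inverse mult.commute)
qed

text \<open>A single term of the exponential series at 1/t, of index m + 2, beats the power t^m with
  a factor t^2 to spare. The quadratic bound makes the difference quotient at 0 tend to 0, which is
  the only delicate point of \<open>expinv_deriv\<close>.\<close>

lemma expinv_bound: "\<bar>expinv m t\<bar> \<le> fact (m + 2) * t\<^sup>2"
proof (cases "t > 0")
  case True
  have "(1/t) ^ (m+2) / fact (m+2) \<le> exp (1/t)"
    using True by (intro power_div_fact_le_exp) auto
  then have "exp (- (1/t)) * (1/t)^(m+2) \<le> fact (m+2)"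
    using True by (simp add: exp_minus divide_simps mult.commute)
  then have "exp (- (1/t)) * (1/t)^(m+2) * t\<^sup>2 \<le> fact (m+2) * t\<^sup>2"
    by (intro mult_right_mono) auto
  moreover have "exp (- (1/t)) * (1/t)^(m+2) * t\<^sup>2 = expinv m t"
    using True by (simp add: expinv_def power_add power_divide power2_eq_square)
  moreover have "expinv m t \<ge> 0" using True by (simp add: expinv_def)
  ultimately show ?thesis by simp
qed (simp add: expinv_def)

lemma expinv_deriv:
  "(expinv m has_real_derivative expinv (m + 2) t - of_nat m * expinv (m + 1) t) (at t)"
proof -
  consider "t > 0" | "t < 0" | "t = 0" by linarith
  then show ?thesis
  proof cases
    case 1
    have E: "((\<lambda>t. exp (- 1 / t)) has_real_derivative exp (- 1 / t) / (t * t)) (at t)"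
      using 1 by (auto intro!: derivative_eq_intros)
    have "((\<lambda>t. exp (- 1 / t) / t ^ m) has_real_derivative
        (exp (- 1 / t) / (t * t) * t ^ m - exp (- 1 / t) * (of_nat m * t ^ (m - 1))) / (t ^ m * t ^ m)) (at t)"
      using 1 DERIV_divide[OF E DERIV_pow[of m t UNIV]] by simp
    also have "(exp (- 1 / t) / (t * t) * t ^ m - exp (- 1 / t) * (of_nat m * t ^ (m - 1))) / (t ^ m * t ^ m)
        = expinv (m + 2) t - of_nat m * expinv (m + 1) t"
    proof -
      have "(e / (t * t) * (t * p) - e * (c * p)) / ((t * p) * (t * p)) = e / (t * (t * (t * p))) - c * (e / (t * (t * p)))"
        if "p > 0" for e c p using that 1 by (simp add: field_simps)
      from this[of "t ^ (m - 1)" "exp (- 1 / t)" "of_nat m"] show ?thesis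
        using 1 by (cases m) (simp_all add: expinv_def divide_divide_eq_left)
    qed
    finally have "((\<lambda>t. exp (- 1 / t) / t ^ m) has_real_derivative expinv (m + 2) t - of_nat m * expinv (m + 1) t) (at t)" .
    moreover have "\<forall>\<^sub>F s in nhds t. expinv m s = exp (- 1 / s) / s ^ m"
      by (rule eventually_mono[OF eventually_nhds_in_open[of "{0<..}" t]]) (use 1 in \<open>auto simp: expinv_def\<close>)
    ultimately show ?thesis by (subst DERIV_cong_ev[OF refl _ refl])
  next
    case 2
    have ev: "\<forall>\<^sub>F s in nhds t. expinv m s = 0"
      by (rule eventually_mono[OF eventually_nhds_in_open[of "{..<0}" t]]) (use 2 in \<open>auto simp: expinv_def\<close>)
    have "(expinv m has_real_derivative 0) (at t)" using DERIV_cong_ev[OF refl ev refl] by simp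
    then show ?thesis using 2 by (simp add: expinv_def[of _ t])
  next
    case 3
    have "((\<lambda>h. (expinv m (0 + h) - expinv m 0) / h) \<longlongrightarrow> 0) (at 0)"
    proof (rule Lim_null_comparison)
      show "\<forall>\<^sub>F h in at 0. norm ((expinv m (0 + h) - expinv m 0) / h) \<le> fact (m + 2) * \<bar>h\<bar>"
      proof (rule always_eventually, rule allI)
        fix h :: real
        show "norm ((expinv m (0 + h) - expinv m 0) / h) \<le> fact (m + 2) * \<bar>h\<bar>"
          using expinv_bound[of m h]
          by (cases "h = 0") (auto simp: expinv_def[of m 0] abs_divide pos_divide_le_eq power2_eq_square mult.assoc)
      qed
      show "((\<lambda>h. fact (m + 2) * \<bar>h\<bar>) \<longlongrightarrow> (0::real)) (at 0)"
        by (auto intro!: tendsto_eq_intros)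
    qed
    then show ?thesis using 3 by (simp add: DERIV_def expinv_def[of _ 0])
  qed
qed

lemma smooth_real_expinv: "smooth_real (expinv m)"
proof -
  have "Ck_real k (expinv m)" for k m
  proof (induction k arbitrary: m)
    case 0
    show ?case using expinv_deriv by (auto intro!: continuous_at_imp_continuous_on DERIV_isCont)
  next
    case (Suc k)
    have "Ck_real k (\<lambda>t. expinv (m + 2) t + (- of_nat m) * expinv (m + 1) t)"
      by (intro Ck_real_add Ck_real_mult Ck_real_const Suc)
    then show ?case using expinv_deriv[of m]
      by (auto intro!: exI[of _ "\<lambda>t. expinv (m + 2) t + (- of_nat m) * expinv (m + 1) t"])
  qed
  then show ?thesis by (simp add: smooth_real_def)
qed

lemma smooth_real_antiderivative:
  assumes a: "smooth_real a" and z: "\<And>t. t \<le> c \<Longrightarrow> a t = 0"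
  shows "((\<lambda>t. integral {c..t} a) has_real_derivative a t) (at t)"
    "smooth_real (\<lambda>t. integral {c..t} a)"
proof -
  have cont: "continuous_on S a" for S using smooth_real_continuous[OF a] continuous_on_subset by blast
  have d: "((\<lambda>t. integral {c..t} a) has_real_derivative a t) (at t)" for t
  proof -
    \<comment> \<open>A base point to the left of both \<open>c\<close> and \<open>t\<close>, so
      that \<open>t\<close> is interior to the interval of integration. Moving the base point
      changes nothing since \<open>a\<close> vanishes up to \<open>c\<close>; for s < c the interval
      from \<open>c\<close> to s is empty and its integral is 0, which agrees as well.\<close>
    define b where "b = min c t - 1"
    have eq: "integral {c..s} a = integral {b..s} a" if "s \<in> {b<..}" for s
    proof (cases "c \<le> s")
      case True
      have "integral {b..s} a = integral {b..c} a + integral {c..s} a"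
        using True cont by (intro Henstock_Kurzweil_Integration.integral_combine[symmetric] integrable_continuous_interval)
         (auto simp: b_def)
      moreover have "integral {b..c} a = 0" using z by (intro integral_unique has_integral_is_0) auto
      ultimately show ?thesis by simp
    next
      case False
      then have "integral {b..s} a = 0" using z by (intro integral_unique has_integral_is_0) auto
      with False show ?thesis by simp
    qed
    have "((\<lambda>s. integral {b..s} a) has_real_derivative a t) (at t within {b..t+1})"
      by (rule integral_has_real_derivative) (auto simp: cont b_def)
    then have "((\<lambda>s. integral {b..s} a) has_real_derivative a t) (at t)"
      by (subst (asm) at_within_interior) (auto simp: b_def interior_atLeastAtMost_real)
    moreover have "\<forall>\<^sub>F s in nhds t. integral {c..s} a = integral {b..s} a"
      by (rule eventually_mono[OF eventually_nhds_in_open[of "{b<..}" t] eq]) (auto simp: b_def)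
    ultimately show ?thesis by (subst DERIV_cong_ev[OF refl _ refl])
  qed
  show "((\<lambda>t. integral {c..t} a) has_real_derivative a t) (at t)" by (rule d)
  show "smooth_real (\<lambda>t. integral {c..t} a)" by (rule smooth_real_antideriv[OF d a])
qed

text \<open>The induction runs over all quotients by powers of t, since the derivative of a/t^m
  consists of a'/t^m and a/t^(m+1). Division by zero is harmless: the numerators vanish up to
  \<open>r\<close>, a neighbourhood of 0.\<close>

lemma smooth_real_divide:
  assumes a: "smooth_real a" and r: "r > 0" and z: "\<And>t. t \<le> r \<Longrightarrow> a t = 0"
  shows "smooth_real (\<lambda>t. a t / t)"
proof -
  have "Ck_real k (\<lambda>t. a t / t ^ m)" if "smooth_real a" "\<And>t. t \<le> r \<Longrightarrow> a t = 0" for k m a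
    using that
  proof (induction k arbitrary: a m)
    case 0
    have "continuous_on {0<..} (\<lambda>t. a t / t ^ m)"
      using smooth_real_continuous[OF 0(1)] by (intro continuous_intros) (auto intro: continuous_on_subset)
    moreover have "continuous_on {..<r} (\<lambda>t. a t / t ^ m)"
      by (rule continuous_on_eq[of _ "\<lambda>t. 0"]) (use 0(2) in auto)
    ultimately have "continuous_on ({0<..} \<union> {..<r}) (\<lambda>t. a t / t ^ m)"
      by (intro continuous_on_open_Un) auto
    also have "{0<..} \<union> {..<r} = UNIV" using r by auto
    finally show ?case by simp
  next
    case (Suc k)
    obtain a' where a': "\<And>t. (a has_real_derivative a' t) (at t)" "smooth_real a'"
      using smooth_real_deriv[OF Suc.prems(1)] by blast
    have cont: "continuous_on UNIV a'" using smooth_real_continuous a'(2) by blast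
    \<comment> \<open>The derivative vanishes on the open half line because \<open>a\<close> is
      locally constant there; the endpoint \<open>r\<close> follows by continuity from the
      left.\<close>
    have z': "a' t = 0" if "t \<le> r" for t
    proof -
      have lt: "a' t = 0" if "t < r" for t
      proof -
        have ev: "\<forall>\<^sub>F s in nhds t. a s = 0"
          by (rule eventually_mono[OF eventually_nhds_in_open[of "{..<r}" t]]) (use that Suc.prems(2) in auto)
        have "(a has_real_derivative 0) (at t)"
          using DERIV_cong_ev[OF refl ev refl] by simp
        then show ?thesis using a'(1) DERIV_unique by blast
      qed
      have "(a' \<longlongrightarrow> a' r) (at_left r)" using cont
        by (auto simp: continuous_on_eq_continuous_at isCont_def intro: tendsto_within_subset)
      moreover have "(a' \<longlongrightarrow> 0) (at_left r)"
        by (rule tendsto_eventually) (auto simp: eventually_at_left_field lt intro!: exI[of _ "r - 1"])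
      ultimately have "a' r = 0" using tendsto_unique trivial_limit_at_left_real by blast
      then show ?thesis using lt that by (cases "t = r") auto
    qed
    have d: "((\<lambda>t. a t / t ^ m) has_real_derivative a' t / t ^ m + (- of_nat m) * (a t / t ^ (m + 1))) (at t)" for t
    proof (cases "t < r")
      case True
      have ev: "\<forall>\<^sub>F s in nhds t. a s / s ^ m = 0"
        by (rule eventually_mono[OF eventually_nhds_in_open[of "{..<r}" t]]) (use True Suc.prems(2) in auto)
      show ?thesis using True z' Suc.prems(2) DERIV_cong_ev[OF refl ev refl] by simp
    next
      case False
      then have "t > 0" using r by simp
      then have "((\<lambda>t. a t / t ^ m) has_real_derivative
          (a' t * t ^ m - a t * (of_nat m * t ^ (m - 1))) / (t ^ m * t ^ m)) (at t)"
        using DERIV_divide[OF a'(1) DERIV_pow[of m t UNIV]] by simp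
      also have "(a' t * t ^ m - a t * (of_nat m * t ^ (m - 1))) / (t ^ m * t ^ m)
          = a' t / t ^ m + (- of_nat m) * (a t / t ^ (m + 1))"
      proof -
        have "(b * (t * p) - e * (c * p)) / ((t * p) * (t * p)) = b / (t * p) + (- c) * (e / (t * (t * p)))"
          if "p > 0" for b e c p using that \<open>t > 0\<close> by (simp add: field_simps)
        from this[of "t ^ (m - 1)" "a' t" "a t" "of_nat m"] show ?thesis
          using \<open>t > 0\<close> by (cases m) simp_all
      qed
      finally show ?thesis .
    qed
    have "Ck_real k (\<lambda>t. a' t / t ^ m + (- of_nat m) * (a t / t ^ (m + 1)))"
      using z' Suc.prems a' by (intro Ck_real_add Ck_real_mult Ck_real_const Suc.IH)
    then show ?case unfolding Ck_real.simps
      by (intro exI[of _ "\<lambda>t. a' t / t ^ m + (- of_nat m) * (a t / t ^ (m + 1))"] conjI allI d)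
  qed
  from this[of a _ 1] show ?thesis using a z by (auto simp: smooth_real_def)
qed

subsection \<open>Test functions\<close>

lemma prod_Basis_plane: "(\<Prod>b\<in>Basis. h b) = h (axis 1 1) * h (axis 2 (1::real) :: plane)"
proof -
  have B: "Basis = (\<lambda>i. axis i 1 :: plane) ` UNIV" by (auto simp: Basis_vec_def)
  have "(\<Prod>b\<in>Basis. h b) = (\<Prod>i\<in>(UNIV::2 set). h (axis i 1))"
    unfolding B by (subst prod.reindex) (auto simp: inj_on_def axis_eq_axis)
  then show ?thesis by (simp add: UNIV_2)
qed

lemma vector_axis: "(vector [a, b] :: plane) = a *\<^sub>R axis 1 1 + b *\<^sub>R axis 2 1"
  by (simp add: vec_eq_iff forall_2 axis_def)

lemma vector_measurable[measurable]: "(\<lambda>(a, b). vector [a, b] :: plane) \<in> borel_measurable borel"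
  unfolding vector_axis by (intro borel_measurable_continuous_onI) (auto simp: split_def intro!: continuous_intros)

text \<open>Lebesgue measure is determined by its values on boxes, and the box measures are products
  of side lengths. This is the bridge by which iterated integrals on pairs of reals become available
  for vectors with two components.\<close>

lemma lborel_plane: "(lborel :: plane measure) = distr (lborel \<Otimes>\<^sub>M lborel) borel (\<lambda>(a, b). vector [a, b])"
proof (rule lborel_eqI)
  fix l u :: plane assume le: "\<And>b. b \<in> Basis \<Longrightarrow> l \<bullet> b \<le> u \<bullet> b"
  have [measurable]: "(\<lambda>(a, b). vector [a, b] :: plane) \<in> borel_measurable (lborel \<Otimes>\<^sub>M lborel)"
    by (simp add: lborel_prod vector_measurable)
  have le': "l $ i \<le> u $ i" for i
    using le[of "axis i 1"] by (auto simp: Basis_vec_def inner_axis)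
  have "emeasure (distr (lborel \<Otimes>\<^sub>M lborel) borel (\<lambda>(a, b). vector [a, b] :: plane)) (box l u)
     = emeasure (lborel \<Otimes>\<^sub>M lborel) ({l$1<..<u$1} \<times> {l$2<..<u$2})"
    by (subst emeasure_distr) (auto simp: mem_box Basis_vec_def inner_axis forall_2 space_pair_measure intro!: arg_cong2[where f=emeasure])
  also have "\<dots> = ennreal ((u$1 - l$1) * (u$2 - l$2))"
    using le' by (subst lborel.emeasure_pair_measure_Times) (auto simp: ennreal_mult)
  also have "\<dots> = (\<Prod>b\<in>Basis. (u - l) \<bullet> b)"
    by (simp add: prod_Basis_plane inner_axis)
  finally show "emeasure (distr (lborel \<Otimes>\<^sub>M lborel) borel (\<lambda>(a, b). vector [a, b])) (box l u) = (\<Prod>b\<in>Basis. (u - l) \<bullet> b)" .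
qed simp

lemma vector_measurable_pair[measurable]: "(\<lambda>(a, b). vector [a, b] :: plane) \<in> borel_measurable (lborel \<Otimes>\<^sub>M lborel)"
  by (simp add: lborel_prod vector_measurable)

lemma nn_integral_plane:
  assumes [measurable]: "h \<in> borel_measurable borel"
  shows "(\<integral>\<^sup>+x. h x \<partial>(lebesgue :: plane measure)) = (\<integral>\<^sup>+a. \<integral>\<^sup>+b. h (vector [a, b]) \<partial>lborel \<partial>lborel)"
    and "(\<integral>\<^sup>+x. h x \<partial>(lebesgue :: plane measure)) = (\<integral>\<^sup>+b. \<integral>\<^sup>+a. h (vector [a, b]) \<partial>lborel \<partial>lborel)"
proof -
  have "(\<integral>\<^sup>+x. h x \<partial>lebesgue) = (\<integral>\<^sup>+x. h x \<partial>(lborel :: plane measure))"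
    by (simp add: nn_integral_completion)
  also have "\<dots> = (\<integral>\<^sup>+p. h (case p of (a, b) \<Rightarrow> vector [a, b]) \<partial>(lborel \<Otimes>\<^sub>M lborel))"
    by (subst lborel_plane) (simp add: nn_integral_distr)
  finally have eq: "(\<integral>\<^sup>+x. h x \<partial>lebesgue) = (\<integral>\<^sup>+p. h (case p of (a, b) \<Rightarrow> vector [a, b]) \<partial>(lborel \<Otimes>\<^sub>M lborel))" .
  show "(\<integral>\<^sup>+x. h x \<partial>(lebesgue :: plane measure)) = (\<integral>\<^sup>+a. \<integral>\<^sup>+b. h (vector [a, b]) \<partial>lborel \<partial>lborel)"
    unfolding eq by (subst lborel.nn_integral_fst[symmetric]) auto
  show "(\<integral>\<^sup>+x. h x \<partial>(lebesgue :: plane measure)) = (\<integral>\<^sup>+b. \<integral>\<^sup>+a. h (vector [a, b]) \<partial>lborel \<partial>lborel)"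
    unfolding eq by (subst lborel_pair.nn_integral_snd[symmetric]) auto
qed

lemma integral_plane:
  fixes h :: "plane \<Rightarrow> real"
  assumes h: "integrable lborel h"
  shows "(LINT x|lebesgue. h x) = (LINT a|lborel. LINT b|lborel. h (vector [a, b]))"
    and "(LINT x|lebesgue. h x) = (LINT b|lborel. LINT a|lborel. h (vector [a, b]))"
proof -
  have [measurable]: "h \<in> borel_measurable borel" using h by auto
  have "integrable (distr (lborel \<Otimes>\<^sub>M lborel) borel (\<lambda>(a, b). vector [a, b])) h"
    using h lborel_plane by simp
  then have int: "integrable (lborel \<Otimes>\<^sub>M lborel) (\<lambda>(a, b). h (vector [a, b]))"
    by (simp add: integrable_distr_eq split_def)
  have "(LINT x|lebesgue. h x) = (LINT x|lborel. h x)"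
    by (simp add: integral_completion)
  also have "\<dots> = (LINT p|(lborel \<Otimes>\<^sub>M lborel). (case p of (a, b) \<Rightarrow> h (vector [a, b])))"
    by (subst lborel_plane) (simp add: integral_distr split_def)
  finally have eq: "(LINT x|lebesgue. h x) = (LINT p|(lborel \<Otimes>\<^sub>M lborel). (case p of (a, b) \<Rightarrow> h (vector [a, b])))" .
  show "(LINT x|lebesgue. h x) = (LINT a|lborel. LINT b|lborel. h (vector [a, b]))"
    unfolding eq using lborel_pair.integral_fst'[OF int] by simp
  show "(LINT x|lebesgue. h x) = (LINT b|lborel. LINT a|lborel. h (vector [a, b]))"
    unfolding eq using lborel_pair.integral_snd[OF int] by simp
qed

section \<open>Calculus of test functions\<close>

lemma test_Ck: "\<phi> \<in> test_functions \<Longrightarrow> Ck k \<phi>"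
  by (simp add: test_functions_def)

lemma test_differentiable: "\<phi> \<in> test_functions \<Longrightarrow> \<phi> differentiable (at x)"
  using test_Ck Ck_differentiable by blast

lemma test_continuous: "\<phi> \<in> test_functions \<Longrightarrow> continuous_on UNIV \<phi>"
  using test_Ck[of \<phi> 0] by simp

lemma test_grad_Ck: "\<phi> \<in> test_functions \<Longrightarrow> Ck k (\<lambda>x. grad \<phi> x $ i)"
  using test_Ck[of \<phi> "Suc k"] by simp

lemma test_grad_continuous: "\<phi> \<in> test_functions \<Longrightarrow> continuous_on UNIV (grad \<phi>)"
  using test_grad_Ck[of \<phi> 0] continuous_on_vec_lambda[of UNIV "\<lambda>i x. grad \<phi> x $ i"] by simp

lemma grad_outside_supp:
  assumes "x \<notin> supp \<phi>" shows "\<phi> x = 0" "grad \<phi> x = 0"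
proof -
  have z: "\<phi> y = 0" if "y \<in> - supp \<phi>" for y
    using that closure_subset[of "{x. \<phi> x \<noteq> 0}"] by (auto simp: supp_def)
  then show "\<phi> x = 0" using assms by simp
  have "(\<phi> has_derivative (\<lambda>h. 0)) (at x)"
  proof (rule has_derivative_transform_within_open)
    show "((\<lambda>y. 0) has_derivative (\<lambda>h. 0)) (at x)" by (rule has_derivative_const)
    show "open (- supp \<phi>)" by (simp add: supp_def open_Compl)
  qed (use assms z in auto)
  then show "grad \<phi> x = 0" by (simp add: vec_eq_iff grad_nth)
qed

lemma test_functionsI:
  assumes "\<And>k. Ck k \<phi>" "\<And>x. norm x > M \<Longrightarrow> \<phi> x = 0"
  shows "\<phi> \<in> test_functions"
proof -
  have "supp \<phi> \<subseteq> cball 0 M"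
    unfolding supp_def by (rule closure_minimal[OF _ closed_cball]) (use assms(2) in \<open>fastforce simp: not_le[symmetric]\<close>)
  then have "compact (supp \<phi>)"
    using bounded_subset[OF bounded_cball] by (simp add: compact_eq_bounded_closed supp_def)
  with assms show ?thesis by (simp add: test_functions_def)
qed

lemma test_bounded:
  assumes "\<phi> \<in> test_functions"
  obtains M B where "M > 0" "B > 0" "\<And>x. norm x \<ge> M \<Longrightarrow> \<phi> x = 0 \<and> grad \<phi> x = 0" "\<And>x. \<bar>\<phi> x\<bar> \<le> B" "\<And>x. norm (grad \<phi> x) \<le> B"
proof -
  have c: "compact (supp \<phi>)" using assms by (simp add: test_functions_def)
  then obtain M where M: "M > 0" "\<And>x. x \<in> supp \<phi> \<Longrightarrow> norm x < M"
    using bounded_pos_less compact_imp_bounded by metis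
  have "bounded (\<phi> ` supp \<phi>)" "bounded (grad \<phi> ` supp \<phi>)"
    using c test_continuous[OF assms] test_grad_continuous[OF assms]
    by (meson compact_continuous_image compact_imp_bounded continuous_on_subset subset_UNIV)+
  then obtain B1 B2 where B: "B1 > 0" "B2 > 0" "\<And>x. x \<in> supp \<phi> \<Longrightarrow> \<bar>\<phi> x\<bar> \<le> B1" "\<And>x. x \<in> supp \<phi> \<Longrightarrow> norm (grad \<phi> x) \<le> B2"
    unfolding bounded_pos by fastforce
  have "\<bar>\<phi> x\<bar> \<le> max B1 B2" "norm (grad \<phi> x) \<le> max B1 B2" for x
    using B grad_outside_supp[of x \<phi>] by (cases "x \<in> supp \<phi>"; fastforce simp: le_max_iff_disj)+
  moreover have "\<phi> x = 0 \<and> grad \<phi> x = 0" if "norm x \<ge> M" for x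
    using M(2)[of x] that grad_outside_supp[of x \<phi>] by (cases "x \<in> supp \<phi>") auto
  ultimately show ?thesis using that[of M "max B1 B2"] M B by auto
qed

lemma test_add: "\<phi> \<in> test_functions \<Longrightarrow> \<psi> \<in> test_functions \<Longrightarrow> (\<lambda>x. \<phi> x + \<psi> x) \<in> test_functions"
  and test_mult: "\<phi> \<in> test_functions \<Longrightarrow> (\<And>k. Ck k \<kappa>) \<Longrightarrow> (\<lambda>x. \<phi> x * \<kappa> x) \<in> test_functions"
proof -
  assume p: "\<phi> \<in> test_functions"
  obtain M where M: "\<And>x. norm x \<ge> M \<Longrightarrow> \<phi> x = 0" using test_bounded[OF p] by metis
  {
    assume q: "\<psi> \<in> test_functions"
    obtain N where N: "\<And>x. norm x \<ge> N \<Longrightarrow> \<psi> x = 0" using test_bounded[OF q] by metis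
    show "(\<lambda>x. \<phi> x + \<psi> x) \<in> test_functions"
      by (rule test_functionsI[where M="max M N"]) (use p q M N in \<open>auto intro: Ck_add test_Ck\<close>)
  }
  {
    assume q: "\<And>k. Ck k \<kappa>"
    show "(\<lambda>x. \<phi> x * \<kappa> x) \<in> test_functions"
      by (rule test_functionsI[where M=M]) (use p q M in \<open>auto intro: Ck_mult test_Ck\<close>)
  }
qed

lemma test_cmult: "\<phi> \<in> test_functions \<Longrightarrow> (\<lambda>x. c * \<phi> x) \<in> test_functions"
  using test_mult[of \<phi> "\<lambda>x. c"] Ck_const by (simp add: mult.commute)

lemma test_zero: "(\<lambda>x. 0) \<in> test_functions"
  by (rule test_functionsI[where M=0]) (auto simp: Ck_const)

lemma test_diff: "\<phi> \<in> test_functions \<Longrightarrow> \<psi> \<in> test_functions \<Longrightarrow> (\<lambda>x. \<phi> x - \<psi> x) \<in> test_functions"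
  using test_add[OF _ test_cmult[of \<psi> "-1"]] by simp

lemma test_grad: "\<phi> \<in> test_functions \<Longrightarrow> (\<lambda>x. grad \<phi> x $ i) \<in> test_functions"
proof -
  assume p: "\<phi> \<in> test_functions"
  obtain M where "\<And>x. norm x \<ge> M \<Longrightarrow> \<phi> x = 0 \<and> grad \<phi> x = 0" using test_bounded[OF p] by metis
  then show "(\<lambda>x. grad \<phi> x $ i) \<in> test_functions"
    by (intro test_functionsI[where M=M]) (simp_all add: test_grad_Ck[OF p])
qed

lemma integrable_continuous_compact:
  fixes h :: "plane \<Rightarrow> 'a::euclidean_space"
  assumes "continuous_on UNIV h" "\<And>x. norm x > M \<Longrightarrow> h x = 0"
  shows "integrable lborel h" "integrable lebesgue h"
proof -
  have "integrable lborel (\<lambda>x. indicator (cball 0 M) x *\<^sub>R h x)"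
    by (rule borel_integrable_compact) (use assms in \<open>auto intro: continuous_on_subset\<close>)
  also have "(\<lambda>x. indicator (cball 0 M) x *\<^sub>R h x) = h"
    using assms(2) by (auto simp: indicator_def not_le)
  finally show "integrable lborel h" .
  then show "integrable lebesgue h"
    by (simp add: integrable_completion)
qed

lemma continuous_measurable_lebesgue:
  fixes h :: "plane \<Rightarrow> 'a::euclidean_space"
  shows "continuous_on UNIV h \<Longrightarrow> h \<in> borel_measurable lebesgue"
  by (intro measurable_completion) (simp add: borel_measurable_continuous_onI)

lemma test_L2: "\<phi> \<in> test_functions \<Longrightarrow> \<phi> \<in> L2"
  and test_grad_L2: "\<phi> \<in> test_functions \<Longrightarrow> grad \<phi> \<in> L2"
proof -
  assume p: "\<phi> \<in> test_functions"
  obtain M where M: "\<And>x. norm x \<ge> M \<Longrightarrow> \<phi> x = 0 \<and> grad \<phi> x = 0" using test_bounded[OF p] by metis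
  have c: "continuous_on UNIV \<phi>" "continuous_on UNIV (grad \<phi>)" using p by (auto simp: test_continuous test_grad_continuous)
  show "\<phi> \<in> L2"
    by (intro L2I continuous_measurable_lebesgue c integrable_continuous_compact[where M=M] continuous_intros)
      (use M in auto)
  show "grad \<phi> \<in> L2"
    by (intro L2I continuous_measurable_lebesgue c integrable_continuous_compact[where M=M] continuous_intros)
      (use M in auto)
qed

lemma has_derivative_vector1: "((\<lambda>a. vector [a, b] :: plane) has_derivative (\<lambda>h. h *\<^sub>R axis 1 1)) (at a)"
  and has_derivative_vector2: "((\<lambda>b. vector [a, b] :: plane) has_derivative (\<lambda>h. h *\<^sub>R axis 2 1)) (at b)"
  unfolding vector_axis by (auto intro!: derivative_eq_intros)

lemma partial_derivative:
  assumes "\<phi> differentiable (at (vector [a, b]))"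
  shows "((\<lambda>a. \<phi> (vector [a, b])) has_real_derivative grad \<phi> (vector [a, b]) $ 1) (at a)"
    "((\<lambda>b. \<phi> (vector [a, b])) has_real_derivative grad \<phi> (vector [a, b]) $ 2) (at b)"
proof -
  let ?D = "frechet_derivative \<phi> (at (vector [a, b]))"
  have d: "(\<phi> has_derivative ?D) (at (vector [a, b]))" using assms frechet_derivative_works by blast
  have l: "?D (h *\<^sub>R x) = h * ?D x" for h x
    using linear_cmul[OF has_derivative_linear[OF d]] by simp
  show "((\<lambda>a. \<phi> (vector [a, b])) has_real_derivative grad \<phi> (vector [a, b]) $ 1) (at a)"
    using has_derivative_compose[OF has_derivative_vector1 d]
    by (simp add: has_field_derivative_def l grad_def mult.commute[of _ "?D _"])
  show "((\<lambda>b. \<phi> (vector [a, b])) has_real_derivative grad \<phi> (vector [a, b]) $ 2) (at b)"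
    using has_derivative_compose[OF has_derivative_vector2 d]
    by (simp add: has_field_derivative_def l grad_def mult.commute[of _ "?D _"])
qed

lemma norm_vector_ge: "\<bar>a\<bar> \<le> norm (vector [a, b] :: plane)" "\<bar>b\<bar> \<le> norm (vector [a, b] :: plane)"
  using component_le_norm_cart[of "vector [a, b] :: plane" 1] component_le_norm_cart[of "vector [a, b] :: plane" 2]
  by simp_all

lemma continuous_on_vector: "continuous_on S (\<lambda>a. vector [a, b] :: plane)" "continuous_on S (\<lambda>b. vector [a, b] :: plane)"
  unfolding vector_axis by (intro continuous_intros)+

lemma integral_real_derivative_0:
  fixes F F' :: "real \<Rightarrow> real"
  assumes d: "\<And>t. (F has_real_derivative F' t) (at t)" and c: "continuous_on UNIV F'"
    and z: "\<And>t. \<bar>t\<bar> \<ge> M \<Longrightarrow> F t = 0 \<and> F' t = 0" and M: "M > 0"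
  shows "(LINT t|lborel. F' t) = 0"
proof -
  have "has_bochner_integral lborel (\<lambda>x. F' x * indicator {- M .. M} x) (F M - F (- M))"
    by (rule has_bochner_integral_FTC_Icc_real)
      (use d c M in \<open>auto simp: continuous_on_eq_continuous_at intro: DERIV_subset\<close>)
  then have "(LINT t|lborel. F' t * indicator {- M .. M} t) = 0"
    using z[of M] z[of "- M"] M by (simp add: has_bochner_integral_iff)
  moreover have "F' t * indicator {- M .. M} t = F' t" for t
    using z[of t] by (cases "\<bar>t\<bar> \<ge> M") (auto simp: indicator_def)
  ultimately show ?thesis by simp
qed

text \<open>The order of integration is chosen so that the inner integral runs in direction i, where
  the fundamental theorem of calculus gives 0 by compact support.\<close>

lemma integral_grad_0:
  assumes p: "\<phi> \<in> test_functions"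
  shows "(LINT x|lebesgue. grad \<phi> x $ i) = 0"
proof -
  obtain M where M: "M > 0" "\<And>x. norm x \<ge> M \<Longrightarrow> \<phi> x = 0 \<and> grad \<phi> x = 0" using test_bounded[OF p] by metis
  have c: "continuous_on UNIV (\<lambda>x. grad \<phi> x $ i)" for i using test_grad_Ck[OF p, of 0] by simp
  have int: "integrable lborel (\<lambda>x. grad \<phi> x $ i)" for i
    using M by (intro integrable_continuous_compact(1)[OF c, of M]) auto
  have z: "\<bar>a\<bar> \<ge> M \<or> \<bar>b\<bar> \<ge> M \<Longrightarrow> \<phi> (vector [a, b]) = 0 \<and> grad \<phi> (vector [a, b]) = 0" for a b
    using M(2)[of "vector [a, b]"] norm_vector_ge(1)[of a b] norm_vector_ge(2)[of b a] by linarith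
  have "i = 1 \<or> i = 2" using exhaust_2 by blast
  then show ?thesis
  proof
    assume i: "i = 1"
    have "(LINT a|lborel. grad \<phi> (vector [a, b]) $ 1) = 0" for b
    proof (rule integral_real_derivative_0)
      show "((\<lambda>a. \<phi> (vector [a, b])) has_real_derivative grad \<phi> (vector [t, b]) $ 1) (at t)" for t
        by (intro partial_derivative test_differentiable p)
      show "continuous_on UNIV (\<lambda>x. grad \<phi> (vector [x, b]) $ 1)"
        by (rule continuous_on_compose2[OF c continuous_on_vector(1)]) auto
    qed (use z M in auto)
    then show ?thesis using i integral_plane(2)[OF int[of i]] by simp
  next
    assume i: "i = 2"
    have "(LINT b|lborel. grad \<phi> (vector [a, b]) $ 2) = 0" for a
    proof (rule integral_real_derivative_0)
      show "((\<lambda>b. \<phi> (vector [a, b])) has_real_derivative grad \<phi> (vector [a, t]) $ 2) (at t)" for t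
        by (intro partial_derivative test_differentiable p)
      show "continuous_on UNIV (\<lambda>x. grad \<phi> (vector [a, x]) $ 2)"
        by (rule continuous_on_compose2[OF c continuous_on_vector(2)]) auto
    qed (use z M in auto)
    then show ?thesis using i integral_plane(1)[OF int[of i]] by simp
  qed
qed

lemma continuous_L1_loc: "continuous_on UNIV U \<Longrightarrow> U \<in> L1_loc"
  unfolding L1_loc_def set_integrable_def
proof (safe intro!: continuous_measurable_lebesgue)
  fix K :: "plane set" assume U: "continuous_on UNIV U" "compact K"
  have "integrable lborel (\<lambda>x. indicat_real K x *\<^sub>R U x)"
    using U by (intro borel_integrable_compact) (auto intro: continuous_on_subset)
  then show "integrable lebesgue (\<lambda>x. indicat_real K x *\<^sub>R U x)"
    by (subst integrable_completion) (auto dest: borel_measurable_integrable)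
qed

text \<open>Integration by parts: the product of the two test functions is again a test function, so
  the integral of its gradient vanishes, and the product rule splits that integral.\<close>

lemma test_weak_grad:
  assumes p: "\<phi> \<in> test_functions"
  shows "has_weak_grad \<phi> (grad \<phi>)"
  unfolding has_weak_grad_def
proof (intro conjI ballI allI)
  show "\<phi> \<in> L1_loc" "grad \<phi> \<in> L1_loc"
    using p by (auto intro: continuous_L1_loc test_continuous test_grad_continuous)
  fix \<psi> i assume q: "\<psi> \<in> test_functions"
  have g: "grad (\<lambda>x. \<psi> x * \<phi> x) x = \<psi> x *\<^sub>R grad \<phi> x + \<phi> x *\<^sub>R grad \<psi> x" for x
    by (intro grad_mult test_differentiable p q)
  have "(LINT x|lebesgue. grad (\<lambda>x. \<psi> x * \<phi> x) x $ i) = 0"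
    by (intro integral_grad_0 test_mult test_Ck p q)
  then have "(LINT x|lebesgue. (grad \<psi> x $ i) * \<phi> x + \<psi> x * grad \<phi> x $ i) = 0"
    unfolding g by (simp add: mult.commute[of "\<phi> _"] add.commute[of "\<psi> _ * _"])
  moreover have "integrable lebesgue (\<lambda>x. (grad \<psi> x $ i) * \<phi> x)" "integrable lebesgue (\<lambda>x. \<psi> x * grad \<phi> x $ i)"
    using integrable_inner_L2[OF test_L2[OF test_grad[OF q]] test_L2[OF p]]
      integrable_inner_L2[OF test_L2[OF q] test_L2[OF test_grad[OF p]]] by simp_all
  ultimately have "(LINT x|lebesgue. (grad \<psi> x $ i) * \<phi> x) + (LINT x|lebesgue. \<psi> x * grad \<phi> x $ i) = 0"
    by simp
  then show "(LINT x|lebesgue. (grad \<psi> x $ i) *\<^sub>R \<phi> x) = - (LINT x|lebesgue. \<psi> x *\<^sub>R (grad \<phi> x $ i))"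
    by simp
qed

lemma test_H1: "\<phi> \<in> test_functions \<Longrightarrow> \<phi> \<in> H1"
  using test_L2 test_grad_L2 test_weak_grad by (auto simp: H1_def)

subsection \<open>Weak gradients\<close>

text \<open>The positive and negative parts of \<open>g\<close> are densities of two measures that
  agree on boxes, an intersection-stable generator of the Borel sets. The measures therefore
  coincide, hence so do the densities almost everywhere; a positive part equal to the negative part
  is 0.\<close>

lemma AE_0_if_box_integrals_0:
  fixes g :: "'a::euclidean_space \<Rightarrow> real"
  assumes g: "integrable lborel g"
    and box: "\<And>l u. (LINT x|lborel. indicator (box l u) x * g x) = 0"
  shows "AE x in lborel. g x = 0"
proof -
  have [measurable]: "g \<in> borel_measurable borel" using g by auto
  define p q where "p x = max (g x) 0" and "q x = max (- g x) 0" for x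
  have [measurable]: "p \<in> borel_measurable borel" "q \<in> borel_measurable borel"
    unfolding p_def q_def by measurable
  have int: "integrable lborel p" "integrable lborel q" unfolding p_def q_def using g by auto
  have intb: "integrable lborel (\<lambda>x. indicator A x * p x)" "integrable lborel (\<lambda>x. indicator A x * q x)" if "A \<in> sets borel" for A
    using that integrable_mult_indicator[OF _ int(1), of A] integrable_mult_indicator[OF _ int(2), of A] by auto
  have em: "emeasure (density lborel p) A = ennreal (LINT x|lborel. indicator A x * p x)"
     "emeasure (density lborel q) A = ennreal (LINT x|lborel. indicator A x * q x)" if A[measurable]: "A \<in> sets borel" for A
  proof -
    have "emeasure (density lborel p) A = (\<integral>\<^sup>+x. ennreal (indicator A x * p x) \<partial>lborel)"
      by (subst emeasure_density) (auto intro!: nn_integral_cong simp: indicator_def)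
    also have "\<dots> = ennreal (LINT x|lborel. indicator A x * p x)"
      by (intro nn_integral_eq_integral intb A) (auto simp: p_def)
    finally show "emeasure (density lborel p) A = ennreal (LINT x|lborel. indicator A x * p x)" .
    have "emeasure (density lborel q) A = (\<integral>\<^sup>+x. ennreal (indicator A x * q x) \<partial>lborel)"
      by (subst emeasure_density) (auto intro!: nn_integral_cong simp: indicator_def)
    also have "\<dots> = ennreal (LINT x|lborel. indicator A x * q x)"
      by (intro nn_integral_eq_integral intb A) (auto simp: q_def)
    finally show "emeasure (density lborel q) A = ennreal (LINT x|lborel. indicator A x * q x)" .
  qed
  have "density lborel p = density lborel q"
  proof (rule measure_eqI_generator_eq)
    let ?E = "range (\<lambda>(a, b). box a b::'a set)"
    show "Int_stable ?E"
      by (auto simp: Int_stable_def box_Int_box)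
    show "?E \<subseteq> Pow UNIV" "sets (density lborel p) = sigma_sets UNIV ?E" "sets (density lborel q) = sigma_sets UNIV ?E"
      by (simp_all add: borel_eq_box)
    let ?A = "\<lambda>n::nat. box (- (real n *\<^sub>R One)) (real n *\<^sub>R One) :: 'a set"
    show "range ?A \<subseteq> ?E" "(\<Union>i. ?A i) = UNIV"
      unfolding UN_box_eq_UNIV by auto
    show "emeasure (density lborel p) (?A i) \<noteq> \<infinity>" for i by (simp add: em)
    show "emeasure (density lborel p) X = emeasure (density lborel q) X" if XE: "X \<in> ?E" for X
    proof -
      obtain l u where X: "X = box l u" using XE by auto
      have "(LINT x|lborel. indicator X x * p x) - (LINT x|lborel. indicator X x * q x)
          = (LINT x|lborel. indicator X x * p x - indicator X x * q x)"
        by (intro Bochner_Integration.integral_diff[symmetric] intb) (simp_all add: X)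
      also have "\<dots> = (LINT x|lborel. indicator (box l u) x * g x)"
        unfolding X by (intro Bochner_Integration.integral_cong) (auto simp: p_def q_def indicator_def)
      finally show ?thesis using box X by (simp add: em)
    qed
  qed
  then have "AE x in lborel. ennreal (p x) = ennreal (q x)"
    by (subst (asm) sigma_finite_measure.density_unique_iff[OF sigma_finite_lborel]) auto
  then show ?thesis
    by eventually_elim (auto simp: p_def q_def max_def split: if_splits)
qed

lemma L1_loc_measurable: "U \<in> L1_loc \<Longrightarrow> U \<in> borel_measurable lebesgue"
  by (simp add: L1_loc_def)

lemma L1_loc_integrable:
  fixes U :: "plane \<Rightarrow> 'a::euclidean_space"
  assumes U: "U \<in> L1_loc" and h: "h \<in> borel_measurable lebesgue"
    and B: "\<And>x. \<bar>h x\<bar> \<le> B" and M: "\<And>x. norm x > M \<Longrightarrow> h x = 0"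
  shows "integrable lebesgue (\<lambda>x. h x *\<^sub>R U x)"
proof (rule Bochner_Integration.integrable_bound)
  have "integrable lebesgue (\<lambda>x. indicat_real (cball 0 M) x *\<^sub>R U x)"
    using U by (auto simp: L1_loc_def set_integrable_def)
  then show "integrable lebesgue (\<lambda>x. B *\<^sub>R (indicat_real (cball 0 M) x *\<^sub>R U x))"
    by (rule integrable_scaleR_right)
  show "(\<lambda>x. h x *\<^sub>R U x) \<in> borel_measurable lebesgue" using h L1_loc_measurable[OF U] by measurable
  have "norm (h x *\<^sub>R U x) \<le> norm (B *\<^sub>R (indicat_real (cball 0 M) x *\<^sub>R U x))" for x
    using B[of x] M[of x] by (auto simp: indicator_def intro!: mult_right_mono)
  then show "AE x in lebesgue. norm (h x *\<^sub>R U x) \<le> norm (B *\<^sub>R (indicat_real (cball 0 M) x *\<^sub>R U x))" by simp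
qed

lemma L1_loc_test_integrable:
  assumes "U \<in> L1_loc" "\<phi> \<in> test_functions"
  shows "integrable lebesgue (\<lambda>x. \<phi> x *\<^sub>R U x)"
proof -
  obtain M B where "\<And>x. norm x \<ge> M \<Longrightarrow> \<phi> x = 0" "\<And>x. \<bar>\<phi> x\<bar> \<le> B" using test_bounded[OF assms(2)] by metis
  then show ?thesis using test_continuous[OF assms(2)]
    by (intro L1_loc_integrable[of _ _ B M] assms continuous_measurable_lebesgue) auto
qed

section \<open>Bumps, their tensor products and the fundamental lemma\<close>

definition bump_real :: "(real \<Rightarrow> real) \<Rightarrow> bool" where
  "bump_real a \<longleftrightarrow> smooth_real a \<and> (\<exists>M. \<forall>t. \<bar>t\<bar> \<ge> M \<longrightarrow> a t = 0)"

lemma bump_realE: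
  assumes "bump_real a"
  obtains M where "M > 0" "\<And>t. \<bar>t\<bar> \<ge> M \<Longrightarrow> a t = 0" "smooth_real a"
proof -
  obtain M where "\<And>t. \<bar>t\<bar> \<ge> M \<Longrightarrow> a t = 0" using assms by (auto simp: bump_real_def)
  then have "\<And>t. \<bar>t\<bar> \<ge> \<bar>M\<bar> + 1 \<Longrightarrow> a t = 0" by auto
  then show ?thesis using that[of "\<bar>M\<bar> + 1"] assms by (auto simp: bump_real_def)
qed

lemma norm_plane_gt: "norm (x::plane) > M + N \<Longrightarrow> \<bar>x $ 1\<bar> \<ge> M \<or> \<bar>x $ 2\<bar> \<ge> N"
  using norm_le_l1_cart[of x] by (auto simp: UNIV_2)

lemma tensor_test:
  assumes "bump_real a" "bump_real b"
  shows "(\<lambda>x. a (x $ 1) * b (x $ 2)) \<in> test_functions"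
proof -
  obtain M where M: "\<And>t. \<bar>t\<bar> \<ge> M \<Longrightarrow> a t = 0" "smooth_real a" using assms(1) bump_realE by metis
  obtain N where N: "\<And>t. \<bar>t\<bar> \<ge> N \<Longrightarrow> b t = 0" "smooth_real b" using assms(2) bump_realE by metis
  show ?thesis
  proof (rule test_functionsI[where M="M + N"])
    show "Ck k (\<lambda>x. a (x $ 1) * b (x $ 2))" for k
      using M(2) N(2) by (intro Ck_mult Ck_comp[OF _ Ck_nth]) (auto simp: smooth_real_def)
    show "norm x > M + N \<Longrightarrow> a (x $ 1) * b (x $ 2) = 0" for x :: plane
      using norm_plane_gt[of M N x] M(1) N(1) by auto
  qed
qed

lemma nth_has_derivative: "((\<lambda>x::plane. x $ j) has_derivative (\<lambda>x. x $ j)) (at x)"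
  by (intro bounded_linear.has_derivative[OF bounded_linear_vec_nth] has_derivative_ident)

lemma nth_differentiable: "(\<lambda>x::plane. x $ j) differentiable (at x)"
  using nth_has_derivative differentiable_def by blast

lemma grad_coord: "grad (\<lambda>x. x $ j) x = axis j 1"
  by (simp add: vec_eq_iff grad_nth[OF nth_has_derivative] axis_def)

lemma comp_differentiable:
  assumes "\<phi> differentiable (at x)" "(a has_real_derivative a') (at (\<phi> x))"
  shows "(\<lambda>x. a (\<phi> x)) differentiable (at x)"
  using has_derivative_compose[OF assms(1)[unfolded frechet_derivative_works] assms(2)[unfolded has_field_derivative_def]]
  by (auto simp: differentiable_def)

lemma grad_tensor:
  assumes "(a has_real_derivative a') (at (x $ 1))" "(b has_real_derivative b') (at (x $ 2))"
  shows "grad (\<lambda>x. a (x $ 1) * b (x $ 2)) x $ 1 = a' * b (x $ 2)"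
    "grad (\<lambda>x. a (x $ 1) * b (x $ 2)) x $ 2 = a (x $ 1) * b'"
  using grad_mult[OF comp_differentiable[OF nth_differentiable assms(1)] comp_differentiable[OF nth_differentiable assms(2)]]
    grad_comp[OF nth_differentiable assms(1)] grad_comp[OF nth_differentiable assms(2)]
  by (simp_all add: grad_coord axis_def)

text \<open>As \<open>n\<close> grows, \<open>pulse n c d\<close> converges to the indicator of the open interval from \<open>c\<close> to \<open>d\<close>.\<close>

definition pulse :: "real \<Rightarrow> real \<Rightarrow> real \<Rightarrow> real \<Rightarrow> real" where
  "pulse n c d t = expinv 0 (n * t + (- n * c)) * expinv 0 (- n * t + n * d)"

lemma expinv_0_bounds: "0 \<le> expinv 0 t" "expinv 0 t \<le> 1"
  by (auto simp: expinv_def)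

lemma pulse_bounds: "0 \<le> pulse n c d t" "pulse n c d t \<le> 1"
  using expinv_0_bounds by (auto simp: pulse_def intro!: mult_le_one)

lemma pulse_eq_0: "n > 0 \<Longrightarrow> t \<notin> {c<..<d} \<Longrightarrow> pulse n c d t = 0"
  by (auto simp: pulse_def expinv_def not_less mult_le_cancel_left_pos algebra_simps)

lemma pulse_pos: "n > 0 \<Longrightarrow> t \<in> {c<..<d} \<Longrightarrow> pulse n c d t > 0"
  by (auto simp: pulse_def expinv_def algebra_simps)

lemma pulse_smooth: "smooth_real (pulse n c d)"
proof -
  have "smooth_real (\<lambda>t. expinv 0 (n * t + (- n * c)) * expinv 0 ((- n) * t + n * d))"
    by (intro smooth_real_mult smooth_real_compose_affine smooth_real_expinv)
  then show ?thesis by (simp add: pulse_def[abs_def])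
qed

lemma pulse_bump: "n > 0 \<Longrightarrow> bump_real (pulse n c d)"
  unfolding bump_real_def
  by (intro conjI pulse_smooth exI[of _ "max \<bar>c\<bar> \<bar>d\<bar>"] allI impI pulse_eq_0) auto

text \<open>Inside the interval both factors have the form exp(-1/(n s)) with s > 0 fixed and tend
  to 1; outside, the pulse is 0 for every positive n, whence the shift to
  \<open>Suc n\<close>.\<close>

lemma pulse_tendsto: "(\<lambda>n. pulse (real (Suc n)) c d t) \<longlonglongrightarrow> indicator {c<..<d} t"
proof (cases "t \<in> {c<..<d}")
  case False
  then show ?thesis using pulse_eq_0[of "real (Suc _)" t c d] by (simp del: of_nat_Suc)
next
  case True
  have lim: "(\<lambda>n. exp (- (1 / s) * (1 / real (Suc n)))) \<longlonglongrightarrow> 1" for s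
  proof -
    have "(\<lambda>n. exp (- (1 / s) * inverse (real (Suc n)))) \<longlonglongrightarrow> exp (- (1 / s) * 0)"
      by (intro tendsto_intros LIMSEQ_inverse_real_of_nat)
    then show ?thesis by (simp add: inverse_eq_divide)
  qed
  have "pulse (real (Suc n)) c d t
      = exp (- (1 / (t - c)) * (1 / real (Suc n))) * exp (- (1 / (d - t)) * (1 / real (Suc n)))" for n
  proof -
    have 1: "real (Suc n) * t + - real (Suc n) * c = real (Suc n) * (t - c)"
         "- real (Suc n) * t + real (Suc n) * d = real (Suc n) * (d - t)" by (simp_all add: algebra_simps)
    have "real (Suc n) * (t - c) > 0" "real (Suc n) * (d - t) > 0" using True by (auto intro!: mult_pos_pos)
    then show ?thesis unfolding pulse_def 1 expinv_def by (simp add: mult.commute)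
  qed
  moreover have "(\<lambda>n. exp (- (1 / (t - c)) * (1 / real (Suc n))) * exp (- (1 / (d - t)) * (1 / real (Suc n)))) \<longlonglongrightarrow> 1 * 1"
    by (intro tendsto_mult lim)
  ultimately show ?thesis using True by simp
qed

text \<open>Products of bumps suffice because they converge boundedly to indicators of boxes, and
  box integrals determine an integrable function almost everywhere. Asking only for products matters
  in \<open>weak_grad_0_imp_const\<close>, where antiderivatives are taken in one variable at a
  time.\<close>

lemma fundamental_lemma:
  fixes g :: "plane \<Rightarrow> 'a::euclidean_space"
  assumes g: "g \<in> L1_loc"
    and ort: "\<And>a b. bump_real a \<Longrightarrow> bump_real b \<Longrightarrow> (LINT x|lebesgue. (a (x $ 1) * b (x $ 2)) *\<^sub>R g x) = 0"
  shows "AE x in lebesgue. g x = 0"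
proof -
  have gm: "g \<in> borel_measurable lebesgue" by (rule L1_loc_measurable[OF g])
  have box0: "(LINT x|lebesgue. indicator (box l u) x *\<^sub>R g x) = 0" for l u
  proof -
    have eq: "indicat_real (box l u) x = indicator {l$1<..<u$1} (x$1) * indicator {l$2<..<u$2} (x$2)" for x
      by (auto simp: indicator_def mem_box_cart forall_2)
    let ?h = "\<lambda>n x::plane. pulse (real (Suc n)) (l$1) (u$1) (x$1) * pulse (real (Suc n)) (l$2) (u$2) (x$2)"
    have bm: "bump_real (pulse (real (Suc n)) c d)" for n c d by (rule pulse_bump) simp
    have m: "?h n \<in> borel_measurable lebesgue" for n
      by (intro continuous_measurable_lebesgue test_continuous tensor_test bm)
    have int: "integrable lebesgue (\<lambda>x. indicator (cbox l u) x *\<^sub>R norm (g x))"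
    proof -
      have "integrable lebesgue (\<lambda>x. indicator (cbox l u) x *\<^sub>R g x)"
        using g by (auto simp: L1_loc_def set_integrable_def)
      from integrable_norm[OF this] show ?thesis by simp
    qed
    have "(\<lambda>n. LINT x|lebesgue. ?h n x *\<^sub>R g x) \<longlonglongrightarrow> (LINT x|lebesgue. indicator (box l u) x *\<^sub>R g x)"
    proof (rule integral_dominated_convergence[OF _ _ int])
      show "AE x in lebesgue. (\<lambda>n. ?h n x *\<^sub>R g x) \<longlonglongrightarrow> indicator (box l u) x *\<^sub>R g x"
        unfolding eq by (intro AE_I2 tendsto_intros pulse_tendsto)
      have "norm (?h n x *\<^sub>R g x) \<le> indicator (cbox l u) x *\<^sub>R norm (g x)" for n x
      proof (cases "x \<in> box l u")
        case True
        then have "\<bar>?h n x\<bar> \<le> 1" using pulse_bounds[of "real (Suc n)"] by (auto simp: abs_mult intro!: mult_le_one)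
        moreover have "x \<in> cbox l u" using True box_subset_cbox by blast
        ultimately show ?thesis by (auto intro: mult_left_le_one_le)
      next
        case False
        then have "x$1 \<notin> {l$1<..<u$1} \<or> x$2 \<notin> {l$2<..<u$2}" by (auto simp: mem_box_cart forall_2)
        then have "?h n x = 0" using pulse_eq_0[of "real (Suc n)"] by (auto simp del: of_nat_Suc)
        then show ?thesis by (simp only: scaleR_zero_left norm_zero) simp
      qed
      then show "AE x in lebesgue. norm (?h n x *\<^sub>R g x) \<le> indicator (cbox l u) x *\<^sub>R norm (g x)" for n by simp
      show "(\<lambda>x. ?h n x *\<^sub>R g x) \<in> borel_measurable lebesgue" for n
        by (intro borel_measurable_scaleR m gm)
      show "(\<lambda>x. indicator (box l u) x *\<^sub>R g x) \<in> borel_measurable lebesgue"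
        by (intro borel_measurable_scaleR gm borel_measurable_indicator) simp
    qed
    moreover have "(LINT x|lebesgue. ?h n x *\<^sub>R g x) = 0" for n by (intro ort bm)
    ultimately show ?thesis by (simp only: LIMSEQ_const_iff)
  qed
  have "AE x in lebesgue. x \<in> box (- (real m *\<^sub>R One)) (real m *\<^sub>R One) \<longrightarrow> g x \<bullet> b = 0" if "b \<in> Basis" for m b
  proof -
    \<comment> \<open>Local integrability is turned into integrability by cutting off at a large
      box; countably many such boxes exhaust the plane.\<close>
    let ?Q = "box (- (real m *\<^sub>R One)) (real m *\<^sub>R One) :: plane set"
    let ?g = "\<lambda>x. indicator ?Q x *\<^sub>R (g x \<bullet> b)"
    have intg: "integrable lebesgue (\<lambda>x. indicator (box l u) x *\<^sub>R g x)" for l u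
    proof -
      have "integrable lebesgue (\<lambda>x. indicat_real (box l u) x *\<^sub>R (indicator (cbox l u) x *\<^sub>R g x))"
        by (rule integrable_mult_indicator) (use g in \<open>auto simp: L1_loc_def set_integrable_def\<close>)
      moreover have "(\<lambda>x. indicat_real (box l u) x *\<^sub>R (indicator (cbox l u) x *\<^sub>R g x)) = (\<lambda>x. indicator (box l u) x *\<^sub>R g x)"
        using box_subset_cbox[of l u] by (intro ext) (auto simp: indicator_def)
      ultimately show ?thesis by simp
    qed
    have "integrable lebesgue (\<lambda>x. (indicator ?Q x *\<^sub>R g x) \<bullet> b)"
      by (rule integrable_inner_left[OF intg])
    then have int: "integrable lebesgue ?g" by (simp only: inner_scaleR_left real_scaleR_def)
    then have "?g \<in> borel_measurable (completion lborel)" by (rule borel_measurable_integrable)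
    \<comment> \<open>The box criterion concerns Borel functions, so it is applied to a Borel
      representative of the cut-off component.\<close>
    from completion_ex_borel_measurable_real[OF this]
    obtain g' where g': "g' \<in> borel_measurable lborel" "AE x in lborel. ?g x = g' x" by auto
    have ae: "AE x in lebesgue. ?g x = g' x" using g'(2) by (rule AE_completion)
    have g'm: "g' \<in> borel_measurable lebesgue" using g'(1) by (intro measurable_completion)
    have "integrable lebesgue g'"
      by (rule integrable_cong_AE_imp[OF int g'm]) (use ae in auto)
    then have int': "integrable lborel g'" using g'(1) by (simp add: integrable_completion)
    have "AE x in lborel. g' x = 0"
    proof (rule AE_0_if_box_integrals_0[OF int'])
      fix l u :: plane
      \<comment> \<open>The cut-off is absorbed into the box: the intersection of two boxes is a
        box, to which \<open>box0\<close> applies.\<close>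
      obtain l' u' where b: "box l u \<inter> ?Q = box l' u'" by (simp only: box_Int_box)
      have "(LINT x|lborel. indicator (box l u) x * g' x) = (LINT x|lebesgue. indicator (box l u) x * g' x)"
        using g'(1) by (intro integral_completion[symmetric]) auto
      also have "\<dots> = (LINT x|lebesgue. indicator (box l u) x * ?g x)"
      proof (rule integral_cong_AE)
        have b: "(indicator (box l u) :: plane \<Rightarrow> real) \<in> borel_measurable lebesgue"
          by (intro borel_measurable_indicator) simp
        show "(\<lambda>x. indicator (box l u) x * g' x) \<in> borel_measurable lebesgue"
          "(\<lambda>x. indicator (box l u) x * ?g x) \<in> borel_measurable lebesgue"
          by (intro borel_measurable_times b g'm borel_measurable_integrable[OF int])+
      qed (use ae in auto)
      also have "\<dots> = (LINT x|lebesgue. (indicator (box l' u') x *\<^sub>R g x) \<bullet> b)"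
        unfolding b[symmetric] by (intro Bochner_Integration.integral_cong refl) (auto simp: indicator_def)
      also have "\<dots> = (LINT x|lebesgue. indicator (box l' u') x *\<^sub>R g x) \<bullet> b"
        by (rule integral_inner_left[OF intg])
      finally show "(LINT x|lborel. indicator (box l u) x * g' x) = 0" using box0 by simp
    qed
    then have "AE x in lebesgue. g' x = 0" by (rule AE_completion)
    with ae show ?thesis by eventually_elim (auto simp: indicator_def)
  qed
  then have "AE x in lebesgue. \<forall>m. \<forall>b\<in>Basis. x \<in> box (- (real m *\<^sub>R One)) (real m *\<^sub>R One) \<longrightarrow> g x \<bullet> b = 0"
    by (intro AE_all_countable[THEN iffD2] allI AE_finite_allI finite_Basis)
  then show ?thesis
  proof eventually_elim
    case (elim x)
    obtain m where "x \<in> box (- (real m *\<^sub>R One)) (real m *\<^sub>R One)"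
      using UN_box_eq_UNIV[where 'a=plane] by blast
    with elim have "\<forall>b\<in>Basis. g x \<bullet> b = 0" by blast
    then show ?case using euclidean_all_zero_iff by blast
  qed
qed

lemma L1_loc_diff: "U \<in> L1_loc \<Longrightarrow> V \<in> L1_loc \<Longrightarrow> (\<lambda>x. U x - V x) \<in> L1_loc"
  by (auto simp: L1_loc_def set_integral_diff)

lemma L1_loc_bounded_linear:
  fixes U :: "plane \<Rightarrow> 'a::euclidean_space" and T :: "'a \<Rightarrow> 'b::euclidean_space"
  assumes "bounded_linear T" "U \<in> L1_loc"
  shows "(\<lambda>x. T (U x)) \<in> L1_loc"
proof -
  have "(\<lambda>x. T (U x)) \<in> borel_measurable lebesgue"
    using assms by (intro measurable_compose[OF L1_loc_measurable borel_measurable_continuous_onI])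
      (auto intro: linear_continuous_on)
  moreover have "integrable lebesgue (\<lambda>x. indicat_real K x *\<^sub>R T (U x))" if "compact K" for K
  proof -
    have "integrable lebesgue (\<lambda>x. T (indicat_real K x *\<^sub>R U x))"
      using assms that by (intro integrable_bounded_linear[OF assms(1)]) (auto simp: L1_loc_def set_integrable_def)
    then show ?thesis by (simp add: linear_cmul[OF bounded_linear.linear[OF assms(1)]])
  qed
  ultimately show ?thesis by (auto simp: L1_loc_def set_integrable_def)
qed

lemma L1_loc_nth: "(G :: plane \<Rightarrow> 'a::euclidean_space ^ 2) \<in> L1_loc \<Longrightarrow> (\<lambda>x. G x $ i) \<in> L1_loc"
  by (rule L1_loc_bounded_linear[OF bounded_linear_vec_nth])

lemma has_weak_gradD:
  "has_weak_grad U G \<Longrightarrow> \<phi> \<in> test_functions \<Longrightarrow>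
    (LINT x|lebesgue. (grad \<phi> x $ i) *\<^sub>R U x) = - (LINT x|lebesgue. \<phi> x *\<^sub>R (G x $ i))"
  by (simp add: has_weak_grad_def)

lemma weak_grad_unique:
  fixes U :: "plane \<Rightarrow> 'a::euclidean_space"
  assumes "has_weak_grad U G" "has_weak_grad U H"
  shows "AE x in lebesgue. G x = H x"
proof -
  have L: "G \<in> L1_loc" "H \<in> L1_loc" using assms by (auto simp: has_weak_grad_def)
  have "AE x in lebesgue. G x $ i - H x $ i = 0" for i
  proof (rule fundamental_lemma)
    show "(\<lambda>x. G x $ i - H x $ i) \<in> L1_loc" using L by (intro L1_loc_diff L1_loc_nth)
    fix a b assume "bump_real a" "bump_real b"
    then have t: "(\<lambda>x. a (x $ 1) * b (x $ 2)) \<in> test_functions" (is "?\<phi> \<in> _") by (rule tensor_test)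
    have "(LINT x|lebesgue. ?\<phi> x *\<^sub>R (G x $ i)) = (LINT x|lebesgue. ?\<phi> x *\<^sub>R (H x $ i))"
      using has_weak_gradD[OF assms(1) t, of i] has_weak_gradD[OF assms(2) t, of i] by simp
    then show "(LINT x|lebesgue. ?\<phi> x *\<^sub>R (G x $ i - H x $ i)) = 0"
      using L1_loc_test_integrable[OF L1_loc_nth[OF L(1)] t] L1_loc_test_integrable[OF L1_loc_nth[OF L(2)] t]
      by (simp add: scaleR_diff_right)
  qed
  then have "AE x in lebesgue. \<forall>i. G x $ i - H x $ i = 0"
    by (simp add: AE_all_countable)
  then show ?thesis by eventually_elim (auto simp: vec_eq_iff)
qed

lemma wgrad_weak_grad: "has_weak_grad U G \<Longrightarrow> has_weak_grad U (wgrad U)"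
  unfolding wgrad_def by (rule someI[of "has_weak_grad U"])

lemma wgrad_AE_eq: "has_weak_grad U G \<Longrightarrow> AE x in lebesgue. wgrad U x = G x"
  using wgrad_weak_grad weak_grad_unique by blast

section \<open>Antiderivatives of bumps and functions with vanishing weak gradient\<close>

lemma bump_integrable:
  assumes "bump_real a" "M > 0" "\<And>t. \<bar>t\<bar> \<ge> M \<Longrightarrow> a t = 0"
  shows "integrable lborel a" "(LINT t|lborel. a t) = integral {-M..M} a"
proof -
  have eq: "(\<lambda>t. indicat_real {-M..M} t *\<^sub>R a t) = a"
  proof
    fix t show "indicat_real {-M..M} t *\<^sub>R a t = a t"
      using assms(3)[of t] by (cases "\<bar>t\<bar> \<ge> M") (auto simp: indicator_def)
  qed
  have "continuous_on UNIV a" using assms(1) by (simp add: bump_real_def smooth_real_continuous)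
  then have "integrable lborel (\<lambda>t. indicat_real {-M..M} t *\<^sub>R a t)"
    by (intro borel_integrable_compact) (auto intro: continuous_on_subset)
  then have s: "set_integrable lborel {-M..M} a" by (simp add: set_integrable_def)
  show "integrable lborel a" using s unfolding set_integrable_def eq .
  show "(LINT t|lborel. a t) = integral {-M..M} a"
    using set_borel_integral_eq_integral(2)[OF s] unfolding set_lebesgue_integral_def eq .
qed

text \<open>Integrating from the left of the support makes the antiderivative vanish there;
  vanishing total integral is exactly what makes it vanish to the right as well.\<close>

lemma bump_antiderivative:
  assumes a: "bump_real a" and zero: "(LINT t|lborel. a t) = 0"
  obtains A where "bump_real A" "\<And>t. (A has_real_derivative a t) (at t)"
proof -
  obtain M where M: "M > 0" "\<And>t. \<bar>t\<bar> \<ge> M \<Longrightarrow> a t = 0" "smooth_real a" using bump_realE[OF a] by metis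
  define A where "A t = integral {-M..t} a" for t
  have cont: "continuous_on S a" for S using smooth_real_continuous[OF M(3)] continuous_on_subset by blast
  have z: "a t = 0" if "t \<le> - M" for t using M(1,2) that by simp
  have A: "(A has_real_derivative a t) (at t)" "smooth_real A" for t
    unfolding A_def[abs_def] using smooth_real_antiderivative[OF M(3) z] by auto
  have "A t = 0" if t: "\<bar>t\<bar> \<ge> M" for t
  proof (cases "t \<ge> M")
    case True
    have "A t = integral {-M..M} a + integral {M..t} a"
      unfolding A_def using True M(1) cont
      by (intro Henstock_Kurzweil_Integration.integral_combine[symmetric] integrable_continuous_interval) auto
    also have "integral {-M..M} a = 0" using bump_integrable(2)[OF a M(1,2)] zero by simp
    also have "integral {M..t} a = 0" using M(1,2) by (intro integral_unique has_integral_is_0) auto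
    finally show ?thesis by simp
  next
    case False
    then have "t \<le> - M" using t by linarith
    then show ?thesis by (cases "t = - M") (auto simp: A_def)
  qed
  then have "bump_real A" using A(2) by (auto simp: bump_real_def)
  then show ?thesis using that A(1) by blast
qed

lemma bump_cmult: "bump_real a \<Longrightarrow> bump_real (\<lambda>t. c * a t)"
  unfolding bump_real_def using smooth_real_mult[OF smooth_real_const] by fastforce

lemma bump_diff:
  assumes "bump_real a" "bump_real b"
  shows "bump_real (\<lambda>t. a t - c * b t)"
proof -
  obtain M where M: "\<And>t. \<bar>t\<bar> \<ge> M \<Longrightarrow> a t = 0" "smooth_real a" using assms(1) bump_realE by metis
  obtain N where N: "\<And>t. \<bar>t\<bar> \<ge> N \<Longrightarrow> b t = 0" "smooth_real b" using assms(2) bump_realE by metis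
  have "smooth_real (\<lambda>t. a t + (- c) * b t)"
    by (intro smooth_real_add smooth_real_mult smooth_real_const M N)
  then show ?thesis unfolding bump_real_def using M(1) N(1)
    by (auto intro!: exI[of _ "max M N"])
qed

lemma pulse_integral_pos:
  assumes "n > 0" "c < d"
  shows "integral {c..d} (pulse n c d) > 0"
proof -
  have cont: "continuous_on {c..d} (pulse n c d)"
    using smooth_real_continuous[OF pulse_smooth] continuous_on_subset by blast
  have "integral {c..d} (pulse n c d) \<ge> 0"
    by (intro Henstock_Kurzweil_Integration.integral_nonneg integrable_continuous_interval cont pulse_bounds)
  moreover have "integral {c..d} (pulse n c d) \<noteq> 0"
  proof
    assume "integral {c..d} (pulse n c d) = 0"
    then have "\<forall>x\<in>{c..d}. pulse n c d x = 0"
      using integral_eq_0_iff[OF cont] assms pulse_bounds by auto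
    then have "pulse n c d ((c + d) / 2) = 0" using assms by auto
    moreover have "pulse n c d ((c + d) / 2) > 0" using assms by (intro pulse_pos) auto
    ultimately show False by simp
  qed
  ultimately show ?thesis by simp
qed

lemma bump_unit_integral: "\<exists>a. bump_real a \<and> (LINT t|lborel. a t) = 1"
proof -
  have b: "bump_real (pulse 1 (-1) 1)" by (intro pulse_bump) simp
  have z: "pulse 1 (-1) 1 t = 0" if "\<bar>t\<bar> \<ge> 1" for t using that by (intro pulse_eq_0) auto
  define I where "I = (LINT t|lborel. pulse 1 (-1) 1 t)"
  have "I > 0"
    unfolding I_def using bump_integrable(2)[OF b _ z, of 1] pulse_integral_pos[of 1 "-1" 1] by simp
  then have "(LINT t|lborel. (1 / I) * pulse 1 (-1) 1 t) = 1"
    by (subst integral_mult_right_zero) (simp add: I_def)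
  then show ?thesis using bump_cmult[OF b] by blast
qed

text \<open>A tensor product \<open>a(x\<^sub>1) b(x\<^sub>2)\<close> is a partial derivative of a test function as soon as \<open>a\<close> or
  \<open>b\<close> has integral 0, so \<open>U\<close> integrates it to \<open>c\<close> times the product of the two integrals.\<close>

lemma weak_grad_0_imp_const:
  fixes U :: "plane \<Rightarrow> 'a::euclidean_space"
  assumes U: "has_weak_grad U G" and G: "AE x in lebesgue. G x = 0"
  shows "\<exists>c. AE x in lebesgue. U x = c"
proof -
  let ?I = "\<lambda>a. LINT t|lborel. a t :: real"
  define L where "L a b = (LINT x|lebesgue. (a (x $ 1) * b (x $ 2)) *\<^sub>R U x)" for a b :: "real \<Rightarrow> real"
  have UL: "U \<in> L1_loc" using U by (simp add: has_weak_grad_def)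
  have int: "integrable lebesgue (\<lambda>x. (a (x $ 1) * b (x $ 2)) *\<^sub>R U x)" if "bump_real a" "bump_real b" for a b
    using L1_loc_test_integrable[OF UL tensor_test[OF that]] .
  have grad0: "(LINT x|lebesgue. (grad \<phi> x $ i) *\<^sub>R U x) = 0" if "\<phi> \<in> test_functions" for \<phi> i
  proof -
    have "(LINT x|lebesgue. \<phi> x *\<^sub>R (G x $ i)) = 0"
      by (rule integral_eq_zero_AE) (use G in eventually_elim, auto)
    then show ?thesis using has_weak_gradD[OF U that, of i] by simp
  qed
  \<comment> \<open>A fixed bump that carries the integral: \<open>a\<close> minus
    \<open>?I a\<close> times \<open>e\<close> has integral 0 and hence an antiderivative that is
    again a bump.\<close>
  obtain e where e: "bump_real e" "?I e = 1" using bump_unit_integral by blast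
  have int1: "integrable lborel a" if "bump_real a" for a
    using bump_realE[OF that] bump_integrable(1)[OF that] by metis
  have L1: "L a b = ?I a *\<^sub>R L e b" if ab: "bump_real a" "bump_real b" for a b
  proof -
    have d: "bump_real (\<lambda>t. a t - ?I a * e t)" by (intro bump_diff ab e)
    have "?I (\<lambda>t. a t - ?I a * e t) = 0"
      using int1[OF ab(1)] int1[OF e(1)] e(2) by simp
    then obtain A where A: "bump_real A" "\<And>t. (A has_real_derivative a t - ?I a * e t) (at t)"
      using bump_antiderivative[OF d] by metis
    obtain b' where b': "\<And>t. (b has_real_derivative b' t) (at t)"
      using ab(2) smooth_real_deriv unfolding bump_real_def by metis
    have "L (\<lambda>t. a t - ?I a * e t) b = 0"
      using grad0[OF tensor_test[OF A(1) ab(2)], of 1] grad_tensor(1)[OF A(2) b'] by (simp add: L_def)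
    moreover have "L (\<lambda>t. a t - ?I a * e t) b = L a b - ?I a *\<^sub>R L e b"
      using int[OF ab] int[OF e(1) ab(2)]
      by (simp add: L_def left_diff_distrib scaleR_diff_left mult.assoc flip: scaleR_scaleR)
    ultimately show ?thesis by simp
  qed
  have L2: "L a b = ?I b *\<^sub>R L a e" if ab: "bump_real a" "bump_real b" for a b
  proof -
    have d: "bump_real (\<lambda>t. b t - ?I b * e t)" by (intro bump_diff ab e)
    have "?I (\<lambda>t. b t - ?I b * e t) = 0"
      using int1[OF ab(2)] int1[OF e(1)] e(2) by simp
    then obtain B where B: "bump_real B" "\<And>t. (B has_real_derivative b t - ?I b * e t) (at t)"
      using bump_antiderivative[OF d] by metis
    obtain a' where a': "\<And>t. (a has_real_derivative a' t) (at t)"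
      using ab(1) smooth_real_deriv unfolding bump_real_def by metis
    have "L a (\<lambda>t. b t - ?I b * e t) = 0"
      using grad0[OF tensor_test[OF ab(1) B(1)], of 2] grad_tensor(2)[OF a' B(2)] by (simp add: L_def)
    moreover have "L a (\<lambda>t. b t - ?I b * e t) = L a b - ?I b *\<^sub>R L a e"
      using int[OF ab] int[OF ab(1) e(1)]
      by (simp add: L_def right_diff_distrib scaleR_diff_left mult.left_commute flip: scaleR_scaleR)
    ultimately show ?thesis by simp
  qed
  have cL: "(\<lambda>x. L e e) \<in> L1_loc" by (intro continuous_L1_loc) auto
  have "AE x in lebesgue. U x - L e e = 0"
  proof (rule fundamental_lemma)
    show "(\<lambda>x. U x - L e e) \<in> L1_loc" by (intro L1_loc_diff UL cL)
    fix a b assume ab: "bump_real a" "bump_real b"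
    let ?\<phi> = "\<lambda>x::plane. a (x $ 1) * b (x $ 2)"
    obtain M where M: "\<And>x. norm x \<ge> M \<Longrightarrow> ?\<phi> x = 0 \<and> grad ?\<phi> x = 0"
      by (rule test_bounded[OF tensor_test[OF ab]]) (rule that)
    have i: "integrable lborel ?\<phi>" "integrable lebesgue ?\<phi>"
      using integrable_continuous_compact[OF test_continuous[OF tensor_test[OF ab]], of M] M by auto
    have "(LINT x|lebesgue. ?\<phi> x) = ?I a * ?I b"
      using integral_plane(1)[OF i(1)] by simp
    moreover have "(LINT x|lebesgue. ?\<phi> x *\<^sub>R (U x - L e e)) = L a b - (LINT x|lebesgue. ?\<phi> x) *\<^sub>R L e e"
      using int[OF ab] i(2) by (simp add: scaleR_diff_right L_def)
    moreover have "L a b = (?I a * ?I b) *\<^sub>R L e e"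
      using L1[OF ab] L2[OF e(1) ab(2)] by simp
    ultimately show "(LINT x|lebesgue. ?\<phi> x *\<^sub>R (U x - L e e)) = 0" by simp
  qed
  then have "AE x in lebesgue. U x = L e e" by eventually_elim simp
  then show ?thesis by blast
qed

subsection \<open>A weighted Poincare inequality\<close>

lemma nn_integral_inverse_1_plus_square:
  "(\<integral>\<^sup>+t. ennreal (1 / (1 + t\<^sup>2)) \<partial>lborel) < \<infinity>"
proof -
  let ?k = "\<lambda>t::real. 1 / (1 + t\<^sup>2)"
  have pos: "1 + t\<^sup>2 > 0" for t :: real by (simp add: add_pos_nonneg)
  have half: "(\<integral>\<^sup>+t. ennreal (?k t) * indicator {0..} t \<partial>lborel) = ennreal (pi / 2 - arctan 0)"
  proof (rule nn_integral_FTC_atLeast)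
    show "(arctan has_real_derivative ?k t) (at t)" for t
      using DERIV_arctan[of t] by (simp add: inverse_eq_divide)
    show "(arctan \<longlongrightarrow> pi / 2) at_top" by (rule tendsto_arctan_at_top)
  qed (use pos in \<open>auto intro: less_imp_le\<close>)
  have "(\<integral>\<^sup>+t. ennreal (?k t) * indicator {..0} t \<partial>lborel)
      = (\<integral>\<^sup>+t. ennreal (?k (0 + (-1) * t)) * indicator {..0} (0 + (-1) * t) \<partial>lborel)"
    by (subst nn_integral_real_affine[where c="-1" and t=0]) auto
  also have "\<dots> = (\<integral>\<^sup>+t. ennreal (?k t) * indicator {0..} t \<partial>lborel)"
    by (intro nn_integral_cong) (auto simp: indicator_def)
  finally have half2: "(\<integral>\<^sup>+t. ennreal (?k t) * indicator {..0} t \<partial>lborel) = ennreal (pi / 2)"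
    using half by simp
  have "(\<integral>\<^sup>+t. ennreal (?k t) \<partial>lborel)
     \<le> (\<integral>\<^sup>+t. (ennreal (?k t) * indicator {0..} t + ennreal (?k t) * indicator {..0} t) \<partial>lborel)"
    by (intro nn_integral_mono) (auto simp: indicator_def)
  also have "\<dots> = (\<integral>\<^sup>+t. ennreal (?k t) * indicator {0..} t \<partial>lborel) + (\<integral>\<^sup>+t. ennreal (?k t) * indicator {..0} t \<partial>lborel)"
    by (rule nn_integral_add) auto
  also have "\<dots> < \<infinity>" unfolding half half2 by (simp add: ennreal_less_top)
  finally show ?thesis .
qed

text \<open>Cauchy-Schwarz in elementary form: with m the mean slope, the integral of (g' - m)^2
  over the interval is nonnegative. The estimate is stated in extended reals because the integral
  over the whole line may be infinite on exceptional coordinate lines.\<close>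

lemma real_difference_square_le:
  fixes g g' :: "real \<Rightarrow> real"
  assumes d: "\<And>t. (g has_real_derivative g' t) (at t)" and c: "continuous_on UNIV g'"
  shows "ennreal ((g s - g t)\<^sup>2) \<le> ennreal \<bar>s - t\<bar> * (\<integral>\<^sup>+u. ennreal ((g' u)\<^sup>2) \<partial>lborel)"
proof -
  have *: "ennreal ((g s - g t)\<^sup>2) \<le> ennreal (s - t) * (\<integral>\<^sup>+u. ennreal ((g' u)\<^sup>2) \<partial>lborel)" if st: "t < s" for s t
  proof -
    define m where "m = (g s - g t) / (s - t)"
    have c': "continuous_on {t..s} g'" using c continuous_on_subset by blast
    have m: "(g s - g t) = m * (s - t)" using st by (simp add: m_def)
    have i1: "(g' has_integral (g s - g t)) {t..s}"
      using st d by (intro fundamental_theorem_of_calculus)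
        (auto simp: has_real_derivative_iff_has_vector_derivative[symmetric] intro: DERIV_subset)
    have i2: "((\<lambda>u. (g' u)\<^sup>2) has_integral integral {t..s} (\<lambda>u. (g' u)\<^sup>2)) {t..s}"
      by (intro integrable_integral integrable_continuous_interval continuous_intros c')
    have "((\<lambda>u. (g' u)\<^sup>2 - 2 * m * g' u + m\<^sup>2) has_integral
       integral {t..s} (\<lambda>u. (g' u)\<^sup>2) - 2 * m * (g s - g t) + m\<^sup>2 * (s - t)) {t..s}"
      using has_integral_const_real[of "m\<^sup>2" t s] st
      by (intro has_integral_add has_integral_diff has_integral_mult_right i1 i2) (simp add: mult.commute)
    then have "0 \<le> integral {t..s} (\<lambda>u. (g' u)\<^sup>2) - 2 * m * (g s - g t) + m\<^sup>2 * (s - t)"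
    proof (rule has_integral_nonneg)
      fix u show "0 \<le> (g' u)\<^sup>2 - 2 * m * g' u + m\<^sup>2"
        using zero_le_power2[of "g' u - m"] by (simp add: power2_diff algebra_simps)
    qed
    then have "m\<^sup>2 * (s - t) \<le> integral {t..s} (\<lambda>u. (g' u)\<^sup>2)"
      unfolding m by (simp add: power2_eq_square algebra_simps)
    then have "(s - t) * (m\<^sup>2 * (s - t)) \<le> (s - t) * integral {t..s} (\<lambda>u. (g' u)\<^sup>2)"
      using st by (intro mult_left_mono) auto
    also have "(s - t) * (m\<^sup>2 * (s - t)) = (g s - g t)\<^sup>2" unfolding m by (simp add: power2_eq_square)
    finally have "ennreal ((g s - g t)\<^sup>2) \<le> ennreal ((s - t) * integral {t..s} (\<lambda>u. (g' u)\<^sup>2))"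
      by (rule ennreal_leI)
    also have "\<dots> = ennreal (s - t) * ennreal (integral {t..s} (\<lambda>u. (g' u)\<^sup>2))"
      using st by (intro ennreal_mult) (auto intro: has_integral_nonneg[OF i2])
    also have "ennreal (integral {t..s} (\<lambda>u. (g' u)\<^sup>2)) = (\<integral>\<^sup>+u. ennreal (if u \<in> {t..s} then (g' u)\<^sup>2 else 0) \<partial>lborel)"
    proof (rule nn_integral_has_integral_lborel[symmetric])
      show "((\<lambda>u. if u \<in> {t..s} then (g' u)\<^sup>2 else 0) has_integral integral {t..s} (\<lambda>u. (g' u)\<^sup>2)) UNIV"
        using i2 by (simp only: has_integral_restrict_UNIV)
      have [measurable]: "g' \<in> borel_measurable borel" using c by (intro borel_measurable_continuous_onI)
      show "(\<lambda>u. if u \<in> {t..s} then (g' u)\<^sup>2 else 0) \<in> borel_measurable borel" by measurable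
    qed auto
    also have "\<dots> \<le> (\<integral>\<^sup>+u. ennreal ((g' u)\<^sup>2) \<partial>lborel)"
      by (intro nn_integral_mono) auto
    finally show ?thesis by (simp add: mult_left_mono)
  qed
  consider "t < s" | "s < t" | "s = t" by linarith
  then show ?thesis
  proof cases
    case 1 then show ?thesis using *[of t s] by simp
  next
    case 2 then show ?thesis using *[of s t] by (simp add: power2_commute)
  qed simp
qed

definition unit_square :: "plane set" where
  "unit_square = cbox 0 (vec 1)"

text \<open>No normalising factor appears because the unit square has measure 1. A square is
  convenient since its indicator factors along the coordinates.\<close>

definition mean :: "(plane \<Rightarrow> real) \<Rightarrow> real" where
  "mean \<phi> = (LINT y|lebesgue. indicator unit_square y * \<phi> y)"

text \<open>The square of the weight still makes \<open>1 + |x\<^sub>i|\<close> integrable, which is what the fundamental theorem of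
  calculus along coordinate lines costs.\<close>

definition weight :: "plane \<Rightarrow> real" where
  "weight x = 1 / (1 + (x $ 1)\<^sup>2) * (1 / (1 + (x $ 2)\<^sup>2))"

lemma one_plus_square_pos: "1 + (t::real)\<^sup>2 > 0"
  by (simp add: add_pos_nonneg)

lemma weight_pos: "weight x > 0"
  using one_plus_square_pos by (simp add: weight_def)

lemma weight_continuous: "continuous_on S weight"
  unfolding weight_def by (intro continuous_intros) (use one_plus_square_pos in \<open>auto simp: less_le\<close>)

lemma unit_square_borel[measurable]: "unit_square \<in> sets borel"
  by (simp add: unit_square_def)

lemma unit_square_indicator:
  "indicator unit_square (vector [a, b] :: plane) = (indicator {0..1} a * indicator {0..1} b :: 'a::semiring_1)"
  by (auto simp: unit_square_def mem_box_cart forall_2 indicator_def)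

lemma unit_square_L2: "(\<lambda>y. indicat_real unit_square y) \<in> L2"
proof (rule L2I)
  have s: "unit_square \<in> sets lebesgue" by (simp add: unit_square_def)
  then show "indicat_real unit_square \<in> borel_measurable lebesgue"
    by (intro borel_measurable_indicator)
  have "emeasure lebesgue unit_square < \<infinity>"
    unfolding unit_square_def using lmeasurable_cbox by (auto simp: fmeasurable_def)
  then have "integrable lebesgue (indicat_real unit_square)"
    using s by (intro integrable_real_indicator) auto
  moreover have "(\<lambda>x. (norm (indicat_real unit_square x))\<^sup>2) = indicat_real unit_square"
    by (auto simp: indicator_def)
  ultimately show "integrable lebesgue (\<lambda>x. (norm (indicat_real unit_square x))\<^sup>2)" by simp
qed

lemma nn_integral_unit_square: "(\<integral>\<^sup>+y. indicator unit_square y \<partial>(lebesgue :: plane measure)) = 1"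
proof -
  have "(\<integral>\<^sup>+y. indicator unit_square y \<partial>(lebesgue :: plane measure)) =
    (\<integral>\<^sup>+a. \<integral>\<^sup>+b. indicator {0..1::real} a * indicator {0..1::real} b \<partial>lborel \<partial>lborel)"
    using unit_square_borel by (subst nn_integral_plane(1)) (auto simp: unit_square_indicator)
  also have "\<dots> = 1"
    by (simp add: nn_integral_cmult)
  finally show ?thesis .
qed

lemma ip_unit_square: "ip (\<lambda>y. indicat_real unit_square y) (\<lambda>y. indicat_real unit_square y) = 1"
proof -
  have "ennreal (ip (\<lambda>y. indicat_real unit_square y) (\<lambda>y. indicat_real unit_square y))
     = (\<integral>\<^sup>+y. indicator unit_square y \<partial>(lebesgue :: plane measure))"
    by (subst nn_integral_norm_L2[OF unit_square_L2, symmetric], rule nn_integral_cong) (simp add: indicator_def)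
  then show ?thesis unfolding nn_integral_unit_square
    by (metis ennreal_1 ennreal_inj ip_self_nonneg zero_le_one)
qed

lemma L2_mult_indicator:
  assumes "F \<in> L2" "A \<in> sets lebesgue" shows "(\<lambda>x. indicat_real A x *\<^sub>R F x) \<in> L2"
proof (rule L2I)
  show "(\<lambda>x. indicat_real A x *\<^sub>R F x) \<in> borel_measurable lebesgue"
    using assms by (intro borel_measurable_scaleR borel_measurable_indicator L2_measurable)
  have "integrable lebesgue (\<lambda>x. indicat_real A x *\<^sub>R (norm (F x))\<^sup>2)"
    by (rule integrable_mult_indicator) (use assms in \<open>auto simp: L2_def\<close>)
  moreover have "(\<lambda>x. (norm (indicat_real A x *\<^sub>R F x))\<^sup>2) = (\<lambda>x. indicat_real A x *\<^sub>R (norm (F x))\<^sup>2)"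
    by (auto simp: indicator_def)
  ultimately show "integrable lebesgue (\<lambda>x. (norm (indicat_real A x *\<^sub>R F x))\<^sup>2)" by simp
qed

text \<open>Jensen's inequality for the square, obtained as Cauchy-Schwarz against the indicator of
  the unit square, whose norm is 1.\<close>

lemma square_minus_mean_le:
  assumes p: "\<phi> \<in> test_functions"
  shows "ennreal ((z - mean \<phi>)\<^sup>2) \<le> (\<integral>\<^sup>+y. indicator unit_square y * ennreal ((z - \<phi> y)\<^sup>2) \<partial>lebesgue)"
proof -
  let ?q = "\<lambda>y. indicat_real unit_square y"
  have s: "unit_square \<in> sets lebesgue" by (simp add: unit_square_def)
  have L: "(\<lambda>y. ?q y *\<^sub>R \<phi> y) \<in> L2" by (rule L2_mult_indicator[OF test_L2[OF p] s])
  define h where "h y = z *\<^sub>R ?q y - ?q y *\<^sub>R \<phi> y" for y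
  have hL: "h \<in> L2" unfolding h_def by (intro L2_diff L2_cmult unit_square_L2 L)
  have "ip h ?q = z * ip ?q ?q - ip (\<lambda>y. ?q y *\<^sub>R \<phi> y) ?q"
    unfolding h_def by (subst ip_diff_left) (auto simp: L2_cmult[OF unit_square_L2, simplified] unit_square_L2 L[simplified] ip_cmult_left[of z ?q, simplified])
  also have "ip (\<lambda>y. ?q y *\<^sub>R \<phi> y) ?q = mean \<phi>"
    unfolding ip_def mean_def by (intro Bochner_Integration.integral_cong) (auto simp: indicator_def)
  finally have "ip h ?q = z - mean \<phi>" by (simp add: ip_unit_square)
  then have "(z - mean \<phi>)\<^sup>2 \<le> ip h h"
    using ip_Cauchy_Schwarz_square[OF hL unit_square_L2] by (simp add: ip_unit_square)
  then have "ennreal ((z - mean \<phi>)\<^sup>2) \<le> ennreal (ip h h)" by (rule ennreal_leI)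
  also have "\<dots> = (\<integral>\<^sup>+y. ennreal ((norm (h y))\<^sup>2) \<partial>lebesgue)" by (rule nn_integral_norm_L2[OF hL, symmetric])
  also have "\<dots> = (\<integral>\<^sup>+y. indicator unit_square y * ennreal ((z - \<phi> y)\<^sup>2) \<partial>lebesgue)"
    by (intro nn_integral_cong) (auto simp: h_def indicator_def)
  finally show ?thesis .
qed

text \<open>The value at (a, b) is compared with that at a point (c, d) of the unit square through
  the corner (c, b): the horizontal leg costs \<open>N1 b\<close>, the vertical one
  \<open>N2 c\<close>. Averaging over (c, d) integrates \<open>N2\<close> into the full energy
  \<open>Z\<close>, while \<open>N1 b\<close> survives as a function of b and is integrated only at
  the end. The lengths of the legs grow linearly and are paid for by the weight. Working with
  nonnegative integrals avoids integrability conditions on single lines.\<close>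

lemma poincare_nn_integral:
  assumes p: "\<phi> \<in> test_functions" and K: "(\<integral>\<^sup>+t. ennreal (1 / (1 + t\<^sup>2)) \<partial>lborel) = ennreal K" "K \<ge> 0"
  shows "(\<integral>\<^sup>+x. ennreal ((weight x * (\<phi> x - mean \<phi>))\<^sup>2) \<partial>lebesgue)
    \<le> ennreal (4 * K + 4 * K\<^sup>2) * (\<integral>\<^sup>+x. ennreal ((norm (grad \<phi> x))\<^sup>2) \<partial>lebesgue)"
proof -
  let ?g = "\<lambda>i x. grad \<phi> x $ i"
  let ?k = "\<lambda>t::real. 1 / (1 + t\<^sup>2)"
  define N1 where "N1 b = (\<integral>\<^sup>+a. ennreal ((?g 1 (vector [a, b]))\<^sup>2) \<partial>lborel)" for b
  define N2 where "N2 a = (\<integral>\<^sup>+b. ennreal ((?g 2 (vector [a, b]))\<^sup>2) \<partial>lborel)" for a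
  define Z where "Z = (\<integral>\<^sup>+x. ennreal ((norm (grad \<phi> x))\<^sup>2) \<partial>lebesgue)"
  have cont: "continuous_on UNIV (?g i)" for i using test_grad_Ck[OF p, of 0] by simp
  have [measurable]: "?g i \<in> borel_measurable borel" for i
    by (intro borel_measurable_continuous_onI cont)
  have [measurable]: "\<phi> \<in> borel_measurable borel"
    by (intro borel_measurable_continuous_onI test_continuous p)
  have mp: "(\<lambda>(a, b). ennreal ((?g i (vector [a, b]))\<^sup>2)) \<in> borel_measurable (lborel \<Otimes>\<^sub>M lborel)" for i
    using measurable_compose[OF vector_measurable_pair, of "\<lambda>x. ennreal ((?g i x)\<^sup>2)" borel] by (simp add: split_def)
  have mp': "(\<lambda>(b, a). ennreal ((?g i (vector [a, b]))\<^sup>2)) \<in> borel_measurable (lborel \<Otimes>\<^sub>M lborel)" for i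
    using measurable_compose[OF measurable_pair_swap' mp] by (simp add: split_def)
  have [measurable]: "N1 \<in> borel_measurable borel" "N2 \<in> borel_measurable borel"
    unfolding N1_def N2_def using lborel.borel_measurable_nn_integral[OF mp'] lborel.borel_measurable_nn_integral[OF mp] by simp_all
  have gle: "(?g i x)\<^sup>2 \<le> (norm (grad \<phi> x))\<^sup>2" for i x
    using component_le_norm_cart[of "grad \<phi> x" i] by (metis abs_le_square_iff abs_norm_cancel)
  have Z1: "(\<integral>\<^sup>+b. N1 b \<partial>lborel) \<le> Z"
  proof -
    have "(\<integral>\<^sup>+b. N1 b \<partial>lborel) = (\<integral>\<^sup>+x. ennreal ((?g 1 x)\<^sup>2) \<partial>lebesgue)"
      unfolding N1_def by (subst nn_integral_plane(2)) auto
    also have "\<dots> \<le> Z" unfolding Z_def by (intro nn_integral_mono ennreal_leI gle)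
    finally show ?thesis .
  qed
  have Z2: "(\<integral>\<^sup>+a. N2 a \<partial>lborel) \<le> Z"
  proof -
    have "(\<integral>\<^sup>+a. N2 a \<partial>lborel) = (\<integral>\<^sup>+x. ennreal ((?g 2 x)\<^sup>2) \<partial>lebesgue)"
      unfolding N2_def by (subst nn_integral_plane(1)) auto
    also have "\<dots> \<le> Z" unfolding Z_def by (intro nn_integral_mono ennreal_leI gle)
    finally show ?thesis .
  qed
  have d1: "ennreal ((\<phi> (vector [s, b]) - \<phi> (vector [t, b]))\<^sup>2) \<le> ennreal \<bar>s - t\<bar> * N1 b" for s t b
    unfolding N1_def
    by (rule real_difference_square_le[OF partial_derivative(1)[OF test_differentiable[OF p]]])
      (rule continuous_on_compose2[OF cont continuous_on_vector(1)], simp)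
  have d2: "ennreal ((\<phi> (vector [a, s]) - \<phi> (vector [a, t]))\<^sup>2) \<le> ennreal \<bar>s - t\<bar> * N2 a" for s t a
    unfolding N2_def
    by (rule real_difference_square_le[OF partial_derivative(2)[OF test_differentiable[OF p]]])
      (rule continuous_on_compose2[OF cont continuous_on_vector(2)], simp)
  \<comment> \<open>The indicator in c is kept only where it is needed: it gives integral 1 to the
    term with \<open>N1 b\<close>, while \<open>N2 c\<close> may be integrated over the whole
    line.\<close>
  have pt: "indicator {0..1} c * indicator {0..1} d * ennreal ((\<phi> (vector [a, b]) - \<phi> (vector [c, d]))\<^sup>2)
     \<le> indicator {0..1} d * (ennreal (2 * (\<bar>a\<bar> + 1)) * N1 b * indicator {0..1} c + ennreal (2 * (\<bar>b\<bar> + 1)) * N2 c)" for a b c d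
  proof (cases "c \<in> {0..1} \<and> d \<in> {0..1}")
    case True
    let ?x = "\<phi> (vector [a, b]) - \<phi> (vector [c, b])" and ?y = "\<phi> (vector [c, b]) - \<phi> (vector [c, d])"
    have "(\<phi> (vector [a, b]) - \<phi> (vector [c, d]))\<^sup>2 = (?x + ?y)\<^sup>2" by simp
    also have "\<dots> \<le> 2 * ?x\<^sup>2 + 2 * ?y\<^sup>2"
      using sum_squares_bound[of ?x ?y] by (simp only: power2_sum)
    finally have "ennreal ((\<phi> (vector [a, b]) - \<phi> (vector [c, d]))\<^sup>2) \<le> ennreal (2 * ?x\<^sup>2 + 2 * ?y\<^sup>2)"
      by (rule ennreal_leI)
    also have "\<dots> = 2 * ennreal (?x\<^sup>2) + 2 * ennreal (?y\<^sup>2)"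
      by (simp add: ennreal_plus ennreal_mult)
    also have "\<dots> \<le> 2 * (ennreal \<bar>a - c\<bar> * N1 b) + 2 * (ennreal \<bar>b - d\<bar> * N2 c)"
      by (intro add_mono mult_left_mono d1 d2) auto
    also have "\<dots> \<le> 2 * (ennreal (\<bar>a\<bar> + 1) * N1 b) + 2 * (ennreal (\<bar>b\<bar> + 1) * N2 c)"
      using True by (intro add_mono mult_left_mono mult_right_mono ennreal_leI) auto
    also have "\<dots> = ennreal (2 * (\<bar>a\<bar> + 1)) * N1 b + ennreal (2 * (\<bar>b\<bar> + 1)) * N2 c"
    proof -
      have "ennreal (2 * (\<bar>t\<bar> + 1)) = 2 * ennreal (\<bar>t\<bar> + 1)" for t :: real
        using ennreal_mult[of 2 "\<bar>t\<bar> + 1"] by (simp only: ennreal_numeral)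
      then show ?thesis by (simp only: mult.assoc)
    qed
    finally show ?thesis using True by simp
  qed auto
  have pw: "ennreal ((\<phi> (vector [a, b]) - mean \<phi>)\<^sup>2) \<le> ennreal (2 * (\<bar>a\<bar> + 1)) * N1 b + ennreal (2 * (\<bar>b\<bar> + 1)) * Z" for a b
  proof -
    have "ennreal ((\<phi> (vector [a, b]) - mean \<phi>)\<^sup>2)
       \<le> (\<integral>\<^sup>+y. indicator unit_square y * ennreal ((\<phi> (vector [a, b]) - \<phi> y)\<^sup>2) \<partial>lebesgue)"
      by (rule square_minus_mean_le[OF p])
    also have "\<dots> = (\<integral>\<^sup>+c. \<integral>\<^sup>+d. indicator {0..1} c * indicator {0..1} d * ennreal ((\<phi> (vector [a, b]) - \<phi> (vector [c, d]))\<^sup>2) \<partial>lborel \<partial>lborel)"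
      by (subst nn_integral_plane(1)) (measurable, simp add: unit_square_indicator)
    also have "\<dots> \<le> (\<integral>\<^sup>+c. \<integral>\<^sup>+d. indicator {0..1::real} d * (ennreal (2 * (\<bar>a\<bar> + 1)) * N1 b * indicator {0..1} c + ennreal (2 * (\<bar>b\<bar> + 1)) * N2 c) \<partial>lborel \<partial>lborel)"
      by (rule nn_integral_mono, rule nn_integral_mono, rule pt)
    also have "\<dots> = (\<integral>\<^sup>+c. ennreal (2 * (\<bar>a\<bar> + 1)) * N1 b * indicator {0..1} c + ennreal (2 * (\<bar>b\<bar> + 1)) * N2 c \<partial>lborel)"
    proof -
      have "(\<integral>\<^sup>+d. indicator {0..1::real} d * z \<partial>lborel) = z" for z :: ennreal
        by (subst nn_integral_multc) auto
      then show ?thesis by (simp only:)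
    qed
    also have "\<dots> = ennreal (2 * (\<bar>a\<bar> + 1)) * N1 b + ennreal (2 * (\<bar>b\<bar> + 1)) * (\<integral>\<^sup>+c. N2 c \<partial>lborel)"
      by (subst nn_integral_add) (auto simp: nn_integral_cmult)
    also have "\<dots> \<le> ennreal (2 * (\<bar>a\<bar> + 1)) * N1 b + ennreal (2 * (\<bar>b\<bar> + 1)) * Z"
      by (intro add_mono mult_left_mono Z2) auto
    finally show ?thesis .
  qed
  \<comment> \<open>Of the two factors \<open>?k t\<close> in the squared weight, one absorbs the
    linear growth and the other remains for integration.\<close>
  have k: "0 < ?k t" "?k t \<le> 1" "(?k t)\<^sup>2 \<le> ?k t" "2 * (\<bar>t\<bar> + 1) * (?k t)\<^sup>2 \<le> 4 * ?k t" for t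
  proof -
    have k0: "1 + t\<^sup>2 > 0" by (rule one_plus_square_pos)
    show k1: "0 < ?k t" "?k t \<le> 1" using k0 by auto
    show "(?k t)\<^sup>2 \<le> ?k t" using mult_left_le_one_le[OF less_imp_le[OF k1(1)] less_imp_le[OF k1(1)] k1(2)] by (simp only: power2_eq_square)
    have "2 * \<bar>t\<bar> \<le> t\<^sup>2 + 1"
      using zero_le_power2[of "\<bar>t\<bar> - 1"] by (simp add: power2_diff)
    moreover have "0 \<le> t\<^sup>2" "2 * (1 + t\<^sup>2) = 2 + 2 * t\<^sup>2" by simp_all
    ultimately have "(\<bar>t\<bar> + 1) \<le> 2 * (1 + t\<^sup>2)" by linarith
    then have "2 * (\<bar>t\<bar> + 1) * (?k t)\<^sup>2 \<le> 2 * (2 * (1 + t\<^sup>2)) * (?k t)\<^sup>2"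
      by (intro mult_right_mono) auto
    also have "\<dots> = 4 * ?k t"
    proof -
      have "2 * (2 * p) * (1 / p)\<^sup>2 = 4 * (1 / p)" if "p > 0" for p :: real
        using that by (simp add: power2_eq_square)
      from this[OF k0] show ?thesis .
    qed
    finally show "2 * (\<bar>t\<bar> + 1) * (?k t)\<^sup>2 \<le> 4 * ?k t" .
  qed
  have in1: "ennreal ((weight (vector [a, b]) * (\<phi> (vector [a, b]) - mean \<phi>))\<^sup>2)
     \<le> 4 * (ennreal (?k a) * N1 b) + 4 * (ennreal (?k a) * (ennreal (?k b) * Z))" for a b
  proof -
    have "ennreal ((weight (vector [a, b]) * (\<phi> (vector [a, b]) - mean \<phi>))\<^sup>2)
       = ennreal ((?k a)\<^sup>2 * (?k b)\<^sup>2) * ennreal ((\<phi> (vector [a, b]) - mean \<phi>)\<^sup>2)"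
      by (simp add: weight_def power_mult_distrib ennreal_mult[symmetric] power_divide)
    also have "\<dots> \<le> ennreal ((?k a)\<^sup>2 * (?k b)\<^sup>2) * (ennreal (2 * (\<bar>a\<bar> + 1)) * N1 b + ennreal (2 * (\<bar>b\<bar> + 1)) * Z)"
      by (intro mult_left_mono pw) auto
    also have "\<dots> = ennreal (2 * (\<bar>a\<bar> + 1) * (?k a)\<^sup>2 * (?k b)\<^sup>2) * N1 b + ennreal ((?k a)\<^sup>2 * (2 * (\<bar>b\<bar> + 1) * (?k b)\<^sup>2)) * Z"
    proof -
      have "ennreal ((?k a)\<^sup>2 * (?k b)\<^sup>2) * ennreal (2 * (\<bar>a\<bar> + 1)) = ennreal (2 * (\<bar>a\<bar> + 1) * (?k a)\<^sup>2 * (?k b)\<^sup>2)"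
        by (subst ennreal_mult[symmetric]) (auto simp: mult_ac)
      moreover have "ennreal ((?k a)\<^sup>2 * (?k b)\<^sup>2) * ennreal (2 * (\<bar>b\<bar> + 1)) = ennreal ((?k a)\<^sup>2 * (2 * (\<bar>b\<bar> + 1) * (?k b)\<^sup>2))"
        by (subst ennreal_mult[symmetric]) (auto simp: mult_ac)
      ultimately show ?thesis by (simp add: distrib_left mult.assoc[symmetric])
    qed
    \<comment> \<open>In the term with \<open>N1 b\<close> the weight in b is simply bounded by 1,
      since \<open>N1\<close> is integrated in b against no weight; the term with the constant
      \<open>Z\<close> needs a weight in both variables. This explains the constants 4 K and 4
      K^2.\<close>
    also have "\<dots> \<le> ennreal (4 * ?k a * 1) * N1 b + ennreal (?k a * (4 * ?k b)) * Z"
    proof (intro add_mono mult_right_mono ennreal_leI)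
      have "(?k b)\<^sup>2 \<le> 1" using k(2)[of b] k(3)[of b] by linarith
      then show "2 * (\<bar>a\<bar> + 1) * (?k a)\<^sup>2 * (?k b)\<^sup>2 \<le> 4 * ?k a * 1"
        using k(1)[of a] by (intro mult_mono[OF k(4)]) (simp_all add: less_imp_le)
      show "(?k a)\<^sup>2 * (2 * (\<bar>b\<bar> + 1) * (?k b)\<^sup>2) \<le> ?k a * (4 * ?k b)"
        using k(1)[of a] by (intro mult_mono[OF k(3) k(4)]) (simp_all add: less_imp_le)
    qed auto
    also have "\<dots> = 4 * (ennreal (?k a) * N1 b) + 4 * (ennreal (?k a) * (ennreal (?k b) * Z))"
    proof -
      have e: "ennreal (p * (4 * q)) = 4 * (ennreal p * ennreal q)" if "p \<ge> 0" "q \<ge> 0" for p q :: real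
        using that ennreal_mult[of 4 "p * q"] ennreal_mult[of p q] by (simp add: mult.left_commute)
      have "ennreal (?k a * (4 * ?k b)) = 4 * (ennreal (?k a) * ennreal (?k b))"
        using k(1)[of a] k(1)[of b] by (intro e less_imp_le)
      moreover have "ennreal (4 * ?k a * 1) = 4 * ennreal (?k a)"
        using e[of 1 "?k a"] k(1)[of a] by (simp only: mult_1_right mult_1_left ennreal_1 less_imp_le zero_le_one)
      ultimately show ?thesis by (simp add: mult.assoc)
    qed
    finally show ?thesis .
  qed
  have [measurable]: "weight \<in> borel_measurable borel"
    by (intro borel_measurable_continuous_onI weight_continuous)
  have "(\<integral>\<^sup>+x. ennreal ((weight x * (\<phi> x - mean \<phi>))\<^sup>2) \<partial>lebesgue)
     = (\<integral>\<^sup>+b. \<integral>\<^sup>+a. ennreal ((weight (vector [a, b]) * (\<phi> (vector [a, b]) - mean \<phi>))\<^sup>2) \<partial>lborel \<partial>lborel)"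
    by (rule nn_integral_plane(2)) measurable
  also have "\<dots> \<le> (\<integral>\<^sup>+b. \<integral>\<^sup>+a. 4 * (ennreal (?k a) * N1 b) + 4 * (ennreal (?k a) * (ennreal (?k b) * Z)) \<partial>lborel \<partial>lborel)"
    by (rule nn_integral_mono, rule nn_integral_mono, rule in1)
  also have "\<dots> = (\<integral>\<^sup>+b. 4 * (ennreal K * N1 b) + 4 * (ennreal K * (ennreal (?k b) * Z)) \<partial>lborel)"
    by (subst nn_integral_add) (auto simp: nn_integral_cmult nn_integral_multc K(1))
  also have "\<dots> = 4 * (ennreal K * (\<integral>\<^sup>+b. N1 b \<partial>lborel)) + 4 * (ennreal K * (ennreal K * Z))"
    by (subst nn_integral_add) (auto simp: nn_integral_cmult nn_integral_multc K(1))
  also have "\<dots> \<le> 4 * (ennreal K * Z) + 4 * (ennreal K * (ennreal K * Z))"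
    by (intro add_mono mult_left_mono Z1) auto
  also have "\<dots> = ennreal (4 * K + 4 * K\<^sup>2) * Z"
    using K(2) by (simp add: ennreal_plus ennreal_mult power2_eq_square distrib_right mult.assoc)
  finally show ?thesis unfolding Z_def .
qed

lemma poincare:
  obtains C where "C \<ge> 0" "\<And>\<phi>. \<phi> \<in> test_functions \<Longrightarrow> (\<lambda>x. weight x * (\<phi> x - mean \<phi>)) \<in> L2 \<and>
    nrm (\<lambda>x. weight x * (\<phi> x - mean \<phi>)) \<le> C * nrm (grad \<phi>)"
proof -
  define K where "K = enn2real (\<integral>\<^sup>+t. ennreal (1 / (1 + t\<^sup>2)) \<partial>lborel)"
  have K: "(\<integral>\<^sup>+t. ennreal (1 / (1 + t\<^sup>2)) \<partial>lborel) = ennreal K" "K \<ge> 0"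
    unfolding K_def using nn_integral_inverse_1_plus_square by auto
  define C where "C = 4 * K + 4 * K\<^sup>2"
  have C: "C \<ge> 0" using K(2) by (simp add: C_def)
  have "(\<lambda>x. weight x * (\<phi> x - mean \<phi>)) \<in> L2 \<and> nrm (\<lambda>x. weight x * (\<phi> x - mean \<phi>)) \<le> sqrt C * nrm (grad \<phi>)"
    if p: "\<phi> \<in> test_functions" for \<phi>
  proof -
    have "(\<integral>\<^sup>+x. ennreal ((norm (weight x * (\<phi> x - mean \<phi>)))\<^sup>2) \<partial>lebesgue)
      \<le> ennreal C * (\<integral>\<^sup>+x. ennreal ((norm (grad \<phi> x))\<^sup>2) \<partial>lebesgue)"
      using poincare_nn_integral[OF p K] unfolding C_def by (simp only: real_norm_def power2_abs)
    also have "\<dots> = ennreal (C * ip (grad \<phi>) (grad \<phi>))"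
      using C by (simp add: nn_integral_norm_L2[OF test_grad_L2[OF p]] ennreal_mult ip_self_nonneg)
    finally have le: "(\<integral>\<^sup>+x. ennreal ((norm (weight x * (\<phi> x - mean \<phi>)))\<^sup>2) \<partial>lebesgue) \<le> ennreal (C * ip (grad \<phi>) (grad \<phi>))" .
    have m: "(\<lambda>x. weight x * (\<phi> x - mean \<phi>)) \<in> borel_measurable lebesgue"
      by (intro continuous_measurable_lebesgue continuous_intros weight_continuous test_continuous p)
    note * = L2_nn_integral[OF m le mult_nonneg_nonneg[OF C ip_self_nonneg]]
    then show ?thesis using C by (simp add: nrm_def real_sqrt_mult[symmetric])
  qed
  then show ?thesis using that[of "sqrt C"] C by auto
qed

section \<open>Limits of test gradients and their potentials\<close>

lemma L2_imp_L2_loc: "U \<in> L2 \<Longrightarrow> U \<in> L2_loc"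
  unfolding L2_loc_def set_integrable_def
  by (safe intro!: integrable_mult_indicator L2_measurable L2_integrable)
    (meson lmeasurable_compact fmeasurableD)

lemma L2_loc_imp_L1_loc:
  fixes U :: "plane \<Rightarrow> 'a::euclidean_space"
  assumes U: "U \<in> L2_loc" shows "U \<in> L1_loc"
proof -
  have m: "U \<in> borel_measurable lebesgue" using U by (simp add: L2_loc_def)
  have "integrable lebesgue (\<lambda>x. indicat_real K x *\<^sub>R U x)" if K: "compact K" for K
  proof (rule Bochner_Integration.integrable_bound)
    have s: "K \<in> sets lebesgue" "emeasure lebesgue K < \<infinity>"
      using lmeasurable_compact[OF K] by (auto simp: fmeasurable_def)
    have "integrable lebesgue (\<lambda>x. indicat_real K x *\<^sub>R (norm (U x))\<^sup>2)"
      using U K by (auto simp: L2_loc_def set_integrable_def)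
    then show "integrable lebesgue (\<lambda>x. indicat_real K x + indicat_real K x *\<^sub>R (norm (U x))\<^sup>2)"
      using s by (intro Bochner_Integration.integrable_add integrable_real_indicator)
    show "(\<lambda>x. indicat_real K x *\<^sub>R U x) \<in> borel_measurable lebesgue"
      by (intro borel_measurable_scaleR borel_measurable_indicator s m)
    have "norm (U x) \<le> 1 + (norm (U x))\<^sup>2" for x
    proof -
      have "2 * norm (U x) \<le> (norm (U x))\<^sup>2 + 1"
        using zero_le_power2[of "norm (U x) - 1"] by (simp add: power2_diff)
      then show ?thesis using norm_ge_zero[of "U x"] by linarith
    qed
    then show "AE x in lebesgue. norm (indicat_real K x *\<^sub>R U x)
       \<le> norm (indicat_real K x + indicat_real K x *\<^sub>R (norm (U x))\<^sup>2)"
      by (intro AE_I2) (auto simp: indicator_def)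
  qed
  with m show ?thesis by (auto simp: L1_loc_def set_integrable_def)
qed

lemma L2_imp_L1_loc: "U \<in> L2 \<Longrightarrow> U \<in> L1_loc"
  by (intro L2_loc_imp_L1_loc L2_imp_L2_loc)

text \<open>The Hilbert space in which the problem is solved. A priori it is smaller than the space
  of all square integrable weak gradients; \<open>weak_grad_in_grad_closure\<close> removes the
  difference for real-valued potentials.\<close>

definition grad_closure :: "(plane \<Rightarrow> plane) set" where
  "grad_closure = {F \<in> L2. \<exists>X. (\<forall>n::nat. X n \<in> test_functions) \<and> (\<lambda>n. nrm (\<lambda>x. grad (X n) x - F x)) \<longlonglongrightarrow> 0}"

lemma test_grad_diff:
  "\<phi> \<in> test_functions \<Longrightarrow> \<psi> \<in> test_functions \<Longrightarrow> grad (\<lambda>x. \<phi> x - \<psi> x) = (\<lambda>x. grad \<phi> x - grad \<psi> x)"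
  using grad_add[of \<phi> _ "\<lambda>x. (-1) * \<psi> x"] grad_cmult[of \<psi> _ "-1"] test_differentiable test_cmult[of \<psi> "-1"]
  by (auto intro!: ext)

lemma mean_diff:
  assumes p: "\<phi> \<in> test_functions" "\<psi> \<in> test_functions"
  shows "mean (\<lambda>x. \<phi> x - \<psi> x) = mean \<phi> - mean \<psi>"
proof -
  have "integrable lebesgue (\<lambda>y. indicator unit_square y * \<phi> y)" if "\<phi> \<in> test_functions" for \<phi>
    using integrable_inner_L2[OF unit_square_L2 test_L2[OF that]] by simp
  from this[OF p(1)] this[OF p(2)] show ?thesis by (simp add: mean_def right_diff_distrib)
qed

lemma continuous_compact_support_L2:
  fixes h :: "plane \<Rightarrow> 'a::euclidean_space"
  assumes "continuous_on UNIV h" "\<And>x. norm x > M \<Longrightarrow> h x = 0"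
  shows "h \<in> L2"
  by (intro L2I continuous_measurable_lebesgue assms(1) integrable_continuous_compact[where M=M] continuous_intros)
    (use assms in auto)

lemma L2_Cauchy:
  assumes F: "\<And>n. F n \<in> L2" "L \<in> L2" and lim: "(\<lambda>n. nrm (\<lambda>x. F n x - L x)) \<longlonglongrightarrow> 0" and e: "e > 0"
  shows "\<exists>N. \<forall>m\<ge>N. \<forall>n\<ge>N. nrm (\<lambda>x. F m x - F n x) < e"
proof -
  obtain N where N: "\<And>n. n \<ge> N \<Longrightarrow> nrm (\<lambda>x. F n x - L x) < e / 2"
    using order_tendstoD(2)[OF lim, of "e / 2"] e by (auto simp: eventually_sequentially)
  have "nrm (\<lambda>x. F m x - F n x) < e" if "m \<ge> N" "n \<ge> N" for m n
  proof -
    have "nrm (\<lambda>x. (F m x - L x) + (-1) *\<^sub>R (F n x - L x)) \<le> nrm (\<lambda>x. F m x - L x) + nrm (\<lambda>x. (-1) *\<^sub>R (F n x - L x))"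
      by (intro nrm_triangle L2_cmult L2_diff F)
    moreover have "nrm (\<lambda>x. (-1) *\<^sub>R (F n x - L x)) = nrm (\<lambda>x. F n x - L x)"
      by (subst nrm_cmult) simp
    ultimately show ?thesis using N[OF that(1)] N[OF that(2)] by simp
  qed
  then show ?thesis by blast
qed

text \<open>The test functions \<open>X n\<close> themselves may drift off by constants. After
  subtracting means and multiplying by the weight they form a Cauchy sequence in L2 by the Poincare
  inequality, and dividing the limit by the weight gives a locally square integrable potential,
  because 1/weight is continuous.\<close>

lemma grad_closure_potential:
  assumes "F \<in> grad_closure"
  obtains U where "U \<in> H1_dot" "has_weak_grad U F"
proof -
  obtain X where F: "F \<in> L2" and X: "\<And>n::nat. X n \<in> test_functions"
    and lim: "(\<lambda>n. nrm (\<lambda>x. grad (X n) x - F x)) \<longlonglongrightarrow> 0"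
    using assms by (auto simp: grad_closure_def)
  obtain C where C: "C \<ge> 0" "\<And>\<phi>. \<phi> \<in> test_functions \<Longrightarrow> (\<lambda>x. weight x * (\<phi> x - mean \<phi>)) \<in> L2 \<and>
    nrm (\<lambda>x. weight x * (\<phi> x - mean \<phi>)) \<le> C * nrm (grad \<phi>)"
    by (rule poincare) (rule that)
  define V where "V n x = weight x * (X n x - mean (X n))" for n x
  have V: "V n \<in> L2" for n unfolding V_def using C(2)[OF X] by blast
  have Vd: "nrm (\<lambda>x. V m x - V n x) \<le> C * nrm (\<lambda>x. grad (X m) x - grad (X n) x)" for m n
  proof -
    have "(\<lambda>x. V m x - V n x) = (\<lambda>x. weight x * ((X m x - X n x) - mean (\<lambda>x. X m x - X n x)))"
      by (simp add: V_def mean_diff[OF X X] algebra_simps)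
    then show ?thesis using C(2)[OF test_diff[OF X X], of m n] by (simp add: test_grad_diff[OF X X])
  qed
  have "\<exists>L\<in>L2. (\<lambda>n. nrm (\<lambda>x. V n x - L x)) \<longlonglongrightarrow> 0"
  proof (rule L2_complete[OF V])
    fix e :: real assume e: "e > 0"
    \<comment> \<open>\<open>C + 1\<close> instead of \<open>C\<close>, which may be 0.\<close>
    have "sqrt e / (C + 1) > 0" using e C(1) by simp
    from L2_Cauchy[OF test_grad_L2[OF X] F lim this]
    obtain N where N: "\<And>m n. m \<ge> N \<Longrightarrow> n \<ge> N \<Longrightarrow> nrm (\<lambda>x. grad (X m) x - grad (X n) x) < sqrt e / (C + 1)"
      by blast
    have "ip (\<lambda>x. V m x - V n x) (\<lambda>x. V m x - V n x) < e" if mn: "m \<ge> N" "n \<ge> N" for m n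
    proof -
      have "nrm (\<lambda>x. V m x - V n x) \<le> C * nrm (\<lambda>x. grad (X m) x - grad (X n) x)" by (rule Vd)
      also have "\<dots> \<le> (C + 1) * nrm (\<lambda>x. grad (X m) x - grad (X n) x)"
        by (intro mult_right_mono nrm_nonneg) simp
      also have "\<dots> < sqrt e" using N[OF mn] C(1) by (simp add: field_simps)
      finally show ?thesis by (simp add: nrm_def)
    qed
    then show "\<exists>N. \<forall>m\<ge>N. \<forall>n\<ge>N. ip (\<lambda>x. V m x - V n x) (\<lambda>x. V m x - V n x) < e" by blast
  qed
  then obtain L where L: "L \<in> L2" "(\<lambda>n. nrm (\<lambda>x. V n x - L x)) \<longlonglongrightarrow> 0" by blast
  define U where "U x = L x / weight x" for x
  have ci: "continuous_on UNIV (\<lambda>x. 1 / weight x)"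
    by (intro continuous_intros weight_continuous) (use weight_pos in \<open>auto simp: less_le\<close>)
  have Um: "U \<in> borel_measurable lebesgue"
  proof -
    have "(\<lambda>x. (1 / weight x) * L x) \<in> borel_measurable lebesgue"
      by (intro borel_measurable_times continuous_measurable_lebesgue ci L2_measurable L(1))
    then show ?thesis by (simp add: U_def[abs_def])
  qed
  have Uloc: "U \<in> L2_loc"
    unfolding L2_loc_def set_integrable_def
  proof (safe intro!: Um)
    fix K :: "plane set" assume K: "compact K"
    have "compact ((\<lambda>x. 1 / weight x) ` K)"
      by (intro compact_continuous_image K) (rule continuous_on_subset[OF ci], simp)
    then have "bounded ((\<lambda>x. 1 / weight x) ` K)" by (rule compact_imp_bounded)
    then obtain B where B: "\<And>x. x \<in> K \<Longrightarrow> \<bar>1 / weight x\<bar> \<le> B"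
      unfolding bounded_iff by auto
    show "integrable lebesgue (\<lambda>x. indicat_real K x *\<^sub>R (norm (U x))\<^sup>2)"
    proof (rule Bochner_Integration.integrable_bound)
      show "integrable lebesgue (\<lambda>x. B\<^sup>2 * (norm (L x))\<^sup>2)" using L2_integrable[OF L(1)] by simp
      have "K \<in> sets lebesgue" using lmeasurable_compact[OF K] by auto
      then show "(\<lambda>x. indicat_real K x *\<^sub>R (norm (U x))\<^sup>2) \<in> borel_measurable lebesgue"
        by (intro borel_measurable_scaleR borel_measurable_indicator borel_measurable_power measurable_compose[OF Um borel_measurable_norm])
      have "norm (indicat_real K x *\<^sub>R (norm (U x))\<^sup>2) \<le> norm (B\<^sup>2 * (norm (L x))\<^sup>2)" for x
      proof (cases "x \<in> K")
        case True
        have "\<bar>1 / weight x\<bar> \<le> \<bar>B\<bar>" using B[OF True] by linarith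
        then have "(1 / weight x)\<^sup>2 \<le> B\<^sup>2" by (simp only: abs_le_square_iff)
        then have "(1 / weight x)\<^sup>2 * (L x)\<^sup>2 \<le> B\<^sup>2 * (L x)\<^sup>2" by (intro mult_right_mono) auto
        then show ?thesis using True by (simp add: U_def power_divide)
      qed simp
      then show "AE x in lebesgue. norm (indicat_real K x *\<^sub>R (norm (U x))\<^sup>2) \<le> norm (B\<^sup>2 * (norm (L x))\<^sup>2)" by simp
    qed
  qed
  have "has_weak_grad U F"
    unfolding has_weak_grad_def
  proof (intro conjI ballI allI)
    show "U \<in> L1_loc" by (rule L2_loc_imp_L1_loc[OF Uloc])
    show "F \<in> L1_loc" by (rule L2_imp_L1_loc[OF F])
    fix \<psi> i assume q: "\<psi> \<in> test_functions"
    let ?g = "\<lambda>x. grad \<psi> x $ i"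
    obtain M where M: "\<And>x. norm x \<ge> M \<Longrightarrow> \<psi> x = 0 \<and> grad \<psi> x = 0" using test_bounded[OF q] by metis
    \<comment> \<open>Dividing the derivative of the test function by the weight undoes the weight
      in \<open>V n\<close>; compact support keeps the quotient in L2.\<close>
    have gw: "(\<lambda>x. ?g x / weight x) \<in> L2"
    proof (rule continuous_compact_support_L2[where M=M])
      have "continuous_on UNIV (\<lambda>x. ?g x * (1 / weight x))"
        using test_grad_Ck[OF q, of 0] by (intro continuous_on_mult ci) simp
      then show "continuous_on UNIV (\<lambda>x. ?g x / weight x)" by simp
    qed (use M in auto)
    have e: "(\<lambda>x. \<psi> x *\<^sub>R axis i 1 :: plane) \<in> L2"
      by (rule continuous_compact_support_L2[where M=M]) (use M test_continuous[OF q] in \<open>auto intro!: continuous_intros\<close>)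
    have wn: "weight x \<noteq> 0" for x using weight_pos[of x] by simp
    \<comment> \<open>The subtracted mean drops out, since a derivative of a test function has
      integral 0.\<close>
    have "ip (V n) (\<lambda>x. ?g x / weight x) = - ip (grad (X n)) (\<lambda>x. \<psi> x *\<^sub>R axis i 1)" for n
    proof -
      have gi: "integrable lebesgue ?g"
        using integrable_continuous_compact(2)[of ?g M] test_grad_Ck[OF q, of 0] M by simp
      have gX: "integrable lebesgue (\<lambda>x. ?g x * X n x)"
        using integrable_inner_L2[OF test_L2[OF test_grad[OF q]] test_L2[OF X]] by simp
      have "ip (V n) (\<lambda>x. ?g x / weight x) = (LINT x|lebesgue. ?g x * X n x - mean (X n) * ?g x)"
        unfolding ip_def V_def using wn by (intro Bochner_Integration.integral_cong) (auto simp: algebra_simps)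
      also have "\<dots> = (LINT x|lebesgue. ?g x * X n x)"
        using gi gX integral_grad_0[OF q, of i] by simp
      also have "\<dots> = - (LINT x|lebesgue. \<psi> x * (grad (X n) x $ i))"
        using has_weak_gradD[OF test_weak_grad[OF X] q, of i n] by simp
      also have "\<dots> = - ip (grad (X n)) (\<lambda>x. \<psi> x *\<^sub>R axis i 1)"
        by (simp add: ip_def inner_axis)
      finally show ?thesis .
    qed
    moreover have "(\<lambda>n. ip (V n) (\<lambda>x. ?g x / weight x)) \<longlonglongrightarrow> ip L (\<lambda>x. ?g x / weight x)"
      by (rule ip_tendsto[OF V L(1) gw L(2)])
    moreover have "(\<lambda>n. - ip (grad (X n)) (\<lambda>x. \<psi> x *\<^sub>R axis i 1)) \<longlonglongrightarrow> - ip F (\<lambda>x. \<psi> x *\<^sub>R axis i 1)"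
      by (intro tendsto_minus ip_tendsto test_grad_L2 X F e lim)
    ultimately have "ip L (\<lambda>x. ?g x / weight x) = - ip F (\<lambda>x. \<psi> x *\<^sub>R axis i 1)"
      using LIMSEQ_unique by simp
    then show "(LINT x|lebesgue. (grad \<psi> x $ i) *\<^sub>R U x) = - (LINT x|lebesgue. \<psi> x *\<^sub>R (F x $ i))"
      by (simp add: ip_def U_def inner_axis mult.commute)
  qed
  then show ?thesis using that[of U] Uloc F by (auto simp: H1_dot_def)
qed

subsection \<open>Weakly harmonic functions with square integrable gradient\<close>

text \<open>The square of the distance, so that smooth functions of it are smooth at the centre
  \<open>y\<close> too.\<close>

definition sqdist :: "plane \<Rightarrow> plane \<Rightarrow> real" where
  "sqdist y x = (x $ 1 - y $ 1)\<^sup>2 + (x $ 2 - y $ 2)\<^sup>2"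

lemma sqdist_norm: "sqdist y x = (norm (x - y))\<^sup>2"
  unfolding power2_norm_eq_inner by (simp add: sqdist_def inner_vec_def UNIV_2 power2_eq_square)

lemma coord_diff_Ck: "Ck k (\<lambda>x. x $ i - c)"
  using Ck_add[OF Ck_nth[of k i] Ck_const[of k "- c"]] by simp

lemma sqdist_Ck: "Ck k (sqdist y)"
  unfolding sqdist_def[abs_def] power2_eq_square by (intro Ck_add Ck_mult[OF coord_diff_Ck coord_diff_Ck])

lemma coord_diff_has_derivative: "((\<lambda>x::plane. x $ i - c) has_derivative (\<lambda>h. h $ i)) (at x)"
  using has_derivative_diff[OF nth_has_derivative has_derivative_const] by simp

lemma sqdist_has_derivative:
  "(sqdist y has_derivative (\<lambda>h. 2 * (x $ 1 - y $ 1) * h $ 1 + 2 * (x $ 2 - y $ 2) * h $ 2)) (at x)"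
  unfolding sqdist_def[abs_def] power2_eq_square
  by (rule has_derivative_eq_rhs[OF has_derivative_add[OF has_derivative_mult[OF coord_diff_has_derivative coord_diff_has_derivative]
      has_derivative_mult[OF coord_diff_has_derivative coord_diff_has_derivative]]]) (simp add: fun_eq_iff algebra_simps)

lemma grad_coord_diff: "grad (\<lambda>x. x $ i - c) x = axis i 1"
  by (simp add: vec_eq_iff grad_nth[OF coord_diff_has_derivative] axis_def)

lemma grad_sqdist: "grad (sqdist y) x = 2 *\<^sub>R (x - y)"
  by (simp add: vec_eq_iff grad_nth[OF sqdist_has_derivative] forall_2 axis_def)

lemma sqdist_differentiable: "sqdist y differentiable (at x)"
  using sqdist_has_derivative differentiable_def by blast

lemma grad_radial:
  assumes "\<And>t. (g has_real_derivative g' t) (at t)"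
  shows "grad (\<lambda>x. g (sqdist y x)) x = (2 * g' (sqdist y x)) *\<^sub>R (x - y)"
  using grad_comp[OF sqdist_differentiable assms] by (simp add: grad_sqdist mult.commute)

lemma radial_test:
  assumes g: "smooth_real g" "\<And>t. t \<ge> b \<Longrightarrow> g t = 0" and h: "\<And>k. Ck k h"
  shows "(\<lambda>x. h x * g (sqdist y x)) \<in> test_functions"
proof (rule test_functionsI[where M="norm y + \<bar>b\<bar> + 1"])
  show "Ck k (\<lambda>x. h x * g (sqdist y x))" for k
    using g(1) by (intro Ck_mult h Ck_comp[OF _ sqdist_Ck]) (auto simp: smooth_real_def)
  show "h x * g (sqdist y x) = 0" if "norm x > norm y + \<bar>b\<bar> + 1" for x
  proof -
    have "norm (x - y) \<ge> \<bar>b\<bar> + 1" using that norm_triangle_ineq2[of x y] by linarith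
    then have "\<bar>b\<bar> + 1 \<le> norm (x - y) * norm (x - y)"
      using mult_mono[of "\<bar>b\<bar> + 1" "norm (x - y)" 1 "norm (x - y)"] by simp
    then have "sqdist y x \<ge> b" unfolding sqdist_norm power2_eq_square by linarith
    then show ?thesis using g(2) by simp
  qed
qed

text \<open>The test function is \<open>\<Phi>(x) = (x - y)\<^sub>i g(|x - y|\<^sup>2)\<close>; its Laplacian is the \<open>i\<close>-th derivative of
  \<open>2 (t g)'(|x - y|\<^sup>2)\<close>, so that no third derivatives are needed.\<close>

lemma weakly_harmonic_radial_average:
  assumes U: "has_weak_grad U G" and G: "G \<in> L2"
    and ort: "\<And>\<phi>. \<phi> \<in> test_functions \<Longrightarrow> ip G (grad \<phi>) = 0"
    and g: "\<And>t. (g has_real_derivative g1 t) (at t)" "\<And>t. (g1 has_real_derivative g2 t) (at t)"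
    and s: "smooth_real g" "smooth_real g1"
    and z: "\<And>t. t \<ge> b \<Longrightarrow> g t = 0" "\<And>t. t \<ge> b \<Longrightarrow> g1 t = 0"
  shows "(LINT x|lebesgue. (sqdist y x * g1 (sqdist y x) + g (sqdist y x)) * (G x $ i)) = 0"
proof -
  let ?q = "sqdist y"
  define Z where "Z j x = x $ j - y $ j" for j and x :: plane
  define h0 where "h0 x = g (?q x)" for x
  define h1 where "h1 x = g1 (?q x)" for x
  define h2 where "h2 x = g2 (?q x)" for x
  have dZ: "Z j differentiable (at x)" for j x
    unfolding Z_def[abs_def] using coord_diff_has_derivative differentiable_def by blast
  have gZ: "grad (Z j) x = axis j 1" for j x unfolding Z_def[abs_def] by (rule grad_coord_diff)
  have dh: "h0 differentiable (at x)" "h1 differentiable (at x)" for x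
    unfolding h0_def[abs_def] h1_def[abs_def]
    by (rule comp_differentiable[OF sqdist_differentiable g(1)], rule comp_differentiable[OF sqdist_differentiable g(2)])
  have gh0: "grad h0 x = (2 * h1 x) *\<^sub>R (x - y)" for x
    unfolding h0_def[abs_def] h1_def by (rule grad_radial[OF g(1)])
  have gh1: "grad h1 x = (2 * h2 x) *\<^sub>R (x - y)" for x
    unfolding h1_def[abs_def] h2_def by (rule grad_radial[OF g(2)])
  have CkZ: "Ck k (Z j)" for k j unfolding Z_def[abs_def] by (rule coord_diff_Ck)
  have \<Phi>: "(\<lambda>x. Z i x * h0 x) \<in> test_functions" (is "?\<Phi> \<in> _")
    unfolding h0_def by (rule radial_test[OF s(1) z(1) CkZ])
  have g\<Phi>: "(\<lambda>x. grad ?\<Phi> x $ j) = (\<lambda>x. 2 * (Z i x * (Z j x * h1 x)) + (axis i 1 $ j :: real) * h0 x)" for j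
    unfolding grad_mult[OF dZ dh(1)] gh0 gZ by (simp add: Z_def algebra_simps)
  have d1: "(\<lambda>x. Z j x * h1 x) differentiable (at x)" for j x
    by (rule differentiable_mult[OF dZ dh(2)])
  have d2: "(\<lambda>x. Z i x * (Z j x * h1 x)) differentiable (at x)" for j x
    by (rule differentiable_mult[OF dZ d1])
  have dc: "(\<lambda>x. c * f x) differentiable (at x)" if "f differentiable (at x)" for c :: real and f and x :: plane
    by (rule differentiable_mult[OF _ that]) simp
  have gg: "grad (\<lambda>x. grad ?\<Phi> x $ j) x $ j
     = 2 * (Z i x * (Z j x * (2 * h2 x * Z j x) + h1 x) + Z j x * h1 x * (axis i 1 $ j)) + (axis i 1 $ j) * (2 * h1 x * Z j x)" for j x
    unfolding g\<Phi> grad_add[OF dc[OF d2] dc[OF dh(1)]] grad_cmult[OF d2] grad_cmult[OF dh(1)] grad_mult[OF dZ d1]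
      grad_mult[OF dZ dh(2)] gh0 gh1 gZ
    by (simp add: Z_def axis_def)
  \<comment> \<open>The Laplacian of the test function. In two dimensions the radial factor
    contributes 4 q g'' + 4 g', and the cross term with the linear factor contributes another 4
    g'.\<close>
  define m where "m x = Z i x * (4 * ?q x * h2 x + 8 * h1 x)" for x
  have lap: "grad (\<lambda>x. grad ?\<Phi> x $ 1) x $ 1 + grad (\<lambda>x. grad ?\<Phi> x $ 2) x $ 2 = m x" for x
  proof -
    have q: "?q x = Z 1 x * Z 1 x + Z 2 x * Z 2 x" by (simp add: sqdist_def Z_def power2_eq_square)
    have "i = 1 \<or> i = 2" using exhaust_2 by blast
    then show ?thesis unfolding gg m_def q by (auto simp: axis_def algebra_simps)
  qed
  have UL: "U \<in> L1_loc" using U by (simp add: has_weak_grad_def)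
  have t1: "(\<lambda>x. grad ?\<Phi> x $ j) \<in> test_functions" for j by (rule test_grad[OF \<Phi>])
  \<comment> \<open>One integration by parts moves a derivative from the Laplacian to
    \<open>U\<close>, leaving the product of \<open>G\<close> with a test gradient, which vanishes
    by hypothesis.\<close>
  have mU: "(LINT x|lebesgue. m x * U x) = 0"
  proof -
    have i1: "integrable lebesgue (\<lambda>x. grad (\<lambda>x. grad ?\<Phi> x $ j) x $ j * U x)" for j
      using L1_loc_test_integrable[OF UL test_grad[OF t1]] by simp
    have i2: "integrable lebesgue (\<lambda>x. grad ?\<Phi> x $ j * G x $ j)" for j
      using integrable_inner_L2[OF L2_cmult[of "\<lambda>x. grad ?\<Phi> x $ j" 1] L2_cmult]
        L1_loc_test_integrable[OF L1_loc_nth[OF L2_imp_L1_loc[OF G]] t1] by simp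
    have "(LINT x|lebesgue. m x * U x) = (LINT x|lebesgue. grad (\<lambda>x. grad ?\<Phi> x $ 1) x $ 1 * U x + grad (\<lambda>x. grad ?\<Phi> x $ 2) x $ 2 * U x)"
      by (simp only: lap[symmetric] distrib_right)
    also have "\<dots> = (LINT x|lebesgue. grad (\<lambda>x. grad ?\<Phi> x $ 1) x $ 1 * U x) + (LINT x|lebesgue. grad (\<lambda>x. grad ?\<Phi> x $ 2) x $ 2 * U x)"
      by (rule Bochner_Integration.integral_add[OF i1 i1])
    also have "\<dots> = - ((LINT x|lebesgue. grad ?\<Phi> x $ 1 * G x $ 1) + (LINT x|lebesgue. grad ?\<Phi> x $ 2 * G x $ 2))"
      using has_weak_gradD[OF U t1, of 1 1] has_weak_gradD[OF U t1, of 2 2] by simp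
    also have "\<dots> = - (LINT x|lebesgue. grad ?\<Phi> x $ 1 * G x $ 1 + grad ?\<Phi> x $ 2 * G x $ 2)"
      by (subst Bochner_Integration.integral_add[OF i2 i2]) simp
    also have "\<dots> = - ip G (grad ?\<Phi>)"
      by (simp add: ip_def inner_vec_def UNIV_2 mult.commute)
    finally show ?thesis using ort[OF \<Phi>] by simp
  qed
  \<comment> \<open>Twice the derivative of t g(t). Its composition with the squared distance has
    \<open>m\<close> as i-th partial derivative, so a second integration by parts turns
    \<open>mU\<close> into a statement about the i-th component of \<open>G\<close>.\<close>
  let ?M = "\<lambda>t. 2 * (t * g1 t + g t)"
  have M': "(?M has_real_derivative 2 * (t * g2 t + g1 t + g1 t)) (at t)" for t
    by (auto intro!: derivative_eq_intros g)
  have sM: "smooth_real ?M"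
  proof -
    have "smooth_real (\<lambda>t. t)" using Ck_real_affine[of _ 1 0] by (simp add: smooth_real_def)
    then show ?thesis by (intro smooth_real_mult smooth_real_add smooth_real_const s)
  qed
  have tM: "(\<lambda>x. ?M (?q x)) \<in> test_functions"
    using radial_test[OF sM _ Ck_const[of _ 1], of b y] z by simp
  have "grad (\<lambda>x. ?M (?q x)) x $ i = m x" for x
    unfolding grad_radial[OF M'] by (simp add: m_def h1_def h2_def Z_def algebra_simps)
  then have "(LINT x|lebesgue. ?M (?q x) * (G x $ i)) = 0"
    using has_weak_gradD[OF U tM, of i] mU by simp
  then have "(LINT x|lebesgue. 2 * ((?q x * g1 (?q x) + g (?q x)) * (G x $ i))) = 0"
    by (simp only: mult.assoc)
  then show ?thesis unfolding integral_mult_right_zero by simp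
qed

text \<open>Evaluated at \<open>sqdist y x / r\<close> it is a smooth weight on the annulus of
  squared radii between r and 2 r. The support stays away from 0 so that an antiderivative can be
  divided by t without losing smoothness.\<close>

definition profile :: "real \<Rightarrow> real" where
  "profile = pulse 1 1 2"

lemma profile_bounds: "0 \<le> profile t" "profile t \<le> 1"
  by (simp_all add: profile_def pulse_bounds)

lemma profile_eq_0: "t \<notin> {1<..<2} \<Longrightarrow> profile t = 0"
  unfolding profile_def by (rule pulse_eq_0) auto

lemma profile_smooth: "smooth_real profile"
  unfolding profile_def by (rule pulse_smooth)

lemma profile_continuous: "continuous_on S profile"
  using smooth_real_continuous[OF profile_smooth] continuous_on_subset by blast

text \<open>A smooth step from 0 to the positive constant \<open>k 2\<close>. It serves twice: for
  comparing two annuli, and for the cutoff in \<open>cutoff_exists\<close>.\<close>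

lemma profile_antiderivative:
  obtains k where "\<And>t. (k has_real_derivative profile t) (at t)" "smooth_real k"
    "\<And>t. t \<le> 1 \<Longrightarrow> k t = 0" "\<And>t. t \<ge> 2 \<Longrightarrow> k t = k 2" "k 2 > 0"
proof -
  define k where "k t = integral {1..t} profile" for t
  have k: "(k has_real_derivative profile t) (at t)" "smooth_real k" for t
    unfolding k_def[abs_def] using smooth_real_antiderivative[OF profile_smooth, of 1] profile_eq_0 by auto
  have k0: "k t = 0" if "t \<le> 1" for t
    using that by (cases "t = 1") (auto simp: k_def)
  have k2: "k t = k 2" if "t \<ge> 2" for t
  proof -
    have "k t = k 2 + integral {2..t} profile"
      unfolding k_def using that
      by (intro Henstock_Kurzweil_Integration.integral_combine[symmetric] integrable_continuous_interval profile_continuous) auto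
    also have "integral {2..t} profile = 0" using profile_eq_0 by (intro integral_unique has_integral_is_0) auto
    finally show ?thesis by simp
  qed
  have "k 2 > 0" unfolding k_def profile_def by (rule pulse_integral_pos) auto
  with that k k0 k2 show thesis by metis
qed

text \<open>With \<open>k' = profile\<close>, the choice \<open>t g(t) = k(t/r) - k(t/s)\<close> gives
  \<open>(t g)' = profile(t/r)/r - profile(t/s)/s\<close>; \<open>g\<close> is smooth because \<open>k\<close> vanishes near 0.\<close>

lemma radial_average_scale_invariant:
  assumes U: "has_weak_grad U G" and G: "G \<in> L2"
    and ort: "\<And>\<phi>. \<phi> \<in> test_functions \<Longrightarrow> ip G (grad \<phi>) = 0"
    and rs: "0 < r" "r < s"
  shows "(LINT x|lebesgue. (profile (sqdist y x / r) / r) * (G x $ i)) = (LINT x|lebesgue. (profile (sqdist y x / s) / s) * (G x $ i))"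
proof -
  obtain k where k: "\<And>t. (k has_real_derivative profile t) (at t)" "smooth_real k"
    and k0: "\<And>t. t \<le> 1 \<Longrightarrow> k t = 0" and k2: "\<And>t. t \<ge> 2 \<Longrightarrow> k t = k 2"
    using profile_antiderivative by metis
  \<comment> \<open>Near 0 both steps vanish; beyond 2 s both have reached the same value
    \<open>k 2\<close> and cancel. Hence \<open>a\<close> has compact support in the positive half
    line.\<close>
  define a where "a t = k (t / r) - k (t / s)" for t
  have sa: "smooth_real a"
  proof -
    have "smooth_real (\<lambda>t. k ((1 / r) * t + 0) + (-1) * k ((1 / s) * t + 0))"
      by (intro smooth_real_add smooth_real_mult smooth_real_const smooth_real_compose_affine k(2))
    then show ?thesis by (simp add: a_def[abs_def])
  qed
  have a0: "a t = 0" if "t \<le> r" for t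
  proof -
    have "t / r \<le> 1" "t / s \<le> 1" using that rs by (auto simp: divide_le_eq)
    then show ?thesis by (simp add: a_def k0)
  qed
  have ainf: "a t = 0" if "t \<ge> 2 * s" for t
  proof -
    have "t / r \<ge> 2" "t / s \<ge> 2" using that rs by (auto simp: le_divide_eq)
    then show ?thesis using k2[of "t / r"] k2[of "t / s"] by (simp add: a_def)
  qed
  have da: "(a has_real_derivative profile (t / r) / r - profile (t / s) / s) (at t)" for t
  proof -
    have "((\<lambda>t. k (t / c)) has_real_derivative profile (t / c) * (1 / c)) (at t)" if "c > 0" for c
      by (rule DERIV_chain2[OF k(1)]) (use that in \<open>auto intro!: derivative_eq_intros\<close>)
    from DERIV_diff[OF this[of r] this[of s]] show ?thesis using rs by (simp add: a_def[abs_def])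
  qed
  define g where "g t = a t / t" for t
  have sg: "smooth_real g" unfolding g_def[abs_def] by (rule smooth_real_divide[OF sa rs(1) a0])
  obtain g1 where g1: "\<And>t. (g has_real_derivative g1 t) (at t)" "smooth_real g1"
    using smooth_real_deriv[OF sg] by metis
  obtain g2 where g2: "\<And>t. (g1 has_real_derivative g2 t) (at t)"
    using smooth_real_deriv[OF g1(2)] by metis
  \<comment> \<open>At t = 0 the product is 0, which agrees with \<open>a 0 = 0\<close>.\<close>
  have tg: "(\<lambda>t. t * g t) = a" using a0[of 0] rs by (auto simp: g_def)
  have tg1: "t * g1 t + g t = profile (t / r) / r - profile (t / s) / s" for t
  proof -
    have "((\<lambda>t. t * g t) has_real_derivative t * g1 t + g t) (at t)"
      by (auto intro!: derivative_eq_intros g1)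
    then show ?thesis using da[of t] DERIV_unique unfolding tg by blast
  qed
  have zg: "g t = 0" if "t \<ge> 2 * s" for t using ainf[OF that] by (simp add: g_def)
  have zg1: "g1 t = 0" if "t \<ge> 2 * s" for t
  proof -
    have "t / r \<ge> 2" "t / s \<ge> 2" using that rs by (auto simp: le_divide_eq)
    then have "t * g1 t = 0" using tg1[of t] zg[OF that] profile_eq_0 by simp
    then show ?thesis using that rs by simp
  qed
  have "(LINT x|lebesgue. (sqdist y x * g1 (sqdist y x) + g (sqdist y x)) * (G x $ i)) = 0"
    by (rule weakly_harmonic_radial_average[OF U G ort g1(1) g2 sg g1(2) zg zg1])
  then have "(LINT x|lebesgue. (profile (sqdist y x / r) / r) * (G x $ i) - (profile (sqdist y x / s) / s) * (G x $ i)) = 0"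
    unfolding tg1 by (simp add: left_diff_distrib)
  moreover have "integrable lebesgue (\<lambda>x. (profile (sqdist y x / c) / c) * (G x $ i))" if c: "c > 0" for c
  proof -
    have "smooth_real (\<lambda>t. (1 / c) * profile ((1 / c) * t + 0))"
      by (intro smooth_real_mult smooth_real_const smooth_real_compose_affine profile_smooth)
    moreover have "(1 / c) * profile ((1 / c) * t + 0) = 0" if "t \<ge> 2 * c" for t
    proof -
      have "t / c \<ge> 2" using that c by (simp add: le_divide_eq)
      then show ?thesis by (simp add: profile_eq_0)
    qed
    ultimately have "(\<lambda>x. 1 * ((1 / c) * profile ((1 / c) * sqdist y x + 0))) \<in> test_functions"
      by (rule radial_test[OF _ _ Ck_const])
    from L1_loc_test_integrable[OF L1_loc_nth[OF L2_imp_L1_loc[OF G]] this] show ?thesis by simp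
  qed
  ultimately show ?thesis using rs by simp
qed

lemma scaled_profile_test:
  assumes "r > 0"
  shows "(\<lambda>x. profile (sqdist y x / r)) \<in> test_functions"
proof -
  have "smooth_real (\<lambda>t. profile ((1 / r) * t + 0))"
    by (intro smooth_real_compose_affine profile_smooth)
  moreover have "profile ((1 / r) * t + 0) = 0" if "t \<ge> 2 * r" for t
  proof -
    have "t / r \<ge> 2" using that assms by (simp add: le_divide_eq)
    then show ?thesis by (simp add: profile_eq_0)
  qed
  ultimately have "(\<lambda>x. 1 * profile ((1 / r) * sqdist y x + 0)) \<in> test_functions"
    by (rule radial_test[OF _ _ Ck_const])
  then show ?thesis by simp
qed

text \<open>The function is at most 1/s with s = 2 n^2 and lives in a square of side 4 n, because
  its squared radius is at most 2 s = (2 n)^2. Its squared norm is thus at most 16 n^2 / (4 n^4),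
  which is (2 / n)^2.\<close>

lemma scaled_profile_nrm:
  assumes "n > 0"
  shows "nrm (\<lambda>x. profile (sqdist y x / (2 * n\<^sup>2)) / (2 * n\<^sup>2)) \<le> 2 / n"
proof -
  let ?s = "2 * n\<^sup>2" and ?Q = "cbox (y - vec (2 * n)) (y + vec (2 * n)) :: plane set"
  let ?h = "\<lambda>x. profile (sqdist y x / ?s) / ?s"
  have s: "?s > 0" using assms by simp
  have le: "(norm (?h x))\<^sup>2 \<le> (1 / ?s)\<^sup>2 * indicat_real ?Q x" for x
  proof (cases "x \<in> ?Q")
    case True
    have "profile (sqdist y x / ?s) \<le> 1" "profile (sqdist y x / ?s) \<ge> 0" by (rule profile_bounds)+
    then have "\<bar>?h x\<bar> \<le> \<bar>1 / ?s\<bar>" using s by (simp add: divide_right_mono)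
    then show ?thesis using True by (simp only: abs_le_square_iff real_norm_def power2_abs) simp
  next
    case False
    have "sqdist y x \<ge> (2 * n)\<^sup>2"
    proof -
      obtain j where "\<not> (\<bar>x $ j - y $ j\<bar> \<le> 2 * n)"
        using False by (auto simp: mem_box_cart abs_le_iff algebra_simps)
      then have "(2 * n)\<^sup>2 \<le> (x $ j - y $ j)\<^sup>2"
        using assms by (intro abs_le_square_iff[THEN iffD1]) auto
      moreover have "(x $ j - y $ j)\<^sup>2 \<le> sqdist y x"
        using exhaust_2[of j] by (auto simp: sqdist_def)
      ultimately show ?thesis by linarith
    qed
    then have "sqdist y x / ?s \<ge> 2" using s by (simp add: le_divide_eq power2_eq_square)
    then show ?thesis by (simp add: profile_eq_0)
  qed
  have "(\<integral>\<^sup>+x. ennreal ((norm (?h x))\<^sup>2) \<partial>lebesgue) \<le> (\<integral>\<^sup>+x. ennreal ((1 / ?s)\<^sup>2) * indicator ?Q x \<partial>lebesgue)"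
  proof (rule nn_integral_mono)
    fix x show "ennreal ((norm (?h x))\<^sup>2) \<le> ennreal ((1 / ?s)\<^sup>2) * indicator ?Q x"
      using ennreal_leI[OF le[of x]] by (auto simp: indicator_def)
  qed
  also have "\<dots> = ennreal ((1 / ?s)\<^sup>2) * emeasure lebesgue ?Q"
    by (rule nn_integral_cmult_indicator) simp
  also have "emeasure lebesgue ?Q = (\<Prod>b\<in>Basis. ((y + vec (2 * n)) - (y - vec (2 * n))) \<bullet> b)"
    using assms by (simp, subst emeasure_lborel_cbox) (auto simp: Basis_vec_def inner_axis)
  also have "\<dots> = ennreal (4 * n * (4 * n))"
    by (simp add: prod_Basis_plane inner_axis)
  also have "ennreal ((1 / ?s)\<^sup>2) * \<dots> = ennreal ((2 / n)\<^sup>2)"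
    using assms by (subst ennreal_mult[symmetric]) (auto simp: field_simps power2_eq_square)
  finally have "ip ?h ?h \<le> (2 / n)\<^sup>2"
  proof (rule L2_nn_integral(2)[rotated])
    have "?h \<in> L2" using L2_cmult[OF test_L2[OF scaled_profile_test[OF s, of y]], of "1 / ?s"] by simp
    then show "?h \<in> borel_measurable lebesgue" by (rule L2_measurable)
  qed simp
  then show ?thesis using assms unfolding nrm_def by (intro real_le_lsqrt) (auto simp: ip_self_nonneg)
qed

lemma L2_nth:
  fixes G :: "plane \<Rightarrow> 'a::euclidean_space ^ 2"
  assumes "G \<in> L2" shows "(\<lambda>x. G x $ i) \<in> L2"
proof (rule L2I)
  show m: "(\<lambda>x. G x $ i) \<in> borel_measurable lebesgue"
    by (rule L1_loc_measurable[OF L1_loc_nth[OF L2_imp_L1_loc[OF assms]]])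
  show "integrable lebesgue (\<lambda>x. (norm (G x $ i))\<^sup>2)"
  proof (rule Bochner_Integration.integrable_bound[OF L2_integrable[OF assms]])
    show "(\<lambda>x. (norm (G x $ i))\<^sup>2) \<in> borel_measurable lebesgue"
      by (intro borel_measurable_power measurable_compose[OF m borel_measurable_norm])
    show "AE x in lebesgue. norm ((norm (G x $ i))\<^sup>2) \<le> norm ((norm (G x))\<^sup>2)"
      by (intro AE_I2) (simp add: power_mono Finite_Cartesian_Product.norm_nth_le)
  qed
qed

text \<open>The normalised average does not change when the annulus is enlarged, but Cauchy-Schwarz
  bounds it by the norm of the component of \<open>G\<close> times the norm of the averaging weight,
  which decays.\<close>

lemma radial_average_0:
  assumes U: "has_weak_grad U G" and G: "G \<in> L2"
    and ort: "\<And>\<phi>. \<phi> \<in> test_functions \<Longrightarrow> ip G (grad \<phi>) = 0"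
    and r: "0 < r"
  shows "(LINT x|lebesgue. profile (sqdist y x / r) * (G x $ i)) = 0"
proof -
  define A where "A s = (LINT x|lebesgue. (profile (sqdist y x / s) / s) * (G x $ i))" for s
  have bound: "\<bar>A r\<bar> \<le> 2 * nrm (\<lambda>x. G x $ i) * (1 / real (Suc n))" if n: "real (Suc n) > r" for n
  proof -
    let ?n = "real (Suc n)"
    let ?s = "2 * ?n\<^sup>2"
    have s: "?s > 0" by simp
    \<comment> \<open>Scale invariance compares r with a strictly larger scale;
      \<open>real (Suc n)\<close> is at least 1 and exceeds r, so 2 \<open>real (Suc n)\<close>
      squared does as well.\<close>
    have "r < 2 * p\<^sup>2" if "1 \<le> p" "r < p" for p
      using mult_left_mono[of 1 p p] that unfolding power2_eq_square by linarith
    from this[OF _ n] have "r < ?s" by simp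
    from radial_average_scale_invariant[OF U G ort r this] have "A r = A ?s" unfolding A_def .
    also have "\<dots> = ip (\<lambda>x. profile (sqdist y x / ?s) / ?s) (\<lambda>x. G x $ i)" by (simp add: A_def ip_def)
    finally have "\<bar>A r\<bar> \<le> nrm (\<lambda>x. profile (sqdist y x / ?s) / ?s) * nrm (\<lambda>x. G x $ i)"
      using ip_Cauchy_Schwarz[OF L2_cmult[OF test_L2[OF scaled_profile_test[OF s]], of "1 / ?s"] L2_nth[OF G]] by simp
    also have "\<dots> \<le> 2 / ?n * nrm (\<lambda>x. G x $ i)"
      by (intro mult_right_mono scaled_profile_nrm nrm_nonneg) simp
    finally show ?thesis by simp
  qed
  have "\<bar>A r\<bar> \<le> 0"
  proof (rule LIMSEQ_le_const)
    show "(\<lambda>n. 2 * nrm (\<lambda>x. G x $ i) * (1 / real (Suc n))) \<longlonglongrightarrow> 0"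
      using tendsto_mult_right[OF LIMSEQ_inverse_real_of_nat, of "2 * nrm (\<lambda>x. G x $ i)"]
      by (simp add: inverse_eq_divide mult.commute)
    obtain N where N: "real N > r" using reals_Archimedean2 by blast
    show "\<exists>N. \<forall>n\<ge>N. \<bar>A r\<bar> \<le> 2 * nrm (\<lambda>x. G x $ i) * (1 / real (Suc n))"
    proof (intro exI allI impI)
      fix n assume "N \<le> n"
      then have "real (Suc n) > r" using N by (simp add: of_nat_mono order.strict_trans2)
      then show "\<bar>A r\<bar> \<le> 2 * nrm (\<lambda>x. G x $ i) * (1 / real (Suc n))" by (rule bound)
    qed
  qed
  then have "A r = 0" by simp
  moreover have "A r = (LINT x|lebesgue. (1 / r) * (profile (sqdist y x / r) * (G x $ i)))" by (simp add: A_def)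
  ultimately show ?thesis using r by (simp only: integral_mult_right_zero) simp
qed

text \<open>The averages \<open>\<integral> profile(|x - y|\<^sup>2/r) G\<^sub>i(x) dx\<close> vanish for all \<open>y\<close> and \<open>r\<close>; integrating them against a
  test function in \<open>y\<close> and letting \<open>r\<close> tend to 0 shows that \<open>G\<^sub>i = 0\<close>.\<close>

lemma weakly_harmonic_grad_0:
  assumes U: "has_weak_grad U G" and G: "G \<in> L2"
    and ort: "\<And>\<phi>. \<phi> \<in> test_functions \<Longrightarrow> ip G (grad \<phi>) = 0"
  shows "AE x in lebesgue. G x = 0"
proof -
  have "AE x in lebesgue. G x $ i = 0" for i
  proof (rule fundamental_lemma)
    show GL: "(\<lambda>x. G x $ i) \<in> L1_loc" by (rule L1_loc_nth[OF L2_imp_L1_loc[OF G]])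
    fix a b assume ab: "bump_real a" "bump_real b"
    define \<phi> where "\<phi> x = a (x $ 1) * b (x $ 2)" for x :: plane
    have \<phi>: "\<phi> \<in> test_functions" unfolding \<phi>_def by (rule tensor_test[OF ab])
    obtain M B where M: "M > 0" "\<And>x. norm x \<ge> M \<Longrightarrow> \<phi> x = 0 \<and> grad \<phi> x = 0" and B: "\<And>x. \<bar>\<phi> x\<bar> \<le> B"
      using test_bounded[OF \<phi>] by metis
    have c\<phi>: "continuous_on S \<phi>" for S using test_continuous[OF \<phi>] continuous_on_subset by blast
    have "(\<lambda>x. G x $ i) \<in> borel_measurable (completion lborel)" by (rule L1_loc_measurable[OF GL])
    \<comment> \<open>Fubini's theorem will be applied on the product of Borel measures, so a Borel
      representative replaces the component of \<open>G\<close>.\<close>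
    from completion_ex_borel_measurable_real[OF this]
    obtain g where g[measurable]: "g \<in> borel_measurable lborel" and ae: "AE x in lborel. G x $ i = g x" by auto
    have ae': "AE x in lebesgue. G x $ i = g x" using ae by (rule AE_completion)
    have gm: "g \<in> borel_measurable lebesgue" using g by (intro measurable_completion)
    have transfer: "(LINT x|lebesgue. \<psi> x * (G x $ i)) = (LINT x|lborel. \<psi> x * g x)" if "continuous_on UNIV \<psi>" for \<psi>
    proof -
      have m: "\<psi> \<in> borel_measurable lborel" using that by (simp add: borel_measurable_continuous_onI)
      have "(LINT x|lebesgue. \<psi> x * (G x $ i)) = (LINT x|lebesgue. \<psi> x * g x)"
      proof (rule integral_cong_AE)
        show "(\<lambda>x. \<psi> x * (G x $ i)) \<in> borel_measurable lebesgue" "(\<lambda>x. \<psi> x * g x) \<in> borel_measurable lebesgue"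
          by (intro borel_measurable_times continuous_measurable_lebesgue that gm L1_loc_measurable[OF GL])+
      qed (use ae' in eventually_elim, simp)
      also have "\<dots> = (LINT x|lborel. \<psi> x * g x)"
        by (rule integral_completion) (use m g in measurable)
      finally show ?thesis .
    qed
    \<comment> \<open>The margin 1 beyond the support of the test function is room for the averaging
      kernel, whose range is at most 1. On this disc \<open>g\<close> is integrable.\<close>
    define g1 where "g1 x = indicat_real (cball 0 (M + 1)) x * g x" for x
    have g1i: "integrable lborel g1"
    proof -
      have i: "integrable lebesgue (\<lambda>x. indicat_real (cball 0 (M + 1)) x *\<^sub>R (G x $ i))"
        using GL by (auto simp: L1_loc_def set_integrable_def)
      have m: "g1 \<in> borel_measurable lborel" unfolding g1_def[abs_def]
        by (intro borel_measurable_times borel_measurable_indicator g) simp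
      have "integrable lebesgue g1"
        by (rule integrable_cong_AE_imp[OF i measurable_completion[OF m]]) (use ae' in eventually_elim, simp add: g1_def)
      then show ?thesis using m by (simp add: integrable_completion)
    qed
    then have [measurable]: "g1 \<in> borel_measurable borel" by auto
    define I where "I = (LINT x|lborel. \<phi> x * g1 x)"
    define C where "C = (LINT x|lborel. \<bar>g1 x\<bar>)"
    have C: "C \<ge> 0" by (simp add: C_def)
    have est: "\<bar>I\<bar> \<le> e * C" if e: "e > 0" for e
    proof -
      have "uniformly_continuous_on (cball 0 (M + 1)) \<phi>"
        by (intro compact_uniformly_continuous c\<phi>) auto
      then obtain d0 where d0: "d0 > 0" "\<And>x y. x \<in> cball 0 (M + 1) \<Longrightarrow> y \<in> cball 0 (M + 1) \<Longrightarrow> dist y x < d0 \<Longrightarrow> dist (\<phi> y) (\<phi> x) < e"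
        using e unfolding uniformly_continuous_on_def by metis
      define d where "d = min d0 1"
      have d: "d > 0" "d \<le> 1" "d \<le> d0" using d0 by (auto simp: d_def)
      have uc: "\<bar>\<phi> y - \<phi> x\<bar> \<le> e" if xy: "norm (x - y) < d" for x y
      proof (cases "norm x < M \<or> norm y < M")
        case True
        have "norm x \<le> norm y + norm (x - y)" "norm y \<le> norm x + norm (x - y)"
          using norm_triangle_sub[of x y] norm_triangle_sub[of y x] by (simp_all add: norm_minus_commute)
        then have "x \<in> cball 0 (M + 1)" "y \<in> cball 0 (M + 1)" using True xy d by auto
        moreover have "dist y x < d0" using xy d by (simp add: dist_norm norm_minus_commute)
        ultimately have "dist (\<phi> y) (\<phi> x) < e" by (rule d0(2))
        then show ?thesis by (simp add: dist_real_def)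
      next
        case False
        then show ?thesis using M(2)[of x] M(2)[of y] e by auto
      qed
      \<comment> \<open>\<open>profile\<close> vanishes from 2 on, so with this r the kernel
        \<open>K\<close> vanishes once the distance reaches \<open>d\<close>. The kernel is an
        unnormalised mollifier with mass \<open>m\<close>.\<close>
      define r where "r = d\<^sup>2 / 2"
      have r: "r > 0" using d by (simp add: r_def)
      define K where "K x y = profile (sqdist y x / r)" for x y
      have K0: "K x y = 0" if "\<not> norm (x - y) < d" for x y
      proof -
        have "d\<^sup>2 \<le> (norm (x - y))\<^sup>2" using that d by (intro power_mono) auto
        then have "sqdist y x / r \<ge> 2" using d by (simp add: r_def sqdist_norm le_divide_eq)
        then show ?thesis by (simp add: K_def profile_eq_0)
      qed
      have Kb: "0 \<le> K x y" "K x y \<le> 1" for x y by (simp_all add: K_def profile_bounds)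
      have Kc: "continuous_on UNIV (\<lambda>(x, y). K x y)"
        unfolding K_def sqdist_norm split_def
        by (intro continuous_on_compose2[OF profile_continuous[of UNIV]] continuous_intros) (use r in auto)
      have [measurable]: "(\<lambda>(x, y). K x y) \<in> borel_measurable (lborel \<Otimes>\<^sub>M lborel)"
        using borel_measurable_continuous_onI[OF Kc] by (simp add: lborel_prod)
      have [measurable]: "\<phi> \<in> borel_measurable borel" by (intro borel_measurable_continuous_onI c\<phi>)
      have Kc1: "continuous_on UNIV (\<lambda>x. K x y)" for y
        using test_continuous[OF scaled_profile_test[OF r, of y]] by (simp add: K_def)
      have Ksym: "K x y = K y x" for x y by (simp add: K_def sqdist_norm norm_minus_commute)
      have Kint: "integrable lborel (\<lambda>y. K x y)" for x
      proof (rule integrable_continuous_compact(1)[where M="norm x + d"])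
        show "continuous_on UNIV (\<lambda>y. K x y)" unfolding Ksym[of x] by (rule Kc1)
        show "norm y > norm x + d \<Longrightarrow> K x y = 0" for y
          using norm_triangle_sub[of y x] by (intro K0) (simp add: norm_minus_commute)
      qed
      define m where "m = (LINT z|lborel. K 0 z)"
      \<comment> \<open>The kernel depends only on the distance, so its mass does not depend on the
        centre.\<close>
      have Km: "(LINT y|lborel. K x y) = m" for x
      proof -
        have "m = (LINT z|distr lborel borel ((+) (- x)). K 0 z)" by (simp add: m_def lborel_distr_plus)
        also have "\<dots> = (LINT y|lborel. K 0 (- x + y))"
          by (intro integral_distr) (use Kint[of 0] in auto)
        also have "\<dots> = (LINT y|lborel. K x y)" by (simp add: K_def sqdist_norm norm_minus_commute algebra_simps)
        finally show ?thesis by simp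
      qed
      have m: "m > 0"
      proof -
        have "m \<noteq> 0"
        proof
          assume "m = 0"
          then have "AE z in lborel. K 0 z = 0"
            unfolding m_def using integral_nonneg_eq_0_iff_AE[OF Kint[of 0]] Kb by simp
          then have "AE z in lebesgue. K 0 z = 0" by (rule AE_completion)
          moreover define O' where "O' = {z. K 0 z \<noteq> 0}"
          ultimately have "negligible O'"
            by (auto simp: O'_def negligible_iff_null_sets AE_iff_null_sets eventually_ae_filter dest: null_sets_completion_subset)
          moreover have "open O'"
          proof -
            have c: "continuous_on UNIV (\<lambda>z. K 0 z)" unfolding Ksym[of 0] by (rule Kc1)
            then have "open ((\<lambda>z. K 0 z) -` (- {0}))" by (intro open_vimage) auto
            also have "(\<lambda>z. K 0 z) -` (- {0}) = O'" by (auto simp: O'_def)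
            finally show ?thesis .
          qed
          \<comment> \<open>A witness that the kernel is not identically 0: the squared distance
            from the origin, divided by r, is 3/2, inside the interval where \<open>profile\<close>
            is positive. A nonempty open set is not negligible.\<close>
          moreover have "vector [sqrt (3 / 2 * r), 0] \<in> O'"
          proof -
            have "sqdist (vector [sqrt (3 / 2 * r), 0]) 0 / r = 3 / 2" using r by (simp add: sqdist_def)
            then have "K 0 (vector [sqrt (3 / 2 * r), 0]) > 0"
              unfolding K_def profile_def by (simp only:) (rule pulse_pos, auto)
            then show ?thesis by (simp add: O'_def)
          qed
          ultimately show False using open_not_negligible by blast
        qed
        moreover have "m \<ge> 0" unfolding m_def using Kb by simp
        ultimately show ?thesis by simp
      qed
      define f where "f x y = g1 x * (\<phi> y * K x y)" for x y
      have \<phi>i: "integrable lborel \<phi>" using integrable_continuous_compact(1)[OF c\<phi>, of M] M by simp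
      have \<phi>K: "integrable lborel (\<lambda>y. \<phi> y * K x y)" for x
      proof (rule Bochner_Integration.integrable_bound[OF \<phi>i])
        show "(\<lambda>y. \<phi> y * K x y) \<in> borel_measurable lborel" using borel_measurable_integrable[OF Kint[of x]] by measurable
        show "AE y in lborel. norm (\<phi> y * K x y) \<le> norm (\<phi> y)"
          using Kb by (intro AE_I2) (simp add: abs_mult mult_left_le)
      qed
      have fi: "integrable (lborel \<Otimes>\<^sub>M lborel) (case_prod f)"
      proof (rule lborel_pair.Fubini_integrable)
        show "case_prod f \<in> borel_measurable (lborel \<Otimes>\<^sub>M lborel)"
          unfolding f_def[abs_def] by measurable
        show "AE x in lborel. integrable lborel (\<lambda>y. case_prod f (x, y))"
          using \<phi>K by (simp add: f_def)
        show "integrable lborel (\<lambda>x. LINT y|lborel. norm (case_prod f (x, y)))"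
        proof (rule Bochner_Integration.integrable_bound)
          show "integrable lborel (\<lambda>x. g1 x * (LINT y|lborel. \<bar>\<phi> y\<bar>))" using g1i by simp
          show "(\<lambda>x. LINT y|lborel. norm (case_prod f (x, y))) \<in> borel_measurable lborel"
            unfolding f_def[abs_def] by measurable
          have "(LINT y|lborel. \<bar>f x y\<bar>) \<le> \<bar>g1 x * (LINT y|lborel. \<bar>\<phi> y\<bar>)\<bar>" for x
          proof -
            have "(LINT y|lborel. \<bar>f x y\<bar>) \<le> (LINT y|lborel. \<bar>g1 x\<bar> * \<bar>\<phi> y\<bar>)"
            proof (rule integral_mono)
              show "integrable lborel (\<lambda>y. \<bar>f x y\<bar>)" using \<phi>K[of x] by (simp add: f_def)
              show "integrable lborel (\<lambda>y. \<bar>g1 x\<bar> * \<bar>\<phi> y\<bar>)" using \<phi>i by simp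
              show "\<bar>f x y\<bar> \<le> \<bar>g1 x\<bar> * \<bar>\<phi> y\<bar>" for y
                using Kb by (simp add: f_def abs_mult mult_left_le mult_left_mono)
            qed
            then show ?thesis by (simp add: abs_mult)
          qed
          then show "AE x in lborel. norm (LINT y|lborel. norm (case_prod f (x, y))) \<le> norm (g1 x * (LINT y|lborel. \<bar>\<phi> y\<bar>))"
            by simp
        qed
      qed
      \<comment> \<open>For fixed y the integral over x is the annular average around y, hence 0. On
        the support of the test function the cut-off in \<open>g1\<close> is invisible.\<close>
      have fx: "(LINT x|lborel. f x y) = 0" for y
      proof -
        have "f x y = \<phi> y * (K x y * g x)" for x
        proof (cases "\<phi> y = 0 \<or> K x y = 0")
          case False
          then have "norm y < M" "norm (x - y) < d" using M(2)[of y] K0[of x y] by force+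
          then have "norm x \<le> M + 1" using norm_triangle_sub[of x y] d by linarith
          then show ?thesis by (simp add: f_def g1_def)
        qed (auto simp: f_def)
        then have "(LINT x|lborel. f x y) = \<phi> y * (LINT x|lborel. K x y * g x)" by simp
        also have "(LINT x|lborel. K x y * g x) = (LINT x|lebesgue. K x y * (G x $ i))"
          by (rule transfer[OF Kc1, symmetric])
        also have "\<dots> = 0" unfolding K_def by (rule radial_average_0[OF U G ort r])
        finally show ?thesis by simp
      qed
      have fy: "(LINT y|lborel. f x y) = g1 x * (LINT y|lborel. \<phi> y * K x y)" for x by (simp add: f_def)
      have f0: "(LINT x|lborel. LINT y|lborel. f x y) = 0"
        using lborel_pair.Fubini_integral[OF fi] fx by simp
      have fyi: "integrable lborel (\<lambda>x. LINT y|lborel. f x y)"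
        using lborel_pair.integrable_fst'[OF fi] by simp
      have \<phi>g: "integrable lborel (\<lambda>x. \<phi> x * g1 x)"
      proof (rule Bochner_Integration.integrable_bound)
        show "integrable lborel (\<lambda>x. B * g1 x)" using g1i by simp
        show "AE x in lborel. norm (\<phi> x * g1 x) \<le> norm (B * g1 x)"
          using B by (intro AE_I2) (simp add: abs_mult mult_right_mono order_trans[OF _ abs_ge_self])
      qed measurable
      \<comment> \<open>Averaging the test function with \<open>K\<close> changes it by at most
        \<open>e\<close> times the mass, by uniform continuity. As the double integral vanishes by
        Fubini, only this error is left of \<open>m * I\<close>.\<close>
      have pt: "\<bar>m * (\<phi> x * g1 x) - (LINT y|lborel. f x y)\<bar> \<le> (e * m) * \<bar>g1 x\<bar>" for x
      proof -
        have "m * \<phi> x - (LINT y|lborel. \<phi> y * K x y) = (LINT y|lborel. (\<phi> x - \<phi> y) * K x y)"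
          using Kint[of x] \<phi>K[of x] by (simp add: left_diff_distrib Km)
        also have "\<bar>\<dots>\<bar> \<le> (LINT y|lborel. e * K x y)"
        proof (rule integral_abs_bound[THEN order_trans], rule integral_mono)
          show "integrable lborel (\<lambda>y. \<bar>(\<phi> x - \<phi> y) * K x y\<bar>)"
            using Kint[of x] \<phi>K[of x] by (intro integrable_abs) (simp add: left_diff_distrib)
          show "integrable lborel (\<lambda>y. e * K x y)" using Kint[of x] by simp
          show "\<bar>(\<phi> x - \<phi> y) * K x y\<bar> \<le> e * K x y" for y
          proof (cases "norm (x - y) < d")
            case True
            then show ?thesis using uc[of x y] Kb[of x y]
              by (simp add: abs_mult mult_right_mono abs_minus_commute)
          next
            case False
            then show ?thesis using K0[of x y] by simp
          qed
        qed
        also have "\<dots> = e * m" by (simp add: Km)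
        finally have "\<bar>g1 x\<bar> * \<bar>m * \<phi> x - (LINT y|lborel. \<phi> y * K x y)\<bar> \<le> \<bar>g1 x\<bar> * (e * m)"
          by (intro mult_left_mono) auto
        also have "\<bar>g1 x\<bar> * \<bar>m * \<phi> x - (LINT y|lborel. \<phi> y * K x y)\<bar> = \<bar>m * (\<phi> x * g1 x) - (LINT y|lborel. f x y)\<bar>"
          unfolding fy abs_mult[symmetric] by (simp add: algebra_simps)
        finally show ?thesis by (simp add: mult.commute)
      qed
      have "m * I = (LINT x|lborel. m * (\<phi> x * g1 x) - (LINT y|lborel. f x y))"
        using \<phi>g fyi f0 by (simp add: I_def)
      also have "\<bar>\<dots>\<bar> \<le> (LINT x|lborel. (e * m) * \<bar>g1 x\<bar>)"
      proof (rule integral_abs_bound[THEN order_trans], rule integral_mono)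
        show "integrable lborel (\<lambda>x. \<bar>m * (\<phi> x * g1 x) - (LINT y|lborel. f x y)\<bar>)"
          using \<phi>g fyi by (intro integrable_abs Bochner_Integration.integrable_diff) auto
        show "integrable lborel (\<lambda>x. (e * m) * \<bar>g1 x\<bar>)" using g1i by simp
      qed (rule pt)
      also have "\<dots> = m * (e * C)" by (simp add: C_def)
      finally have "m * \<bar>I\<bar> \<le> m * (e * C)" using m by (simp add: abs_mult)
      then show ?thesis using m by simp
    qed
    have "\<bar>I\<bar> \<le> 0"
    proof (rule field_le_epsilon)
      fix e :: real assume e: "e > 0"
      have "\<bar>I\<bar> \<le> e / (C + 1) * C" using e C by (intro est) simp
      also have "\<dots> \<le> e" using e C by (simp add: field_simps)
      finally show "\<bar>I\<bar> \<le> 0 + e" by simp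
    qed
    then have "I = 0" by simp
    moreover have "I = (LINT x|lborel. \<phi> x * g x)"
      unfolding I_def using M by (intro Bochner_Integration.integral_cong) (auto simp: g1_def indicator_def)
    ultimately have "(LINT x|lebesgue. \<phi> x * (G x $ i)) = 0" using transfer[OF c\<phi>] by simp
    then show "(LINT x|lebesgue. (a (x $ 1) * b (x $ 2)) *\<^sub>R (G x $ i)) = 0" by (simp add: \<phi>_def)
  qed
  then have "AE x in lebesgue. \<forall>i. G x $ i = 0" by (simp add: AE_all_countable)
  then show ?thesis by eventually_elim (simp add: vec_eq_iff)
qed

subsection \<open>The space of square integrable gradients\<close>

lemma grad_closure_L2: "F \<in> grad_closure \<Longrightarrow> F \<in> L2"
  by (simp add: grad_closure_def)

lemma ip_cong_AE:
  assumes "AE x in lebesgue. F x = F' x" "AE x in lebesgue. H x = H' x"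
    and "F \<in> borel_measurable lebesgue" "F' \<in> borel_measurable lebesgue"
      "H \<in> borel_measurable lebesgue" "H' \<in> borel_measurable lebesgue"
  shows "ip F H = ip F' H'"
  unfolding ip_def
proof (rule integral_cong_AE)
  show "AE x in lebesgue. F x \<bullet> H x = F' x \<bullet> H' x" using assms(1,2) by eventually_elim simp
qed (use assms in \<open>auto intro: borel_measurable_inner\<close>)

lemma L2_AE_cong:
  assumes "F \<in> L2" "AE x in lebesgue. F x = G x" "G \<in> borel_measurable lebesgue"
  shows "G \<in> L2"
proof (rule L2I[OF assms(3)])
  show "integrable lebesgue (\<lambda>x. (norm (G x))\<^sup>2)"
  proof (rule integrable_cong_AE_imp[OF L2_integrable[OF assms(1)]])
    show "(\<lambda>x. (norm (G x))\<^sup>2) \<in> borel_measurable lebesgue"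
      by (intro borel_measurable_power measurable_compose[OF assms(3) borel_measurable_norm])
    show "AE x in lebesgue. (norm (F x))\<^sup>2 = (norm (G x))\<^sup>2" using assms(2) by eventually_elim simp
  qed
qed

lemma grad_closure_AE_cong:
  assumes "F \<in> grad_closure" "AE x in lebesgue. F x = G x" "G \<in> borel_measurable lebesgue"
  shows "G \<in> grad_closure"
proof -
  have F: "F \<in> L2" and G: "G \<in> L2" using assms grad_closure_L2 L2_AE_cong by blast+
  obtain X where X: "\<And>n::nat. X n \<in> test_functions" "(\<lambda>n. nrm (\<lambda>x. grad (X n) x - F x)) \<longlonglongrightarrow> 0"
    using assms(1) by (auto simp: grad_closure_def)
  have "nrm (\<lambda>x. grad (X n) x - F x) = nrm (\<lambda>x. grad (X n) x - G x)" for n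
    unfolding nrm_def
    by (intro arg_cong[where f=sqrt] ip_cong_AE L2_measurable[OF L2_diff[OF test_grad_L2[OF X(1)] F]]
        L2_measurable[OF L2_diff[OF test_grad_L2[OF X(1)] G]]) (use assms(2) in \<open>eventually_elim, simp\<close>)+
  then show ?thesis using X G by (auto simp: grad_closure_def)
qed

lemma test_grad_closure: "\<phi> \<in> test_functions \<Longrightarrow> grad \<phi> \<in> grad_closure"
  using test_grad_L2[of \<phi>] by (auto simp: grad_closure_def nrm_def ip_def intro!: exI[of _ "\<lambda>n. \<phi>"])

lemma test_add_cmult: "\<phi> \<in> test_functions \<Longrightarrow> \<psi> \<in> test_functions \<Longrightarrow> (\<lambda>x. \<phi> x + c * \<psi> x) \<in> test_functions"
  by (intro test_add test_cmult)

lemma test_grad_add_cmult: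
  assumes "\<phi> \<in> test_functions" "\<psi> \<in> test_functions"
  shows "grad (\<lambda>x. \<phi> x + c * \<psi> x) = (\<lambda>x. grad \<phi> x + c *\<^sub>R grad \<psi> x)"
  using grad_add[OF test_differentiable[OF assms(1)] test_differentiable[OF test_cmult[OF assms(2)]]]
    grad_cmult[OF test_differentiable[OF assms(2)]] by auto

lemma grad_closure_add_cmult:
  assumes "F \<in> grad_closure" "H \<in> grad_closure"
  shows "(\<lambda>x. F x + c *\<^sub>R H x) \<in> grad_closure"
proof -
  have L: "F \<in> L2" "H \<in> L2" using assms grad_closure_L2 by auto
  obtain X where X: "\<And>n::nat. X n \<in> test_functions" "(\<lambda>n. nrm (\<lambda>x. grad (X n) x - F x)) \<longlonglongrightarrow> 0"
    using assms(1) by (auto simp: grad_closure_def)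
  obtain Y where Y: "\<And>n::nat. Y n \<in> test_functions" "(\<lambda>n. nrm (\<lambda>x. grad (Y n) x - H x)) \<longlonglongrightarrow> 0"
    using assms(2) by (auto simp: grad_closure_def)
  have "(\<lambda>n. nrm (\<lambda>x. grad (\<lambda>x. X n x + c * Y n x) x - (F x + c *\<^sub>R H x))) \<longlonglongrightarrow> 0"
  proof (rule Lim_null_comparison)
    have "nrm (\<lambda>x. grad (\<lambda>x. X n x + c * Y n x) x - (F x + c *\<^sub>R H x))
        \<le> nrm (\<lambda>x. grad (X n) x - F x) + \<bar>c\<bar> * nrm (\<lambda>x. grad (Y n) x - H x)" for n
    proof -
      have "(\<lambda>x. grad (\<lambda>x. X n x + c * Y n x) x - (F x + c *\<^sub>R H x))
         = (\<lambda>x. (grad (X n) x - F x) + c *\<^sub>R (grad (Y n) x - H x))"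
        unfolding test_grad_add_cmult[OF X(1) Y(1)] by (simp add: algebra_simps)
      then show ?thesis
        using nrm_triangle[OF L2_diff[OF test_grad_L2[OF X(1)] L(1)] L2_cmult[OF L2_diff[OF test_grad_L2[OF Y(1)] L(2)]], of n c n]
        by (simp only: nrm_cmult)
    qed
    then show "\<forall>\<^sub>F n in sequentially. norm (nrm (\<lambda>x. grad (\<lambda>x. X n x + c * Y n x) x - (F x + c *\<^sub>R H x)))
       \<le> nrm (\<lambda>x. grad (X n) x - F x) + \<bar>c\<bar> * nrm (\<lambda>x. grad (Y n) x - H x)"
      by (simp add: nrm_nonneg)
    show "(\<lambda>n. nrm (\<lambda>x. grad (X n) x - F x) + \<bar>c\<bar> * nrm (\<lambda>x. grad (Y n) x - H x)) \<longlonglongrightarrow> 0"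
      using tendsto_add[OF X(2) tendsto_mult_left[OF Y(2), of "\<bar>c\<bar>"]] by simp
  qed
  then show ?thesis unfolding grad_closure_def using L X(1) Y(1)
    by (auto intro!: L2_add L2_cmult exI[of _ "\<lambda>n x. X n x + c * Y n x"] test_add_cmult)
qed

text \<open>Diagonal choice: each \<open>F n\<close> is replaced by a test gradient within
  \<open>1 / real (Suc n)\<close>.\<close>

lemma grad_closure_closed:
  assumes F: "\<And>n::nat. F n \<in> grad_closure" and L: "L \<in> L2" and lim: "(\<lambda>n. nrm (\<lambda>x. F n x - L x)) \<longlonglongrightarrow> 0"
  shows "L \<in> grad_closure"
proof -
  have FL: "F n \<in> L2" for n using F grad_closure_L2 by blast
  have "\<exists>\<phi>\<in>test_functions. nrm (\<lambda>x. grad \<phi> x - F n x) < 1 / real (Suc n)" for n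
  proof -
    obtain X where X: "\<And>n::nat. X n \<in> test_functions" "(\<lambda>k. nrm (\<lambda>x. grad (X k) x - F n x)) \<longlonglongrightarrow> 0"
      using F[of n] by (auto simp: grad_closure_def)
    have "\<forall>\<^sub>F k in sequentially. nrm (\<lambda>x. grad (X k) x - F n x) < 1 / real (Suc n)"
      by (rule order_tendstoD(2)[OF X(2)]) simp
    then show ?thesis using X(1) by (meson eventually_happens trivial_limit_sequentially)
  qed
  then obtain Y where Y: "\<And>n. Y n \<in> test_functions" "\<And>n. nrm (\<lambda>x. grad (Y n) x - F n x) < 1 / real (Suc n)"
    by metis
  have "(\<lambda>n. nrm (\<lambda>x. grad (Y n) x - L x)) \<longlonglongrightarrow> 0"
  proof (rule Lim_null_comparison)
    have "nrm (\<lambda>x. grad (Y n) x - L x) \<le> 1 / real (Suc n) + nrm (\<lambda>x. F n x - L x)" for n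
      using nrm_triangle[OF L2_diff[OF test_grad_L2[OF Y(1)] FL] L2_diff[OF FL L], of n n n] Y(2)[of n] by simp
    then show "\<forall>\<^sub>F n in sequentially. norm (nrm (\<lambda>x. grad (Y n) x - L x)) \<le> 1 / real (Suc n) + nrm (\<lambda>x. F n x - L x)"
      by (simp add: nrm_nonneg)
    show "(\<lambda>n. 1 / real (Suc n) + nrm (\<lambda>x. F n x - L x)) \<longlonglongrightarrow> 0"
      using tendsto_add[OF LIMSEQ_inverse_real_of_nat lim] by (simp add: inverse_eq_divide)
  qed
  then show ?thesis using L Y(1) by (auto simp: grad_closure_def)
qed

lemma grad_closure_orthogonal:
  assumes H: "H \<in> L2" and ort: "\<And>\<phi>. \<phi> \<in> test_functions \<Longrightarrow> ip H (grad \<phi>) = 0" and F: "F \<in> grad_closure"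
  shows "ip H F = 0"
proof -
  obtain X where X: "\<And>n::nat. X n \<in> test_functions" "(\<lambda>n. nrm (\<lambda>x. grad (X n) x - F x)) \<longlonglongrightarrow> 0"
    using F by (auto simp: grad_closure_def)
  have "(\<lambda>n. ip (grad (X n)) H) \<longlonglongrightarrow> ip F H"
    by (intro ip_tendsto test_grad_L2 X grad_closure_L2[OF F] H)
  moreover have "ip (grad (X n)) H = 0" for n using ort[OF X(1)] by (simp only: ip_commute)
  ultimately show ?thesis by (simp add: LIMSEQ_const_iff ip_commute)
qed

text \<open>The test gradients need not form a closed space; the approximating sequence delivered by
  \<open>riesz_L2\<close> is what places the representative in the closure.\<close>

lemma riesz_grad_closure:
  assumes lin: "\<And>\<phi> \<psi> c. \<phi> \<in> test_functions \<Longrightarrow> \<psi> \<in> test_functions \<Longrightarrow> l (\<lambda>x. \<phi> x + c * \<psi> x) = l \<phi> + c * l \<psi>"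
    and bd: "\<And>\<phi>. \<phi> \<in> test_functions \<Longrightarrow> \<bar>l \<phi>\<bar> \<le> C * nrm (grad \<phi>)"
  shows "\<exists>P\<in>grad_closure. \<forall>\<phi>\<in>test_functions. ip P (grad \<phi>) = l \<phi>"
proof -
  obtain P X where P: "P \<in> L2" "\<And>n::nat. X n \<in> test_functions" "(\<lambda>n. nrm (\<lambda>x. grad (X n) x - P x)) \<longlonglongrightarrow> 0"
    "\<And>\<phi>. \<phi> \<in> test_functions \<Longrightarrow> ip P (grad \<phi>) = l \<phi>"
  proof (rule riesz_L2[where T=test_functions and D=grad and l=l and C=C])
    show "test_functions \<noteq> {}" using test_zero by blast
    show "\<exists>r\<in>test_functions. grad r = (\<lambda>x. grad s x + c *\<^sub>R grad t x) \<and> l r = l s + c * l t"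
      if "s \<in> test_functions" "t \<in> test_functions" for s t c
      using that by (intro bexI[of _ "\<lambda>x. s x + c * t x"] conjI test_grad_add_cmult lin test_add_cmult)
  qed (use bd test_grad_L2 in auto)
  then show ?thesis by (auto simp: grad_closure_def)
qed

text \<open>The orthogonal projection onto gradients, i.e. the Helmholtz decomposition, as the Riesz
  representative of the functional given by \<open>H\<close>.\<close>

lemma projection_grad_closure:
  assumes H: "H \<in> L2"
  shows "\<exists>P\<in>grad_closure. \<forall>\<phi>\<in>test_functions. ip P (grad \<phi>) = ip H (grad \<phi>)"
proof (rule riesz_grad_closure)
  show "\<bar>ip H (grad \<phi>)\<bar> \<le> nrm H * nrm (grad \<phi>)" if "\<phi> \<in> test_functions" for \<phi>
    by (rule ip_Cauchy_Schwarz[OF H test_grad_L2[OF that]])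
  show "ip H (grad (\<lambda>x. \<phi> x + c * \<psi> x)) = ip H (grad \<phi>) + c * ip H (grad \<psi>)"
    if "\<phi> \<in> test_functions" "\<psi> \<in> test_functions" for \<phi> \<psi> c
    unfolding test_grad_add_cmult[OF that]
    using that by (simp add: ip_add_right H test_grad_L2 L2_cmult ip_cmult_right)
qed

lemma has_weak_grad_diff:
  fixes U V :: "plane \<Rightarrow> 'a::euclidean_space"
  assumes "has_weak_grad U F" "has_weak_grad V H"
  shows "has_weak_grad (\<lambda>x. U x - V x) (\<lambda>x. F x - H x)"
  unfolding has_weak_grad_def
proof (intro conjI ballI allI)
  have L: "U \<in> L1_loc" "V \<in> L1_loc" "F \<in> L1_loc" "H \<in> L1_loc" using assms by (auto simp: has_weak_grad_def)
  then show "(\<lambda>x. U x - V x) \<in> L1_loc" "(\<lambda>x. F x - H x) \<in> L1_loc" by (auto intro: L1_loc_diff)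
  fix \<phi> i assume p: "\<phi> \<in> test_functions"
  show "(LINT x|lebesgue. (grad \<phi> x $ i) *\<^sub>R (U x - V x)) = - (LINT x|lebesgue. \<phi> x *\<^sub>R ((F x - H x) $ i))"
    using has_weak_gradD[OF assms(1) p, of i] has_weak_gradD[OF assms(2) p, of i]
      L1_loc_test_integrable[OF L(1) test_grad[OF p]] L1_loc_test_integrable[OF L(2) test_grad[OF p]]
      L1_loc_test_integrable[OF L1_loc_nth[OF L(3)] p] L1_loc_test_integrable[OF L1_loc_nth[OF L(4)] p]
    by (simp add: scaleR_diff_right)
qed

text \<open>The gradient minus its projection is orthogonal to all test gradients. It is also the
  gradient of a function, namely of \<open>U\<close> minus a potential of the projection, so the
  Liouville argument applies to it and it vanishes.\<close>

lemma weak_grad_in_grad_closure: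
  assumes U: "has_weak_grad (U :: plane \<Rightarrow> real) F" and F: "F \<in> L2"
  shows "F \<in> grad_closure"
proof -
  obtain P where P: "P \<in> grad_closure" "\<And>\<phi>. \<phi> \<in> test_functions \<Longrightarrow> ip P (grad \<phi>) = ip F (grad \<phi>)"
    using projection_grad_closure[OF F] by blast
  obtain V where V: "has_weak_grad V P" using grad_closure_potential[OF P(1)] by metis
  have PL: "P \<in> L2" by (rule grad_closure_L2[OF P(1)])
  have "AE x in lebesgue. F x - P x = 0"
  proof (rule weakly_harmonic_grad_0[OF has_weak_grad_diff[OF U V] L2_diff[OF F PL]])
    show "ip (\<lambda>x. F x - P x) (grad \<phi>) = 0" if "\<phi> \<in> test_functions" for \<phi>
      using P(2)[OF that] by (simp add: ip_diff_left F PL test_grad_L2 that)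
  qed
  then have "AE x in lebesgue. P x = F x" by eventually_elim simp
  from grad_closure_AE_cong[OF P(1) this L2_measurable[OF F]] show ?thesis .
qed

lemma nrm_le:
  fixes F :: "plane \<Rightarrow> 'a::euclidean_space" and H :: "plane \<Rightarrow> 'b::euclidean_space"
  assumes F: "F \<in> L2" and H: "H \<in> borel_measurable lebesgue" and le: "\<And>x. norm (H x) \<le> B * norm (F x)" and B: "B \<ge> 0"
  shows "H \<in> L2" "nrm H \<le> B * nrm F"
proof -
  have le2: "(norm (H x))\<^sup>2 \<le> B\<^sup>2 * (norm (F x))\<^sup>2" for x
    using power_mono[OF le[of x] norm_ge_zero, of 2] by (simp add: power_mult_distrib)
  have i: "integrable lebesgue (\<lambda>x. B\<^sup>2 * (norm (F x))\<^sup>2)" using L2_integrable[OF F] by simp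
  have "integrable lebesgue (\<lambda>x. (norm (H x))\<^sup>2)"
  proof (rule Bochner_Integration.integrable_bound[OF i])
    show "(\<lambda>x. (norm (H x))\<^sup>2) \<in> borel_measurable lebesgue"
      by (intro borel_measurable_power measurable_compose[OF H borel_measurable_norm])
    show "AE x in lebesgue. norm ((norm (H x))\<^sup>2) \<le> norm (B\<^sup>2 * (norm (F x))\<^sup>2)"
      using le2 by (intro AE_I2) simp
  qed
  then show "H \<in> L2" using H by (intro L2I)
  have "ip H H \<le> B\<^sup>2 * ip F F"
  proof -
    have "ip H H \<le> (LINT x|lebesgue. B\<^sup>2 * (norm (F x))\<^sup>2)"
      unfolding ip_self by (rule integral_mono[OF \<open>integrable lebesgue (\<lambda>x. (norm (H x))\<^sup>2)\<close> i le2])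
    then show ?thesis by (simp add: ip_self)
  qed
  then have "sqrt (ip H H) \<le> sqrt (B\<^sup>2 * ip F F)" by (rule real_sqrt_le_mono)
  then show "nrm H \<le> B * nrm F" using B by (simp add: nrm_def real_sqrt_mult)
qed

lemma H1_norm_test:
  assumes p: "\<phi> \<in> test_functions"
  shows "H1_norm \<phi> \<le> nrm \<phi> + nrm (grad \<phi>)"
proof -
  have m: "wgrad \<phi> \<in> borel_measurable lebesgue"
    using wgrad_weak_grad[OF test_weak_grad[OF p]] L1_loc_measurable by (auto simp: has_weak_grad_def)
  have "ip (wgrad \<phi>) (wgrad \<phi>) = ip (grad \<phi>) (grad \<phi>)"
    by (intro ip_cong_AE wgrad_AE_eq test_weak_grad p m L2_measurable test_grad_L2)
  then have "H1_norm \<phi> = sqrt ((nrm \<phi>)\<^sup>2 + (nrm (grad \<phi>))\<^sup>2)"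
    by (simp add: H1_norm_def nrm_power2 ip_self)
  also have "\<dots> \<le> nrm \<phi> + nrm (grad \<phi>)"
    by (rule sqrt_sum_squares_le_sum) (simp_all add: nrm_nonneg)
  finally show ?thesis .
qed

section \<open>The source as a bounded functional of the gradient\<close>

lemma cutoff_exists:
  assumes "compactly_supported f"
  shows "\<exists>\<theta>. cutoff_for f \<theta>"
proof -
  obtain K where K: "compact K" "supported_in f K" using assms by (auto simp: compactly_supported_def)
  obtain \<rho> where \<rho>: "\<rho> > 0" "\<And>x. x \<in> K \<Longrightarrow> norm x < \<rho>"
    using bounded_pos_less[of K] compact_imp_bounded[OF K(1)] by auto
  obtain k where k: "smooth_real k" "\<And>t. t \<le> 1 \<Longrightarrow> k t = 0" "\<And>t. t \<ge> 2 \<Longrightarrow> k t = k 2" "k 2 > 0"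
    using profile_antiderivative by metis
  \<comment> \<open>The smooth step turned upside down and scaled: as a function of the squared
    distance it is 1 up to \<rho>^2 and 0 from 2 \<rho>^2 on.\<close>
  define g where "g t = 1 + (- 1 / k 2) * k ((1 / \<rho>\<^sup>2) * t + 0)" for t
  have g: "smooth_real g"
    unfolding g_def[abs_def] by (intro smooth_real_add smooth_real_mult smooth_real_const smooth_real_compose_affine k)
  have g0: "g t = 0" if "t \<ge> 2 * \<rho>\<^sup>2" for t
  proof -
    have "t / \<rho>\<^sup>2 \<ge> 2" using that \<rho> by (simp add: le_divide_eq)
    then show ?thesis using k(3)[of "t / \<rho>\<^sup>2"] k(4) by (simp add: g_def)
  qed
  have g1: "g t = 1" if "t \<le> \<rho>\<^sup>2" for t
  proof -
    have "t / \<rho>\<^sup>2 \<le> 1" using that \<rho> by (simp add: divide_le_eq)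
    then show ?thesis using k(2)[of "t / \<rho>\<^sup>2"] by (simp add: g_def)
  qed
  have "(\<lambda>x. 1 * g (sqdist 0 x)) \<in> test_functions" by (rule radial_test[OF g g0 Ck_const])
  then have t: "(\<lambda>x. g (sqdist 0 x)) \<in> test_functions" by simp
  have "g (sqdist 0 x) = 1" if "x \<in> ball 0 \<rho>" for x
    using that by (intro g1) (auto simp: sqdist_norm intro!: power_mono)
  then have "cutoff_for f (\<lambda>x. g (sqdist 0 x))"
    unfolding cutoff_for_def using t K \<rho> by (intro conjI exI[of _ K] exI[of _ "ball 0 \<rho>"]) auto
  then show ?thesis by blast
qed

text \<open>Inserting the cutoff does not change the value of \<open>f\<close>, and subtracting a
  multiple of the cutoff does not either, since \<open>f\<close> vanishes on it. The value at \<phi>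
  is therefore the value at the cutoff times \<phi> minus its mean, whose H1 norm is bounded by the
  gradient norm: on the bounded region where the cutoff lives, the weighted Poincare inequality
  controls the function without weight.\<close>

lemma source_test_bound:
  assumes f: "f \<in> H_minus1" and c: "compactly_supported f" and avg: "pairing f (\<lambda>_. 1) = 0"
  obtains C where "\<And>\<phi>. \<phi> \<in> test_functions \<Longrightarrow> \<bar>f \<phi>\<bar> \<le> C * nrm (grad \<phi>)"
proof -
  \<comment> \<open>The very cutoff chosen in \<open>pairing\<close>, so that the vanishing average
    reads \<open>f \<theta> = 0\<close>.\<close>
  define \<theta> where "\<theta> = (SOME \<theta>. cutoff_for f \<theta>)"
  have "cutoff_for f \<theta>" unfolding \<theta>_def using cutoff_exists[OF c] by (rule someI_ex)
  then obtain K W where \<theta>: "\<theta> \<in> test_functions" and KW: "supported_in f K" "open W" "K \<subseteq> W" "\<And>x. x \<in> W \<Longrightarrow> \<theta> x = 1"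
    unfolding cutoff_for_def by blast
  have f\<theta>: "f \<theta> = 0" using avg by (simp add: pairing_def \<theta>_def[symmetric])
  have add: "f (\<lambda>x. u x + v x) = f u + f v" if "u \<in> H1" "v \<in> H1" for u v
    using f that unfolding H_minus1_def by blast
  have scale: "f (\<lambda>x. c * u x) = c * f u" if "u \<in> H1" for c u
    using f that unfolding H_minus1_def by blast
  obtain C0 where C0: "\<And>u. u \<in> H1 \<Longrightarrow> \<bar>f u\<bar> \<le> C0 * H1_norm u" using f unfolding H_minus1_def by blast
  obtain C1 where C1: "C1 \<ge> 0" "\<And>\<phi>. \<phi> \<in> test_functions \<Longrightarrow> (\<lambda>x. weight x * (\<phi> x - mean \<phi>)) \<in> L2 \<and>
    nrm (\<lambda>x. weight x * (\<phi> x - mean \<phi>)) \<le> C1 * nrm (grad \<phi>)"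
    by (rule poincare) (rule that)
  obtain M B where M: "M > 0" "\<And>x. norm x \<ge> M \<Longrightarrow> \<theta> x = 0 \<and> grad \<theta> x = 0"
    and B: "B > 0" "\<And>x. \<bar>\<theta> x\<bar> \<le> B" "\<And>x. norm (grad \<theta> x) \<le> B"
    using test_bounded[OF \<theta>] by metis
  have "bounded ((\<lambda>x. 1 / weight x) ` cball 0 M)"
    by (intro compact_imp_bounded compact_continuous_image continuous_intros weight_continuous)
      (use weight_pos in \<open>auto simp: less_le\<close>)
  then obtain D where D: "D > 0" "\<And>x. x \<in> cball 0 M \<Longrightarrow> \<bar>1 / weight x\<bar> \<le> D"
    unfolding bounded_pos by auto
  have w: "1 \<le> D * weight x" if "norm x < M" for x
    using D(2)[of x] that weight_pos[of x] by (auto simp: divide_le_eq)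
  have "\<bar>f \<phi>\<bar> \<le> \<bar>C0\<bar> * (B * D * C1 + (B + B * D * C1)) * nrm (grad \<phi>)" if p: "\<phi> \<in> test_functions" for \<phi>
  proof -
    let ?c = "mean \<phi>"
    let ?W = "\<lambda>x. weight x * (\<phi> x - ?c)"
    define \<psi> where "\<psi> x = \<theta> x * \<phi> x + (- ?c) * \<theta> x" for x
    have \<theta>\<phi>: "(\<lambda>x. \<theta> x * \<phi> x) \<in> test_functions" by (rule test_mult[OF \<theta> test_Ck[OF p]])
    have rest: "(\<lambda>x. \<phi> x - \<theta> x * \<phi> x) \<in> test_functions" by (rule test_diff[OF p \<theta>\<phi>])
    have \<psi>: "\<psi> \<in> test_functions" unfolding \<psi>_def by (intro test_add test_cmult \<theta> \<theta>\<phi>)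
    have "supp (\<lambda>x. \<phi> x - \<theta> x * \<phi> x) \<subseteq> - W"
      unfolding supp_def by (rule closure_minimal) (use KW(2,4) in auto)
    then have "f (\<lambda>x. \<phi> x - \<theta> x * \<phi> x) = 0" using KW(1,3) rest unfolding supported_in_def by blast
    moreover have "f \<phi> = f (\<lambda>x. (\<phi> x - \<theta> x * \<phi> x) + \<theta> x * \<phi> x)" by simp
    ultimately have "f \<phi> = f (\<lambda>x. \<theta> x * \<phi> x)" using add[OF test_H1[OF rest] test_H1[OF \<theta>\<phi>]] by simp
    also have "\<dots> = f \<psi>"
      unfolding \<psi>_def using add[OF test_H1[OF \<theta>\<phi>] test_H1[OF test_cmult[OF \<theta>, of "- ?c"]]]
        scale[OF test_H1[OF \<theta>], of "- ?c"] f\<theta> by (simp only: mult_zero_right add_0_right)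
    finally have "\<bar>f \<phi>\<bar> \<le> C0 * H1_norm \<psi>" using C0[OF test_H1[OF \<psi>]] by simp
    also have "\<dots> \<le> \<bar>C0\<bar> * H1_norm \<psi>"
      by (intro mult_right_mono) (auto simp: H1_norm_def)
    also have "\<dots> \<le> \<bar>C0\<bar> * (nrm \<psi> + nrm (grad \<psi>))"
      by (intro mult_left_mono H1_norm_test \<psi>) auto
    also have "\<dots> \<le> \<bar>C0\<bar> * (B * D * C1 * nrm (grad \<phi>) + (B * nrm (grad \<phi>) + B * D * C1 * nrm (grad \<phi>)))"
    proof (intro mult_left_mono add_mono abs_ge_zero)
      have WL: "?W \<in> L2" and Wn: "nrm ?W \<le> C1 * nrm (grad \<phi>)" using C1(2)[OF p] by auto
      have BD: "0 \<le> B * D" using B D by simp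
      have BW: "B * D * nrm ?W \<le> B * D * C1 * nrm (grad \<phi>)"
        using mult_left_mono[OF Wn BD] by (simp only: mult.assoc)
      \<comment> \<open>On the disc the weight is at least 1/D, so a bounded factor can be traded
        for the weight. Both terms of \<open>grad \<psi>\<close> and \<open>\<psi>\<close> itself
        need only this and the bound \<open>B\<close>.\<close>
      have bw: "z * \<bar>\<phi> x - ?c\<bar> \<le> B * D * norm (?W x)" if "0 \<le> z" "z \<le> B" "norm x < M" for z x
      proof -
        have "z * \<bar>\<phi> x - ?c\<bar> \<le> B * (1 * \<bar>\<phi> x - ?c\<bar>)" using that by (simp add: mult_right_mono)
        also have "\<dots> \<le> B * ((D * weight x) * \<bar>\<phi> x - ?c\<bar>)"
          using w[OF that(3)] B by (intro mult_left_mono mult_right_mono) auto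
        also have "\<dots> = B * D * norm (?W x)" using weight_pos[of x] by (simp add: abs_mult mult.assoc)
        finally show ?thesis .
      qed
      have "nrm \<psi> \<le> B * D * nrm ?W"
      proof (rule nrm_le(2)[OF WL L2_measurable[OF test_L2[OF \<psi>]] _ BD])
        fix x
        have e: "\<psi> x = \<theta> x * (\<phi> x - ?c)" by (simp add: \<psi>_def algebra_simps)
        show "norm (\<psi> x) \<le> B * D * norm (?W x)"
        proof (cases "norm x < M")
          case True
          then show ?thesis using bw[of "\<bar>\<theta> x\<bar>" x] B by (simp add: e abs_mult)
        next
          case False
          then show ?thesis using M(2)[of x] BD by (simp add: e)
        qed
      qed
      then show "nrm \<psi> \<le> B * D * C1 * nrm (grad \<phi>)" using BW by linarith
      have gp: "grad \<psi> x = \<theta> x *\<^sub>R grad \<phi> x + (\<phi> x - ?c) *\<^sub>R grad \<theta> x" for x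
        unfolding \<psi>_def
        unfolding grad_add[OF test_differentiable[OF \<theta>\<phi>] test_differentiable[OF test_cmult[OF \<theta>]]]
          grad_mult[OF test_differentiable[OF \<theta>] test_differentiable[OF p]] grad_cmult[OF test_differentiable[OF \<theta>]]
        by (simp add: algebra_simps)
      have c1: "continuous_on UNIV (\<lambda>x. \<theta> x *\<^sub>R grad \<phi> x)"
        by (intro continuous_intros test_continuous test_grad_continuous \<theta> p)
      have c2: "continuous_on UNIV (\<lambda>x. (\<phi> x - ?c) *\<^sub>R grad \<theta> x)"
        by (intro continuous_intros test_continuous test_grad_continuous \<theta> p)
      note n1 = nrm_le[OF test_grad_L2[OF p] continuous_measurable_lebesgue[OF c1], of B]
      note n2 = nrm_le[OF WL continuous_measurable_lebesgue[OF c2], of "B * D"]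
      have le1: "norm (\<theta> x *\<^sub>R grad \<phi> x) \<le> B * norm (grad \<phi> x)" for x
        using B by (simp add: mult_right_mono)
      have le2: "norm ((\<phi> x - ?c) *\<^sub>R grad \<theta> x) \<le> B * D * norm (?W x)" for x
      proof (cases "norm x < M")
        case True
        then show ?thesis using bw[of "norm (grad \<theta> x)" x] B by (simp add: mult.commute)
      next
        case False
        then show ?thesis using M(2)[of x] BD by simp
      qed
      have "nrm (grad \<psi>) \<le> nrm (\<lambda>x. \<theta> x *\<^sub>R grad \<phi> x) + nrm (\<lambda>x. (\<phi> x - ?c) *\<^sub>R grad \<theta> x)"
        using nrm_triangle[OF n1(1)[OF le1] n2(1)[OF le2]] B BD by (simp add: gp[abs_def])
      also have "\<dots> \<le> B * nrm (grad \<phi>) + B * D * nrm ?W"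
        using n1(2)[OF le1] n2(2)[OF le2] B BD by (intro add_mono) auto
      finally show "nrm (grad \<psi>) \<le> B * nrm (grad \<phi>) + B * D * C1 * nrm (grad \<phi>)" using BW by linarith
    qed
    also have "\<dots> = \<bar>C0\<bar> * (B * D * C1 + (B + B * D * C1)) * nrm (grad \<phi>)" by (simp add: algebra_simps)
    finally show ?thesis .
  qed
  then show ?thesis by (rule that)
qed

subsection \<open>The optimality system\<close>

lemma L2_bounded_linear:
  fixes F :: "plane \<Rightarrow> 'a::euclidean_space" and T :: "'a \<Rightarrow> 'b::euclidean_space"
  assumes T: "bounded_linear T" and F: "F \<in> L2"
  shows "(\<lambda>x. T (F x)) \<in> L2"
proof -
  obtain B where B: "B \<ge> 0" "\<And>x. norm (T x) \<le> norm x * B" using bounded_linear.nonneg_bounded[OF T] by blast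
  show ?thesis
  proof (rule nrm_le(1)[OF F])
    show "(\<lambda>x. T (F x)) \<in> borel_measurable lebesgue"
      by (rule L1_loc_measurable[OF L1_loc_bounded_linear[OF T L2_imp_L1_loc[OF F]]])
    show "norm (T (F x)) \<le> B * norm (F x)" for x using B(2)[of "F x"] by (simp add: mult.commute)
  qed (rule B(1))
qed

lemma L2_mult_bounded:
  assumes "A \<in> borel_measurable lebesgue" "\<And>x. \<bar>A x\<bar> \<le> 1" "F \<in> L2"
  shows "(\<lambda>x. A x *\<^sub>R F x) \<in> L2"
proof (rule nrm_le(1)[OF assms(3), of _ 1])
  show "(\<lambda>x. A x *\<^sub>R F x) \<in> borel_measurable lebesgue"
    using assms(1) L2_measurable[OF assms(3)] by (intro borel_measurable_scaleR)
  show "norm (A x *\<^sub>R F x) \<le> 1 * norm (F x)" for x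
    using assms(2)[of x] by (simp add: mult_left_le_one_le)
qed simp

lemma ip_mult_swap: "ip (\<lambda>x. A x *\<^sub>R F x) H = ip F (\<lambda>x. A x *\<^sub>R H x)"
  by (simp add: ip_def)

lemma L2_Pair:
  assumes "F \<in> L2" "H \<in> L2" shows "(\<lambda>x. (F x, H x)) \<in> L2"
proof (rule L2I)
  show "(\<lambda>x. (F x, H x)) \<in> borel_measurable lebesgue"
    using assms[THEN L2_measurable] by (rule borel_measurable_Pair)
  show "integrable lebesgue (\<lambda>x. (norm (F x, H x))\<^sup>2)"
    using assms[THEN L2_integrable] by (simp add: norm_Pair)
qed

lemma ip_Pair:
  assumes "F \<in> L2" "H \<in> L2" "F' \<in> L2" "H' \<in> L2"
  shows "ip (\<lambda>x. (F x, H x)) (\<lambda>x. (F' x, H' x)) = ip F F' + ip H H'"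
  using assms by (simp add: ip_def integrable_inner_L2)

text \<open>The Hilbert space problem behind the minimisation: with \<open>F0\<close> the gradient of the solution of
  \<open>-\<Delta> w = f\<close>, the pair \<open>(F, H - F0)\<close> is the Riesz representative of \<open>(F', H') \<mapsto> -\<langle>F0, H'\<rangle>/\<eta>\<close> on the closed space
  of gradient pairs with \<open>div (A F' - H') = 0\<close>.\<close>

lemma optimality_system_solvable:
  fixes A :: "plane \<Rightarrow> real"
  assumes A: "A \<in> borel_measurable lebesgue" "\<And>x. \<bar>A x\<bar> \<le> 1" and \<eta>: "\<eta> > 0"
    and lin: "\<And>\<phi> \<psi> c. \<phi> \<in> test_functions \<Longrightarrow> \<psi> \<in> test_functions \<Longrightarrow> f (\<lambda>x. \<phi> x + c * \<psi> x) = f \<phi> + c * f \<psi>"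
    and bd: "\<And>\<phi>. \<phi> \<in> test_functions \<Longrightarrow> \<bar>f \<phi>\<bar> \<le> C * nrm (grad \<phi>)"
  obtains F H where "F \<in> grad_closure" "H \<in> grad_closure"
    "\<And>\<phi>. \<phi> \<in> test_functions \<Longrightarrow> ip (\<lambda>x. A x *\<^sub>R F x) (grad \<phi>) - ip H (grad \<phi>) = - f \<phi>"
    "\<And>\<phi>. \<phi> \<in> test_functions \<Longrightarrow> \<eta> * ip F (grad \<phi>) + 1 / \<eta> * ip (\<lambda>x. A x *\<^sub>R H x) (grad \<phi>) = 0"
proof -
  obtain F0 where F0: "F0 \<in> grad_closure" "\<And>\<phi>. \<phi> \<in> test_functions \<Longrightarrow> ip F0 (grad \<phi>) = f \<phi>"
    using riesz_grad_closure[OF lin bd] by blast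
  have F0L: "F0 \<in> L2" by (rule grad_closure_L2[OF F0(1)])
  note AL = L2_mult_bounded[OF A]
  define T where "T = {(F, H). F \<in> grad_closure \<and> H \<in> grad_closure \<and>
    (\<forall>\<phi>\<in>test_functions. ip (\<lambda>x. A x *\<^sub>R F x) (grad \<phi>) = ip H (grad \<phi>))}"
  \<comment> \<open>The square roots of \<eta> make the L2 norm of \<open>D t\<close> the energy
    norm: its square is \<eta> times the square of the first gradient plus 1/\<eta> times that of
    the second.\<close>
  define D where "D t x = (sqrt \<eta> *\<^sub>R fst t x, (1 / sqrt \<eta>) *\<^sub>R snd t x)"
    for t :: "(plane \<Rightarrow> plane) \<times> (plane \<Rightarrow> plane)" and x :: plane
  define l where "l t = - (1 / \<eta>) * ip F0 (snd t)" for t :: "(plane \<Rightarrow> plane) \<times> (plane \<Rightarrow> plane)"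
  have T: "fst t \<in> L2" "snd t \<in> L2" if "t \<in> T" for t
    using that grad_closure_L2 by (auto simp: T_def)
  have DL: "D t \<in> L2" if "t \<in> T" for t
    unfolding D_def[abs_def] using T[OF that] by (intro L2_Pair L2_cmult)
  have s\<eta>: "sqrt \<eta> > 0" "sqrt \<eta> * sqrt \<eta> = \<eta>" using \<eta> by auto
  have lin_T: "\<exists>r\<in>T. D r = (\<lambda>x. D s x + c *\<^sub>R D t x) \<and> l r = l s + c * l t" if st: "s \<in> T" "t \<in> T" for s t c
  proof -
    let ?r = "(\<lambda>x. fst s x + c *\<^sub>R fst t x, \<lambda>x. snd s x + c *\<^sub>R snd t x)"
    have "?r \<in> T"
    proof -
      have "ip (\<lambda>x. A x *\<^sub>R (fst s x + c *\<^sub>R fst t x)) (grad \<phi>) = ip (\<lambda>x. snd s x + c *\<^sub>R snd t x) (grad \<phi>)"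
        if p: "\<phi> \<in> test_functions" for \<phi>
        unfolding ip_mult_swap
        using st p T[OF st(1)] T[OF st(2)] test_grad_L2[OF p] AL[OF test_grad_L2[OF p]]
        by (auto simp: ip_add_left L2_cmult ip_cmult_left T_def ip_mult_swap)
      then show ?thesis using st grad_closure_add_cmult by (auto simp: T_def)
    qed
    moreover have "D ?r = (\<lambda>x. D s x + c *\<^sub>R D t x)"
      by (auto simp: D_def algebra_simps)
    moreover have "l ?r = l s + c * l t"
      using T[OF st(1)] T[OF st(2)] by (simp add: l_def ip_add_right F0L L2_cmult ip_cmult_right algebra_simps)
    ultimately show ?thesis by blast
  qed
  have bd_T: "\<bar>l t\<bar> \<le> (1 / \<eta> * nrm F0 * sqrt \<eta>) * nrm (D t)" if t: "t \<in> T" for t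
  proof -
    have "\<bar>l t\<bar> = 1 / \<eta> * \<bar>ip F0 (snd t)\<bar>" using \<eta> by (simp add: l_def abs_mult)
    also have "\<dots> \<le> 1 / \<eta> * (nrm F0 * nrm (snd t))"
      using \<eta> by (intro mult_left_mono ip_Cauchy_Schwarz F0L T[OF t]) auto
    also have "nrm (snd t) \<le> sqrt \<eta> * nrm (D t)"
    proof (rule nrm_le(2)[OF DL[OF t] L2_measurable[OF T(2)[OF t]]])
      fix x
      have "norm (snd (D t x)) \<le> norm (D t x)" by (metis norm_snd_le prod.collapse)
      then show "norm (snd t x) \<le> sqrt \<eta> * norm (D t x)"
        using s\<eta>(1) by (simp add: D_def divide_le_eq mult.commute)
    qed (use \<eta> in simp)
    finally show ?thesis using \<eta> by (simp add: mult_left_mono nrm_nonneg mult.assoc divide_right_mono)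
  qed
  have Tne: "T \<noteq> {}"
  proof -
    have "grad (\<lambda>x. 0) = (\<lambda>x. 0 :: plane)"
      using test_grad_diff[OF test_zero test_zero] by simp
    then have "(\<lambda>x. 0 :: plane) \<in> grad_closure" using test_grad_closure[OF test_zero] by simp
    then have "(\<lambda>x. 0, \<lambda>x. 0) \<in> T" by (simp add: T_def)
    then show ?thesis by blast
  qed
  obtain L X where L: "L \<in> L2" and X: "\<And>n::nat. X n \<in> T" and lim: "(\<lambda>n. nrm (\<lambda>x. D (X n) x - L x)) \<longlonglongrightarrow> 0"
    and repr: "\<And>t. t \<in> T \<Longrightarrow> ip L (D t) = l t"
    by (rule riesz_L2[OF Tne DL lin_T bd_T]) (assumption | rule that)+
  define F1 where "F1 x = (1 / sqrt \<eta>) *\<^sub>R fst (L x)" for x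
  define H1 where "H1 x = sqrt \<eta> *\<^sub>R snd (L x)" for x
  have F1L: "F1 \<in> L2" unfolding F1_def[abs_def] by (intro L2_cmult L2_bounded_linear[OF bounded_linear_fst L])
  have H1L: "H1 \<in> L2" unfolding H1_def[abs_def] by (intro L2_cmult L2_bounded_linear[OF bounded_linear_snd L])
  have LD: "L = (\<lambda>x. (sqrt \<eta> *\<^sub>R F1 x, (1 / sqrt \<eta>) *\<^sub>R H1 x))"
    using s\<eta>(1) by (auto simp: F1_def H1_def)
  \<comment> \<open>Convergence in the energy norm splits into convergence of each component, which
    carries membership in the closure and the linear constraint over to the limit.\<close>
  have limF: "(\<lambda>n. nrm (\<lambda>x. fst (X n) x - F1 x)) \<longlonglongrightarrow> 0"
  proof (rule Lim_null_comparison)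
    have "nrm (\<lambda>x. fst (X n) x - F1 x) \<le> 1 / sqrt \<eta> * nrm (\<lambda>x. D (X n) x - L x)" for n
    proof (rule nrm_le(2)[OF L2_diff[OF DL[OF X] L] L2_measurable[OF L2_diff[OF T(1)[OF X] F1L]]])
      fix x
      have "norm (fst (D (X n) x - L x)) \<le> norm (D (X n) x - L x)" by (metis norm_fst_le prod.collapse)
      moreover have "fst (D (X n) x - L x) = sqrt \<eta> *\<^sub>R (fst (X n) x - F1 x)"
        by (simp add: LD D_def algebra_simps)
      ultimately show "norm (fst (X n) x - F1 x) \<le> 1 / sqrt \<eta> * norm (D (X n) x - L x)"
        using s\<eta>(1) by (simp add: le_divide_eq mult.commute)
    qed (use \<eta> in simp)
    then show "\<forall>\<^sub>F n in sequentially. norm (nrm (\<lambda>x. fst (X n) x - F1 x)) \<le> 1 / sqrt \<eta> * nrm (\<lambda>x. D (X n) x - L x)"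
      by (simp add: nrm_nonneg)
    show "(\<lambda>n. 1 / sqrt \<eta> * nrm (\<lambda>x. D (X n) x - L x)) \<longlonglongrightarrow> 0"
      using tendsto_mult_left[OF lim, of "1 / sqrt \<eta>"] by simp
  qed
  have limH: "(\<lambda>n. nrm (\<lambda>x. snd (X n) x - H1 x)) \<longlonglongrightarrow> 0"
  proof (rule Lim_null_comparison)
    have "nrm (\<lambda>x. snd (X n) x - H1 x) \<le> sqrt \<eta> * nrm (\<lambda>x. D (X n) x - L x)" for n
    proof (rule nrm_le(2)[OF L2_diff[OF DL[OF X] L] L2_measurable[OF L2_diff[OF T(2)[OF X] H1L]]])
      fix x
      have "norm (snd (D (X n) x - L x)) \<le> norm (D (X n) x - L x)" by (metis norm_snd_le prod.collapse)
      moreover have "snd (D (X n) x - L x) = (1 / sqrt \<eta>) *\<^sub>R (snd (X n) x - H1 x)"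
        by (simp add: LD D_def algebra_simps)
      ultimately show "norm (snd (X n) x - H1 x) \<le> sqrt \<eta> * norm (D (X n) x - L x)"
        using s\<eta>(1) by (simp add: divide_le_eq mult.commute)
    qed (use \<eta> in simp)
    then show "\<forall>\<^sub>F n in sequentially. norm (nrm (\<lambda>x. snd (X n) x - H1 x)) \<le> sqrt \<eta> * nrm (\<lambda>x. D (X n) x - L x)"
      by (simp add: nrm_nonneg)
    show "(\<lambda>n. sqrt \<eta> * nrm (\<lambda>x. D (X n) x - L x)) \<longlonglongrightarrow> 0"
      using tendsto_mult_left[OF lim, of "sqrt \<eta>"] by simp
  qed
  have F1G: "F1 \<in> grad_closure"
    by (rule grad_closure_closed[OF _ F1L limF]) (use X in \<open>auto simp: T_def split_beta\<close>)
  have H1G: "H1 \<in> grad_closure"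
    by (rule grad_closure_closed[OF _ H1L limH]) (use X in \<open>auto simp: T_def split_beta\<close>)
  have constraint: "ip (\<lambda>x. A x *\<^sub>R F1 x) (grad \<phi>) = ip H1 (grad \<phi>)" if p: "\<phi> \<in> test_functions" for \<phi>
  proof -
    have gL: "grad \<phi> \<in> L2" by (rule test_grad_L2[OF p])
    have "(\<lambda>n. ip (fst (X n)) (\<lambda>x. A x *\<^sub>R grad \<phi> x)) \<longlonglongrightarrow> ip F1 (\<lambda>x. A x *\<^sub>R grad \<phi> x)"
      by (rule ip_tendsto[OF T(1)[OF X] F1L AL[OF gL] limF])
    moreover have "(\<lambda>n. ip (snd (X n)) (grad \<phi>)) \<longlonglongrightarrow> ip H1 (grad \<phi>)"
      by (rule ip_tendsto[OF T(2)[OF X] H1L gL limH])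
    moreover have "ip (fst (X n)) (\<lambda>x. A x *\<^sub>R grad \<phi> x) = ip (snd (X n)) (grad \<phi>)" for n
      using X[of n] p unfolding ip_mult_swap[symmetric] by (auto simp: T_def split_beta)
    ultimately show ?thesis unfolding ip_mult_swap by (simp add: LIMSEQ_unique)
  qed
  \<comment> \<open>Adding back \<open>F0\<close> turns the homogeneous constraint into the one with
    source \<open>f\<close>. The functional \<open>l\<close> was chosen so that the Euler equation
    takes its natural form for this \<open>H\<close>.\<close>
  define H where "H x = H1 x + 1 *\<^sub>R F0 x" for x
  have HG: "H \<in> grad_closure" unfolding H_def[abs_def] by (rule grad_closure_add_cmult[OF H1G F0(1)])
  have HL: "H \<in> L2" by (rule grad_closure_L2[OF HG])
  have euler: "\<eta> * ip F1 (fst t) + 1 / \<eta> * ip H (snd t) = 0" if t: "t \<in> T" for t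
  proof -
    have "ip L (D t) = \<eta> * ip F1 (fst t) + 1 / \<eta> * ip H1 (snd t)"
      unfolding LD D_def[abs_def] using T[OF t] F1L H1L s\<eta>
      by (subst ip_Pair) (auto intro: L2_cmult simp: ip_cmult_left ip_cmult_right mult.assoc[symmetric])
    moreover have "ip H (snd t) = ip H1 (snd t) + ip F0 (snd t)"
      unfolding H_def using T[OF t] H1L F0L by (simp add: ip_add_left)
    ultimately show ?thesis using repr[OF t] \<eta> by (simp add: l_def field_simps)
  qed
  show thesis
  proof (rule that[OF F1G HG])
    fix \<phi> assume p: "\<phi> \<in> test_functions"
    have gL: "grad \<phi> \<in> L2" by (rule test_grad_L2[OF p])
    have "ip H (grad \<phi>) = ip H1 (grad \<phi>) + f \<phi>"
      unfolding H_def using gL H1L F0L F0(2)[OF p] by (simp add: ip_add_left)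
    then show "ip (\<lambda>x. A x *\<^sub>R F1 x) (grad \<phi>) - ip H (grad \<phi>) = - f \<phi>" using constraint[OF p] by simp
    \<comment> \<open>Variations in \<open>T\<close> are tied together by the constraint. For a free
      first component \<open>grad \<phi>\<close> the second is the projection of \<open>A\<close>
      times \<open>grad \<phi>\<close>, and the pair is admissible as a variation. As
      \<open>H\<close> lies in the closure, it does not see the difference between \<open>P\<close>
      and the unprojected field, so \<open>P\<close> can be eliminated.\<close>
    obtain P where P: "P \<in> grad_closure" "\<And>\<psi>. \<psi> \<in> test_functions \<Longrightarrow> ip P (grad \<psi>) = ip (\<lambda>x. A x *\<^sub>R grad \<phi> x) (grad \<psi>)"
      using projection_grad_closure[OF AL[OF gL]] by blast
    have PL: "P \<in> L2" by (rule grad_closure_L2[OF P(1)])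
    have "(grad \<phi>, P) \<in> T" using P test_grad_closure[OF p] by (simp add: T_def)
    then have "\<eta> * ip F1 (grad \<phi>) + 1 / \<eta> * ip H P = 0" using euler by fastforce
    moreover have "ip (\<lambda>x. P x - A x *\<^sub>R grad \<phi> x) H = 0"
      by (rule grad_closure_orthogonal[OF L2_diff[OF PL AL[OF gL]] _ HG])
        (simp add: ip_diff_left PL AL gL test_grad_L2 P(2))
    then have "ip P H = ip (\<lambda>x. A x *\<^sub>R grad \<phi> x) H"
      using ip_diff_left[OF PL AL[OF gL] HL] by simp
    then have "ip H P = ip (\<lambda>x. A x *\<^sub>R H x) (grad \<phi>)"
      using trans[OF ip_mult_swap ip_commute] ip_commute[of H P] by metis
    ultimately show "\<eta> * ip F1 (grad \<phi>) + 1 / \<eta> * ip (\<lambda>x. A x *\<^sub>R H x) (grad \<phi>) = 0" by simp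
  qed
qed

lemma weak_div_eq_ip: "weak_div F \<phi> = - ip F (grad \<phi>)" for F :: "plane \<Rightarrow> plane"
  by (simp add: weak_div_def ip_def inner_vec_def mult.commute)

lemma wgrad_measurable: "has_weak_grad U G \<Longrightarrow> wgrad U \<in> borel_measurable lebesgue"
  using wgrad_weak_grad L1_loc_measurable unfolding has_weak_grad_def by blast

lemma H1_dot_wgrad:
  assumes "U \<in> H1_dot"
  shows "has_weak_grad U (wgrad U)" "wgrad U \<in> L2"
proof -
  obtain G where G: "G \<in> L2" "has_weak_grad U G" using assms by (auto simp: H1_dot_def)
  show "has_weak_grad U (wgrad U)" by (rule wgrad_weak_grad[OF G(2)])
  have "AE x in lebesgue. G x = wgrad U x" using wgrad_AE_eq[OF G(2)] by eventually_elim simp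
  then show "wgrad U \<in> L2" by (rule L2_AE_cong[OF G(1) _ wgrad_measurable[OF G(2)]])
qed

lemma H1_dot_wgrad_closure: "U \<in> H1_dot \<Longrightarrow> wgrad U \<in> grad_closure" for U :: "plane \<Rightarrow> real"
  using weak_grad_in_grad_closure H1_dot_wgrad by blast

lemma eq_up_to_constI:
  fixes U V :: "plane \<Rightarrow> 'a::euclidean_space"
  assumes U: "has_weak_grad U G" and V: "has_weak_grad V H" and eq: "AE x in lebesgue. G x = H x"
  shows "eq_up_to_const U V"
proof -
  have "AE x in lebesgue. G x - H x = 0" using eq by eventually_elim simp
  from weak_grad_0_imp_const[OF has_weak_grad_diff[OF U V] this]
  obtain c where "AE x in lebesgue. U x - V x = c" by blast
  then have "AE x in lebesgue. U x = V x + c" by eventually_elim (simp add: algebra_simps)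
  then show ?thesis by (auto simp: eq_up_to_const_def)
qed

text \<open>Testing the first equation with \<open>K\<close> and the second with \<open>F\<close>
  produces the same term in \<open>A\<close>, multiplication by a real function being symmetric.
  Eliminating it leaves \<eta> times the sum of both squared norms equal to 0, whatever the sign of
  \<open>A\<close>.\<close>

lemma optimality_system_unique:
  fixes A :: "plane \<Rightarrow> real"
  assumes A: "A \<in> borel_measurable lebesgue" "\<And>x. \<bar>A x\<bar> \<le> 1" and \<eta>: "\<eta> > 0"
    and F: "F \<in> grad_closure" and K: "K \<in> grad_closure"
    and 1: "\<And>\<phi>. \<phi> \<in> test_functions \<Longrightarrow> ip (\<lambda>x. A x *\<^sub>R F x) (grad \<phi>) - \<eta> * ip K (grad \<phi>) = 0"
    and 2: "\<And>\<phi>. \<phi> \<in> test_functions \<Longrightarrow> \<eta> * ip F (grad \<phi>) + ip (\<lambda>x. A x *\<^sub>R K x) (grad \<phi>) = 0"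
  shows "AE x in lebesgue. F x = 0" "AE x in lebesgue. K x = 0"
proof -
  note L = grad_closure_L2[OF F] grad_closure_L2[OF K]
  note AL = L2_mult_bounded[OF A]
  have "ip (\<lambda>x. A x *\<^sub>R F x - \<eta> *\<^sub>R K x) K = 0"
    using 1 by (intro grad_closure_orthogonal[OF _ _ K])
      (auto intro!: L2_diff L2_cmult AL L simp: ip_diff_left AL L L2_cmult test_grad_L2 ip_cmult_left)
  then have e1: "ip (\<lambda>x. A x *\<^sub>R F x) K = \<eta> * ip K K"
    by (simp add: ip_diff_left AL L L2_cmult ip_cmult_left)
  have "ip (\<lambda>x. A x *\<^sub>R K x + \<eta> *\<^sub>R F x) F = 0"
    using 2 by (intro grad_closure_orthogonal[OF _ _ F])
      (auto intro!: L2_add L2_cmult AL L simp: ip_add_left AL L L2_cmult test_grad_L2 ip_cmult_left add.commute)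
  then have e2: "ip (\<lambda>x. A x *\<^sub>R K x) F + \<eta> * ip F F = 0"
    by (simp add: ip_add_left AL L L2_cmult ip_cmult_left)
  have "ip (\<lambda>x. A x *\<^sub>R K x) F = ip (\<lambda>x. A x *\<^sub>R F x) K"
    unfolding ip_mult_swap by (rule trans[OF ip_mult_swap[symmetric] ip_commute])
  then have "\<eta> * (ip K K + ip F F) = 0" using e1 e2 by (simp add: distrib_left)
  then have "ip K K + ip F F = 0" using \<eta> by simp
  then have "ip F F = 0" "ip K K = 0" using ip_self_nonneg[of F] ip_self_nonneg[of K] by linarith+
  then show "AE x in lebesgue. F x = 0" "AE x in lebesgue. K x = 0"
    using L nrm_eq_0_AE by blast+
qed

section \<open>Complex-valued functions as pairs of real ones\<close>

lemma has_weak_grad_bounded_linear: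
  fixes U :: "plane \<Rightarrow> 'a::euclidean_space" and T :: "'a \<Rightarrow> 'b::euclidean_space"
  assumes T: "bounded_linear T" and U: "has_weak_grad U G"
  shows "has_weak_grad (\<lambda>x. T (U x)) (\<lambda>x. \<chi> i. T (G x $ i))"
  unfolding has_weak_grad_def
proof (intro conjI ballI allI)
  have L: "U \<in> L1_loc" "G \<in> L1_loc" using U by (auto simp: has_weak_grad_def)
  have "bounded_linear (\<lambda>y :: 'a ^ 2. \<chi> i. T (y $ i))"
  proof -
    have "linear (\<lambda>y :: 'a ^ 2. \<chi> i. T (y $ i))"
      by (rule linearI) (simp_all add: vec_eq_iff linear_add linear_scale bounded_linear.linear[OF T])
    then show ?thesis by (simp add: linear_conv_bounded_linear)
  qed
  then show "(\<lambda>x. \<chi> i. T (G x $ i)) \<in> L1_loc" by (rule L1_loc_bounded_linear[OF _ L(2)])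
  show "(\<lambda>x. T (U x)) \<in> L1_loc" by (rule L1_loc_bounded_linear[OF T L(1)])
  fix \<phi> i assume p: "\<phi> \<in> test_functions"
  have "(LINT x|lebesgue. (grad \<phi> x $ i) *\<^sub>R T (U x)) = (LINT x|lebesgue. T ((grad \<phi> x $ i) *\<^sub>R U x))"
    by (simp add: linear_scale[OF bounded_linear.linear[OF T]])
  also have "\<dots> = T (LINT x|lebesgue. (grad \<phi> x $ i) *\<^sub>R U x)"
    by (rule integral_bounded_linear[OF T L1_loc_test_integrable[OF L(1) test_grad[OF p]]])
  also have "\<dots> = T (- (LINT x|lebesgue. \<phi> x *\<^sub>R (G x $ i)))"
    using has_weak_gradD[OF U p, of i] by simp
  also have "\<dots> = - T (LINT x|lebesgue. \<phi> x *\<^sub>R (G x $ i))"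
    by (rule linear_neg[OF bounded_linear.linear[OF T]])
  also have "T (LINT x|lebesgue. \<phi> x *\<^sub>R (G x $ i)) = (LINT x|lebesgue. T (\<phi> x *\<^sub>R (G x $ i)))"
    by (rule integral_bounded_linear[OF T L1_loc_test_integrable[OF L1_loc_nth[OF L(2)] p], symmetric])
  finally show "(LINT x|lebesgue. (grad \<phi> x $ i) *\<^sub>R T (U x)) = - (LINT x|lebesgue. \<phi> x *\<^sub>R ((\<chi> i. T (G x $ i)) $ i))"
    by (simp add: linear_scale[OF bounded_linear.linear[OF T]])
qed

lemma has_weak_grad_add:
  fixes U V :: "plane \<Rightarrow> 'a::euclidean_space"
  assumes U: "has_weak_grad U F" and V: "has_weak_grad V H"
  shows "has_weak_grad (\<lambda>x. U x + V x) (\<lambda>x. F x + H x)"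
proof -
  have "has_weak_grad (\<lambda>x. - V x) (\<lambda>x. \<chi> i. - (H x $ i))"
    by (rule has_weak_grad_bounded_linear[OF bounded_linear_minus[OF bounded_linear_ident] V])
  from has_weak_grad_diff[OF U this] show ?thesis by (simp add: vec_eq_iff minus_vec_def plus_vec_def)
qed

definition vec_Re :: "complex ^ 2 \<Rightarrow> plane" where "vec_Re z = (\<chi> i. Re (z $ i))"
definition vec_Im :: "complex ^ 2 \<Rightarrow> plane" where "vec_Im z = (\<chi> i. Im (z $ i))"
definition vec_Complex :: "plane \<Rightarrow> plane \<Rightarrow> complex ^ 2" where "vec_Complex a b = (\<chi> i. Complex (a $ i) (b $ i))"

lemma bounded_linear_vec_Re: "bounded_linear vec_Re" and bounded_linear_vec_Im: "bounded_linear vec_Im"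
proof -
  have "linear vec_Re" "linear vec_Im"
    by (auto intro!: linearI simp: vec_Re_def vec_Im_def vec_eq_iff)
  then show "bounded_linear vec_Re" "bounded_linear vec_Im" by (simp_all add: linear_conv_bounded_linear)
qed

lemma bounded_linear_vec_Complex: "bounded_linear (\<lambda>p. vec_Complex (fst p) (snd p))"
proof -
  have "linear (\<lambda>p. vec_Complex (fst p) (snd p))"
    by (auto intro!: linearI simp: vec_Complex_def vec_eq_iff complex_eq_iff)
  then show ?thesis by (simp add: linear_conv_bounded_linear)
qed

lemma vec_Complex_Re_Im: "vec_Complex (vec_Re z) (vec_Im z) = z"
  by (simp add: vec_Complex_def vec_Re_def vec_Im_def vec_eq_iff)

lemma vec_Re_Complex: "vec_Re (vec_Complex a b) = a" and vec_Im_Complex: "vec_Im (vec_Complex a b) = b"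
  by (simp_all add: vec_Complex_def vec_Re_def vec_Im_def vec_eq_iff)

lemma norm_vec_Complex: "(norm (vec_Complex a b))\<^sup>2 = (norm a)\<^sup>2 + (norm b)\<^sup>2"
  unfolding power2_norm_eq_inner
  by (simp add: inner_vec_def vec_Complex_def inner_complex_def UNIV_2)

lemma H1_dot_complex:
  assumes v: "v \<in> H1_dot" "has_weak_grad v F" "F \<in> L2" and w: "w \<in> H1_dot" "has_weak_grad w K" "K \<in> L2"
  shows "(\<lambda>x. complex_of_real (v x) + \<i> * complex_of_real (w x)) \<in> H1_dot"
    "has_weak_grad (\<lambda>x. complex_of_real (v x) + \<i> * complex_of_real (w x)) (\<lambda>x. vec_Complex (F x) (K x))"
proof -
  let ?u = "\<lambda>x. complex_of_real (v x) + \<i> * complex_of_real (w x)"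
  have bI: "bounded_linear (\<lambda>r. \<i> * complex_of_real r)"
    by (rule bounded_linear_compose[OF bounded_linear_mult_right bounded_linear_of_real])
  have "has_weak_grad ?u (\<lambda>x. (\<chi> i. complex_of_real (F x $ i)) + (\<chi> i. \<i> * complex_of_real (K x $ i)))"
    by (rule has_weak_grad_add[OF has_weak_grad_bounded_linear[OF bounded_linear_of_real v(2)] has_weak_grad_bounded_linear[OF bI w(2)]])
  moreover have "(\<lambda>x. (\<chi> i. complex_of_real (F x $ i)) + (\<chi> i. \<i> * complex_of_real (K x $ i))) = (\<lambda>x. vec_Complex (F x) (K x))"
    by (simp add: vec_Complex_def vec_eq_iff fun_eq_iff complex_eq_iff)
  ultimately show g: "has_weak_grad ?u (\<lambda>x. vec_Complex (F x) (K x))" by simp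
  have L: "(\<lambda>x. vec_Complex (F x) (K x)) \<in> L2"
    using L2_bounded_linear[OF bounded_linear_vec_Complex L2_Pair[OF v(3) w(3)]] by simp
  have m: "?u \<in> borel_measurable lebesgue" using g L1_loc_measurable unfolding has_weak_grad_def by blast
  have "?u \<in> L2_loc"
    unfolding L2_loc_def
  proof (safe intro!: m)
    fix C :: "plane set" assume "compact C"
    then have "set_integrable lebesgue C (\<lambda>x. (norm (v x))\<^sup>2)" "set_integrable lebesgue C (\<lambda>x. (norm (w x))\<^sup>2)"
      using v(1) w(1) by (auto simp: H1_dot_def L2_loc_def)
    from set_integral_add(1)[OF this]
    show "set_integrable lebesgue C (\<lambda>x. (norm (?u x))\<^sup>2)" by (simp add: cmod_power2)
  qed
  then show "?u \<in> H1_dot" using g L by (auto simp: H1_dot_def)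
qed

lemma H1_dot_wgrad_complex:
  fixes u :: "plane \<Rightarrow> complex"
  assumes "u \<in> H1_dot"
  shows "(\<lambda>x. vec_Re (wgrad u x)) \<in> grad_closure" "(\<lambda>x. vec_Im (wgrad u x)) \<in> grad_closure"
proof -
  note g = H1_dot_wgrad[OF assms]
  show "(\<lambda>x. vec_Re (wgrad u x)) \<in> grad_closure"
    by (rule weak_grad_in_grad_closure[OF _ L2_bounded_linear[OF bounded_linear_vec_Re g(2)]])
      (unfold vec_Re_def, rule has_weak_grad_bounded_linear[OF bounded_linear_Re g(1)])
  show "(\<lambda>x. vec_Im (wgrad u x)) \<in> grad_closure"
    by (rule weak_grad_in_grad_closure[OF _ L2_bounded_linear[OF bounded_linear_vec_Im g(2)]])
      (unfold vec_Im_def, rule has_weak_grad_bounded_linear[OF bounded_linear_Im g(1)])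
qed

text \<open>The product of A + i \<eta> and F + i K has real part A F - \<eta> K and imaginary part
  \<eta> F + A K; the signs come from \<open>weak_div\<close>.\<close>

lemma weak_div_coeff_complex:
  fixes G :: "plane \<Rightarrow> complex ^ 2"
  assumes A: "A \<in> borel_measurable lebesgue" "\<And>x. \<bar>A x\<bar> \<le> 1" and G: "G \<in> L2" and p: "\<phi> \<in> test_functions"
  defines "F \<equiv> \<lambda>x. vec_Re (G x)" and "K \<equiv> \<lambda>x. vec_Im (G x)"
  shows "weak_div (\<lambda>x. (complex_of_real (A x) + \<i> * complex_of_real \<eta>) *s G x) \<phi>
    = Complex (- (ip (\<lambda>x. A x *\<^sub>R F x) (grad \<phi>) - \<eta> * ip K (grad \<phi>)))
        (- (\<eta> * ip F (grad \<phi>) + ip (\<lambda>x. A x *\<^sub>R K x) (grad \<phi>)))"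
proof -
  have FL: "F \<in> L2" "K \<in> L2"
    unfolding F_def K_def by (rule L2_bounded_linear[OF bounded_linear_vec_Re G], rule L2_bounded_linear[OF bounded_linear_vec_Im G])
  note AL = L2_mult_bounded[OF A]
  have gL: "grad \<phi> \<in> L2" by (rule test_grad_L2[OF p])
  let ?a = "\<lambda>x. (A x *\<^sub>R F x - \<eta> *\<^sub>R K x) \<bullet> grad \<phi> x" and ?b = "\<lambda>x. (\<eta> *\<^sub>R F x + A x *\<^sub>R K x) \<bullet> grad \<phi> x"
  have ia: "integrable lebesgue ?a" "integrable lebesgue ?b"
    by (intro integrable_inner_L2 L2_diff L2_add L2_cmult AL FL gL)+
  have "(\<Sum>i\<in>UNIV. (grad \<phi> x $ i) *\<^sub>R (((complex_of_real (A x) + \<i> * complex_of_real \<eta>) *s G x) $ i))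
     = complex_of_real (?a x) + \<i> * complex_of_real (?b x)" for x
    by (simp add: UNIV_2 inner_vec_def F_def K_def vec_Re_def vec_Im_def complex_eq_iff algebra_simps)
  then have "weak_div (\<lambda>x. (complex_of_real (A x) + \<i> * complex_of_real \<eta>) *s G x) \<phi>
     = - (LINT x|lebesgue. complex_of_real (?a x) + \<i> * complex_of_real (?b x))"
    by (simp only: weak_div_def)
  also have "(LINT x|lebesgue. complex_of_real (?a x) + \<i> * complex_of_real (?b x))
    = complex_of_real (LINT x|lebesgue. ?a x) + \<i> * complex_of_real (LINT x|lebesgue. ?b x)"
    using ia by (simp add: integral_complex_of_real)
  also have "(LINT x|lebesgue. ?a x) = ip (\<lambda>x. A x *\<^sub>R F x) (grad \<phi>) - \<eta> * ip K (grad \<phi>)"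
    unfolding ip_def[symmetric] by (simp add: ip_diff_left AL FL gL L2_cmult ip_cmult_left)
  also have "(LINT x|lebesgue. ?b x) = \<eta> * ip F (grad \<phi>) + ip (\<lambda>x. A x *\<^sub>R K x) (grad \<phi>)"
    unfolding ip_def[symmetric] by (simp add: ip_add_left AL FL gL L2_cmult ip_cmult_left)
  finally show ?thesis by (simp add: complex_eq_iff)
qed

lemma has_weak_grad_AE_cong:
  fixes U :: "plane \<Rightarrow> 'a::euclidean_space"
  assumes U: "has_weak_grad U G" and eq: "AE x in lebesgue. G x = H x" and H: "H \<in> L1_loc"
  shows "has_weak_grad U H"
  unfolding has_weak_grad_def
proof (intro conjI ballI allI)
  have L: "U \<in> L1_loc" "G \<in> L1_loc" using U by (auto simp: has_weak_grad_def)
  then show "U \<in> L1_loc" "H \<in> L1_loc" using H by auto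
  fix \<phi> i assume p: "\<phi> \<in> test_functions"
  have "(LINT x|lebesgue. \<phi> x *\<^sub>R (G x $ i)) = (LINT x|lebesgue. \<phi> x *\<^sub>R (H x $ i))"
    by (intro integral_cong_AE borel_measurable_integrable L1_loc_test_integrable L1_loc_nth L H p)
      (use eq in eventually_elim, simp)
  then show "(LINT x|lebesgue. (grad \<phi> x $ i) *\<^sub>R U x) = - (LINT x|lebesgue. \<phi> x *\<^sub>R (H x $ i))"
    using has_weak_gradD[OF U p, of i] by simp
qed

section \<open>Admissible pairs and minimisers\<close>

lemma coeff_A_measurable:
  assumes "S \<in> sets lebesgue" shows "coeff_A R S \<in> borel_measurable lebesgue"
proof -
  have "ball 0 R - S \<in> sets lebesgue" using assms by (intro sets.Diff) simp
  then have "(\<lambda>x. 1 - 2 * indicat_real (ball 0 R - S) x) \<in> borel_measurable lebesgue"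
    by (intro borel_measurable_diff borel_measurable_times borel_measurable_const borel_measurable_indicator)
  moreover have "(\<lambda>x. 1 - 2 * indicat_real (ball 0 R - S) x) = coeff_A R S"
    by (auto simp: coeff_A_def indicator_def fun_eq_iff)
  ultimately show ?thesis by simp
qed

lemma coeff_A_bound: "\<bar>coeff_A R S x\<bar> \<le> 1"
  by (simp add: coeff_A_def)

lemma I_fun_ip: "I_fun \<eta> (v, w) = \<eta> / 2 * ip (wgrad v) (wgrad v) + 1 / (2 * \<eta>) * ip (wgrad w) (wgrad w)"
  by (simp add: I_fun_def ip_self)

lemma admissible_iff:
  "(v, w) \<in> admissible R S f \<longleftrightarrow> v \<in> H1_dot \<and> w \<in> H1_dot \<and> (\<forall>\<phi>\<in>test_functions.
    ip (\<lambda>x. coeff_A R S x *\<^sub>R wgrad v x) (grad \<phi>) - ip (wgrad w) (grad \<phi>) = - f \<phi>)"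
  by (auto simp: admissible_def weak_div_eq_ip algebra_simps)

text \<open>An admissible pair differs from the solution \<open>(F0, H0)\<close> of the optimality system by a pair of gradients
  \<open>(p, q)\<close> with \<open>div (A p - q) = 0\<close>, which is orthogonal to \<open>(F0, H0)\<close> for the energy.\<close>

lemma I_fun_admissible:
  assumes S: "S \<in> sets lebesgue" and \<eta>: "\<eta> > 0" and F0: "F0 \<in> grad_closure" and H0: "H0 \<in> grad_closure"
    and 1: "\<And>\<phi>. \<phi> \<in> test_functions \<Longrightarrow> ip (\<lambda>x. coeff_A R S x *\<^sub>R F0 x) (grad \<phi>) - ip H0 (grad \<phi>) = - f \<phi>"
    and 2: "\<And>\<phi>. \<phi> \<in> test_functions \<Longrightarrow> \<eta> * ip F0 (grad \<phi>) + 1 / \<eta> * ip (\<lambda>x. coeff_A R S x *\<^sub>R H0 x) (grad \<phi>) = 0"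
    and vw: "(v, w) \<in> admissible R S f"
  shows "I_fun \<eta> (v, w) = \<eta> / 2 * ip F0 F0 + 1 / (2 * \<eta>) * ip H0 H0
    + \<eta> / 2 * ip (\<lambda>x. wgrad v x - F0 x) (\<lambda>x. wgrad v x - F0 x)
    + 1 / (2 * \<eta>) * ip (\<lambda>x. wgrad w x - H0 x) (\<lambda>x. wgrad w x - H0 x)"
proof -
  let ?A = "coeff_A R S"
  note AL = L2_mult_bounded[OF coeff_A_measurable[OF S, of R] coeff_A_bound]
  have v: "wgrad v \<in> grad_closure" and w: "wgrad w \<in> grad_closure"
    and c: "\<And>\<phi>. \<phi> \<in> test_functions \<Longrightarrow> ip (\<lambda>x. ?A x *\<^sub>R wgrad v x) (grad \<phi>) - ip (wgrad w) (grad \<phi>) = - f \<phi>"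
    using vw H1_dot_wgrad_closure by (auto simp: admissible_iff)
  define p where "p x = wgrad v x - F0 x" for x
  define q where "q x = wgrad w x - H0 x" for x
  have pG: "p \<in> grad_closure" using grad_closure_add_cmult[OF v F0, of "-1"] by (simp add: p_def[abs_def])
  note L = grad_closure_L2[OF v] grad_closure_L2[OF w] grad_closure_L2[OF F0] grad_closure_L2[OF H0] grad_closure_L2[OF pG]
  have qL: "q \<in> L2" unfolding q_def[abs_def] by (rule L2_diff[OF L(2,4)])
  \<comment> \<open>Both pairs satisfy the constraint, so their difference satisfies the homogeneous
    one; by density it may be tested with \<open>H0\<close>.\<close>
  have "ip (\<lambda>x. ?A x *\<^sub>R p x - q x) H0 = 0"
  proof (rule grad_closure_orthogonal[OF L2_diff[OF AL[OF L(5)] qL] _ H0])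
    fix \<phi> assume t: "\<phi> \<in> test_functions"
    note g = test_grad_L2[OF t]
    have "ip (\<lambda>x. ?A x *\<^sub>R p x) (grad \<phi>) = ip (\<lambda>x. ?A x *\<^sub>R wgrad v x) (grad \<phi>) - ip (\<lambda>x. ?A x *\<^sub>R F0 x) (grad \<phi>)"
      using ip_diff_left[OF L(1,3) AL[OF g]] unfolding ip_mult_swap p_def .
    moreover have "ip q (grad \<phi>) = ip (wgrad w) (grad \<phi>) - ip H0 (grad \<phi>)"
      unfolding q_def by (rule ip_diff_left[OF L(2,4) g])
    ultimately show "ip (\<lambda>x. ?A x *\<^sub>R p x - q x) (grad \<phi>) = 0"
      using ip_diff_left[OF AL[OF L(5)] qL g] c[OF t] 1[OF t] by simp
  qed
  then have e1: "ip (\<lambda>x. ?A x *\<^sub>R p x) H0 = ip q H0" using ip_diff_left[OF AL[OF L(5)] qL L(4)] by simp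
  \<comment> \<open>The Euler equation of the solution, tested with the difference \<open>p\<close>.
    Together with \<open>e1\<close> this removes \<open>A\<close> and yields \<open>cross\<close>,
    the orthogonality for the energy.\<close>
  have "ip (\<lambda>x. \<eta> *\<^sub>R F0 x + (1 / \<eta>) *\<^sub>R (?A x *\<^sub>R H0 x)) p = 0"
  proof (rule grad_closure_orthogonal[OF L2_add[OF L2_cmult[OF L(3)] L2_cmult[OF AL[OF L(4)]]] _ pG])
    fix \<phi> assume t: "\<phi> \<in> test_functions"
    show "ip (\<lambda>x. \<eta> *\<^sub>R F0 x + (1 / \<eta>) *\<^sub>R (?A x *\<^sub>R H0 x)) (grad \<phi>) = 0"
      using 2[OF t] ip_add_left[OF L2_cmult[OF L(3)] L2_cmult[OF AL[OF L(4)]] test_grad_L2[OF t], of \<eta> "1 / \<eta>"]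
      by (simp only: ip_cmult_left)
  qed
  then have e2: "\<eta> * ip F0 p + 1 / \<eta> * ip (\<lambda>x. ?A x *\<^sub>R H0 x) p = 0"
    using ip_add_left[OF L2_cmult[OF L(3)] L2_cmult[OF AL[OF L(4)]] L(5), of \<eta> "1 / \<eta>"] by (simp only: ip_cmult_left)
  have "ip (\<lambda>x. ?A x *\<^sub>R H0 x) p = ip (\<lambda>x. ?A x *\<^sub>R p x) H0"
    by (rule trans[OF ip_mult_swap ip_commute])
  then have cross: "\<eta> * ip F0 p + 1 / \<eta> * ip H0 q = 0" using e1 e2 by (simp only: ip_commute[of q])
  have "ip (wgrad v) (wgrad v) = ip F0 F0 + 2 * ip F0 p + ip p p"
    using ip_sum_square[OF L(3) L(5), of 1] by (simp add: p_def)
  moreover have "ip (wgrad w) (wgrad w) = ip H0 H0 + 2 * ip H0 q + ip q q"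
    using ip_sum_square[OF L(4) qL, of 1] by (simp add: q_def)
  ultimately have "I_fun \<eta> (v, w) = \<eta> / 2 * ip F0 F0 + 1 / (2 * \<eta>) * ip H0 H0 + (\<eta> * ip F0 p + 1 / \<eta> * ip H0 q)
      + \<eta> / 2 * ip p p + 1 / (2 * \<eta>) * ip q q"
    unfolding I_fun_ip using \<eta> by (simp add: field_simps)
  then show ?thesis unfolding cross by (simp add: p_def[abs_def] q_def[abs_def])
qed

text \<open>By \<open>I_fun_admissible\<close> the energy is a constant plus two nonnegative
  squares, so minimisers are exactly pinned down at the level of gradients: all of them share
  \<open>F0\<close> and \<open>H0\<close>. Existence comes from potentials of these two
  fields.\<close>

lemma minimizer_characterization:
  assumes S: "S \<in> sets lebesgue" and \<eta>: "\<eta> > 0"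
    and f: "f \<in> H_minus1" "compactly_supported f" "pairing f (\<lambda>_. 1) = 0"
  obtains F0 H0 v0 w0 where "F0 \<in> grad_closure" "H0 \<in> grad_closure"
    "\<And>\<phi>. \<phi> \<in> test_functions \<Longrightarrow> ip (\<lambda>x. coeff_A R S x *\<^sub>R F0 x) (grad \<phi>) - ip H0 (grad \<phi>) = - f \<phi>"
    "\<And>\<phi>. \<phi> \<in> test_functions \<Longrightarrow> \<eta> * ip F0 (grad \<phi>) + 1 / \<eta> * ip (\<lambda>x. coeff_A R S x *\<^sub>R H0 x) (grad \<phi>) = 0"
    "minimizer \<eta> R S f v0 w0"
    "\<And>v w. minimizer \<eta> R S f v w \<Longrightarrow> v \<in> H1_dot \<and> w \<in> H1_dot \<and> has_weak_grad v F0 \<and> has_weak_grad w H0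
       \<and> I_fun \<eta> (v, w) = \<eta> / 2 * ip F0 F0 + 1 / (2 * \<eta>) * ip H0 H0"
proof -
  let ?A = "coeff_A R S"
  obtain C where bd: "\<And>\<phi>. \<phi> \<in> test_functions \<Longrightarrow> \<bar>f \<phi>\<bar> \<le> C * nrm (grad \<phi>)"
    using source_test_bound[OF f] by metis
  have lin: "f (\<lambda>x. \<phi> x + c * \<psi> x) = f \<phi> + c * f \<psi>" if "\<phi> \<in> test_functions" "\<psi> \<in> test_functions" for \<phi> \<psi> c
  proof -
    have add: "f (\<lambda>x. a x + b x) = f a + f b" if "a \<in> H1" "b \<in> H1" for a b
      using f(1) that unfolding H_minus1_def by blast
    have scale: "f (\<lambda>x. d * a x) = d * f a" if "a \<in> H1" for d a
      using f(1) that unfolding H_minus1_def by blast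
    have "f (\<lambda>x. \<phi> x + c * \<psi> x) = f \<phi> + f (\<lambda>x. c * \<psi> x)"
      by (rule add[OF test_H1[OF that(1)] test_H1[OF test_cmult[OF that(2)]]])
    also have "f (\<lambda>x. c * \<psi> x) = c * f \<psi>" by (rule scale[OF test_H1[OF that(2)]])
    finally show ?thesis .
  qed
  note Am = coeff_A_measurable[OF S, of R]
  obtain F0 H0 where F0: "F0 \<in> grad_closure" and H0: "H0 \<in> grad_closure"
    and 1: "\<And>\<phi>. \<phi> \<in> test_functions \<Longrightarrow> ip (\<lambda>x. ?A x *\<^sub>R F0 x) (grad \<phi>) - ip H0 (grad \<phi>) = - f \<phi>"
    and 2: "\<And>\<phi>. \<phi> \<in> test_functions \<Longrightarrow> \<eta> * ip F0 (grad \<phi>) + 1 / \<eta> * ip (\<lambda>x. ?A x *\<^sub>R H0 x) (grad \<phi>) = 0"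
    by (rule optimality_system_solvable[OF Am coeff_A_bound \<eta> lin bd]) (assumption | rule that)+
  obtain v0 where v0: "v0 \<in> H1_dot" "has_weak_grad v0 F0" using grad_closure_potential[OF F0] by metis
  obtain w0 where w0: "w0 \<in> H1_dot" "has_weak_grad w0 H0" using grad_closure_potential[OF H0] by metis
  have F0L: "F0 \<in> L2" and H0L: "H0 \<in> L2" using F0 H0 grad_closure_L2 by auto
  note mv = wgrad_measurable[OF v0(2)] and mw = wgrad_measurable[OF w0(2)]
  note ev = wgrad_AE_eq[OF v0(2)] and ew = wgrad_AE_eq[OF w0(2)]
  let ?I0 = "\<eta> / 2 * ip F0 F0 + 1 / (2 * \<eta>) * ip H0 H0"
  have "ip (\<lambda>x. ?A x *\<^sub>R wgrad v0 x) (grad \<phi>) - ip (wgrad w0) (grad \<phi>) = - f \<phi>" if t: "\<phi> \<in> test_functions" for \<phi>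
  proof -
    note g = L2_measurable[OF test_grad_L2[OF t]]
    have "ip (\<lambda>x. ?A x *\<^sub>R wgrad v0 x) (grad \<phi>) = ip (\<lambda>x. ?A x *\<^sub>R F0 x) (grad \<phi>)"
      by (rule ip_cong_AE) (use ev in eventually_elim, simp,
        auto intro!: g borel_measurable_scaleR Am mv L2_measurable[OF F0L])
    moreover have "ip (wgrad w0) (grad \<phi>) = ip H0 (grad \<phi>)"
      by (rule ip_cong_AE[OF ew _ mw L2_measurable[OF H0L] g g]) simp
    ultimately show ?thesis using 1[OF t] by simp
  qed
  then have adm0: "(v0, w0) \<in> admissible R S f" using v0(1) w0(1) by (simp add: admissible_iff)
  have I0: "I_fun \<eta> (v0, w0) = ?I0"
    unfolding I_fun_ip ip_cong_AE[OF ev ev mv L2_measurable[OF F0L] mv L2_measurable[OF F0L]]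
      ip_cong_AE[OF ew ew mw L2_measurable[OF H0L] mw L2_measurable[OF H0L]] by (rule refl)
  note I = I_fun_admissible[OF S \<eta> F0 H0 1 2]
  have lower: "?I0 \<le> I_fun \<eta> z" if "z \<in> admissible R S f" for z
  proof -
    obtain v w where z: "z = (v, w)" by force
    show ?thesis using I[of v w] that \<eta> unfolding z by (simp add: ip_self_nonneg)
  qed
  \<comment> \<open>The infimum of a set of reals has its intended meaning only if the set is
    nonempty and bounded below; \<open>adm0\<close> and \<open>lower\<close> supply both.\<close>
  have inf: "(INF z \<in> admissible R S f. I_fun \<eta> z) = ?I0"
  proof (rule antisym)
    have "bdd_below (I_fun \<eta> ` admissible R S f)" using lower by (auto intro!: bdd_belowI2)
    from cINF_lower[OF this adm0] show "(INF z \<in> admissible R S f. I_fun \<eta> z) \<le> ?I0" unfolding I0 .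
    show "?I0 \<le> (INF z \<in> admissible R S f. I_fun \<eta> z)"
      by (rule cINF_greatest) (use adm0 lower in auto)
  qed
  show thesis
  proof (rule that[OF F0 H0 1 2])
    show "minimizer \<eta> R S f v0 w0" using adm0 inf I0 by (simp add: minimizer_def)
    fix v w assume m: "minimizer \<eta> R S f v w"
    then have adm: "(v, w) \<in> admissible R S f" and Ivw: "I_fun \<eta> (v, w) = ?I0"
      using inf by (simp_all add: minimizer_def)
    have vH: "v \<in> H1_dot" and wH: "w \<in> H1_dot" using adm by (simp_all add: admissible_iff)
    let ?p = "\<lambda>x. wgrad v x - F0 x" and ?q = "\<lambda>x. wgrad w x - H0 x"
    have "\<eta> / 2 * ip ?p ?p + 1 / (2 * \<eta>) * ip ?q ?q = 0"
      using I[OF _ _ adm] Ivw by simp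
    moreover have "\<eta> / 2 * ip ?p ?p \<ge> 0" "1 / (2 * \<eta>) * ip ?q ?q \<ge> 0"
      using \<eta> ip_self_nonneg[of ?p] ip_self_nonneg[of ?q] by simp_all
    ultimately have "\<eta> / 2 * ip ?p ?p = 0" "1 / (2 * \<eta>) * ip ?q ?q = 0" by linarith+
    then have "ip ?p ?p = 0" "ip ?q ?q = 0" using \<eta> by simp_all
    then have "AE x in lebesgue. ?p x = 0" "AE x in lebesgue. ?q x = 0"
      using nrm_eq_0_AE L2_diff H1_dot_wgrad(2)[OF vH] H1_dot_wgrad(2)[OF wH] F0L H0L by blast+
    then have ae: "AE x in lebesgue. wgrad v x = F0 x" "AE x in lebesgue. wgrad w x = H0 x" by simp_all
    have "has_weak_grad v F0" by (rule has_weak_grad_AE_cong[OF H1_dot_wgrad(1)[OF vH] ae(1) L2_imp_L1_loc[OF F0L]])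
    moreover have "has_weak_grad w H0" by (rule has_weak_grad_AE_cong[OF H1_dot_wgrad(1)[OF wH] ae(2) L2_imp_L1_loc[OF H0L]])
    ultimately show "v \<in> H1_dot \<and> w \<in> H1_dot \<and> has_weak_grad v F0 \<and> has_weak_grad w H0 \<and> I_fun \<eta> (v, w) = ?I0"
      using vH wH Ivw by blast
  qed (assumption+)?
qed

text \<open>Since \<open>wgrad\<close> is an arbitrary choice among representatives, the equation is
  rephrased for any square integrable representative \<open>G\<close>. It is used with the explicit
  gradient built from a minimiser and with \<open>wgrad u\<close> itself.\<close>

lemma solution_iff:
  assumes S: "S \<in> sets lebesgue" and u: "u \<in> H1_dot" and G: "has_weak_grad u G" "G \<in> L2"
  shows "solution \<eta> R S f u \<longleftrightarrow> (\<forall>\<phi>\<in>test_functions.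
    ip (\<lambda>x. coeff_A R S x *\<^sub>R vec_Re (G x)) (grad \<phi>) - \<eta> * ip (\<lambda>x. vec_Im (G x)) (grad \<phi>) = - f \<phi> \<and>
    \<eta> * ip (\<lambda>x. vec_Re (G x)) (grad \<phi>) + ip (\<lambda>x. coeff_A R S x *\<^sub>R vec_Im (G x)) (grad \<phi>) = 0)"
proof -
  note Am = coeff_A_measurable[OF S, of R]
  have "weak_div (\<lambda>x. coeff_a R S \<eta> x *s wgrad u x) \<phi> = weak_div (\<lambda>x. coeff_a R S \<eta> x *s G x) \<phi>"
    if t: "\<phi> \<in> test_functions" for \<phi>
  proof -
    have gm: "(\<lambda>x. grad \<phi> x $ i) \<in> borel_measurable lebesgue" for i
      by (rule L2_measurable[OF test_L2[OF test_grad[OF t]]])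
    have am: "coeff_a R S \<eta> \<in> borel_measurable lebesgue"
      unfolding coeff_a_def[abs_def]
      by (intro borel_measurable_add borel_measurable_const measurable_compose[OF Am] borel_measurable_of_real measurable_ident)
    have m: "(\<lambda>x. \<Sum>i\<in>UNIV. (grad \<phi> x $ i) *\<^sub>R ((coeff_a R S \<eta> x *s V x) $ i)) \<in> borel_measurable lebesgue"
      if "V \<in> L2" for V :: "plane \<Rightarrow> complex ^ 2"
      unfolding vector_smult_component
      by (intro borel_measurable_sum borel_measurable_scaleR gm borel_measurable_times am L2_measurable[OF L2_nth[OF that]])
    show ?thesis unfolding weak_div_def
      by (intro arg_cong[where f=uminus] integral_cong_AE m G(2) H1_dot_wgrad(2)[OF u])
        (use wgrad_AE_eq[OF G(1)] in eventually_elim, simp)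
  qed
  then have "weak_div (\<lambda>x. coeff_a R S \<eta> x *s wgrad u x) \<phi> = Complex
        (- (ip (\<lambda>x. coeff_A R S x *\<^sub>R vec_Re (G x)) (grad \<phi>) - \<eta> * ip (\<lambda>x. vec_Im (G x)) (grad \<phi>)))
        (- (\<eta> * ip (\<lambda>x. vec_Re (G x)) (grad \<phi>) + ip (\<lambda>x. coeff_A R S x *\<^sub>R vec_Im (G x)) (grad \<phi>)))"
    if "\<phi> \<in> test_functions" for \<phi>
    using that weak_div_coeff_complex[OF Am coeff_A_bound G(2) that, of \<eta>, folded coeff_a_def] by (simp only:)
  then have "weak_div (\<lambda>x. coeff_a R S \<eta> x *s wgrad u x) \<phi> = complex_of_real (f \<phi>) \<longleftrightarrow>
    ip (\<lambda>x. coeff_A R S x *\<^sub>R vec_Re (G x)) (grad \<phi>) - \<eta> * ip (\<lambda>x. vec_Im (G x)) (grad \<phi>) = - f \<phi> \<and>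
    \<eta> * ip (\<lambda>x. vec_Re (G x)) (grad \<phi>) + ip (\<lambda>x. coeff_A R S x *\<^sub>R vec_Im (G x)) (grad \<phi>) = 0"
    if "\<phi> \<in> test_functions" for \<phi>
    using that by (auto simp: complex_eq_iff)
  then show ?thesis unfolding solution_def using u by blast
qed

theorem lemma2p1:
  fixes R \<eta> :: real and S :: "(real ^ 2) set" and f :: "(real ^ 2 \<Rightarrow> real) \<Rightarrow> real"
  assumes "R > 1"
    and "S \<in> sets lebesgue" and "S \<subseteq> ball 0 1"
    and "\<eta> > 0"
    and "f \<in> H_minus1" and "compactly_supported f" and "pairing f (\<lambda>_. 1) = 0"
  shows
    "(\<exists>v w. minimizer \<eta> R S f v w) \<and>
     (\<forall>v w v' w'. minimizer \<eta> R S f v w \<and> minimizer \<eta> R S f v' w' \<longrightarrow>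
        eq_up_to_const v' v \<and> eq_up_to_const w' w) \<and>
     (\<forall>v w. minimizer \<eta> R S f v w \<longrightarrow>
        solution \<eta> R S f
          (\<lambda>x. complex_of_real (v x) + \<i> * complex_of_real (inverse \<eta> * w x)) \<and>
        (\<forall>u. solution \<eta> R S f u \<longrightarrow> eq_up_to_const u
          (\<lambda>x. complex_of_real (v x) + \<i> * complex_of_real (inverse \<eta> * w x)))) \<and>
     (\<forall>v w u. minimizer \<eta> R S f v w \<and> solution \<eta> R S f u \<longrightarrow>
        E_fun \<eta> u = I_fun \<eta> (v, w))"
proof -
  obtain F0 H0 v0 w0 where F0: "F0 \<in> grad_closure" and H0: "H0 \<in> grad_closure"
    and 1: "\<And>\<phi>. \<phi> \<in> test_functions \<Longrightarrow> ip (\<lambda>x. coeff_A R S x *\<^sub>R F0 x) (grad \<phi>) - ip H0 (grad \<phi>) = - f \<phi>"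
    and 2: "\<And>\<phi>. \<phi> \<in> test_functions \<Longrightarrow> \<eta> * ip F0 (grad \<phi>) + 1 / \<eta> * ip (\<lambda>x. coeff_A R S x *\<^sub>R H0 x) (grad \<phi>) = 0"
    and m0: "minimizer \<eta> R S f v0 w0"
    and m: "\<And>v w. minimizer \<eta> R S f v w \<Longrightarrow> v \<in> H1_dot \<and> w \<in> H1_dot \<and> has_weak_grad v F0 \<and> has_weak_grad w H0
       \<and> I_fun \<eta> (v, w) = \<eta> / 2 * ip F0 F0 + 1 / (2 * \<eta>) * ip H0 H0"
    by (rule minimizer_characterization[OF assms(2,4-7)]) (assumption | rule that)+
  have \<eta>: "\<eta> > 0" by fact
  note Am = coeff_A_measurable[OF assms(2), of R]
  note L = grad_closure_L2[OF F0] grad_closure_L2[OF H0]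
  \<comment> \<open>The gradient of w/\<eta>, the imaginary part of the candidate solution.\<close>
  define K0 where "K0 x = (1 / \<eta>) *\<^sub>R H0 x" for x
  have K0L: "K0 \<in> L2" unfolding K0_def[abs_def] by (rule L2_cmult[OF L(2)])
  have K0G: "K0 \<in> grad_closure"
    using grad_closure_add_cmult[OF H0 H0, of "1 / \<eta> - 1"] by (simp add: K0_def[abs_def] algebra_simps)
  let ?G = "\<lambda>x. vec_Complex (F0 x) (K0 x)"
  have GL: "?G \<in> L2" using L2_bounded_linear[OF bounded_linear_vec_Complex L2_Pair[OF L(1) K0L]] by simp
  have ipK: "\<eta> * ip K0 H = ip H0 H" for H unfolding K0_def ip_cmult_left using \<eta> by simp
  have ipAK: "ip (\<lambda>x. coeff_A R S x *\<^sub>R K0 x) H = 1 / \<eta> * ip (\<lambda>x. coeff_A R S x *\<^sub>R H0 x) H" for H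
    using ip_cmult_left[of "1 / \<eta>" H0 "\<lambda>x. coeff_A R S x *\<^sub>R H x"]
    unfolding ip_mult_swap[of "coeff_A R S"] K0_def .
  let ?u = "\<lambda>v w x. complex_of_real (v x) + \<i> * complex_of_real (inverse \<eta> * w x)"
  have u: "?u v w \<in> H1_dot" "has_weak_grad (?u v w) ?G" if vw: "minimizer \<eta> R S f v w" for v w
  proof -
    have "has_weak_grad (\<lambda>x. inverse \<eta> * w x) (\<lambda>x. \<chi> i. inverse \<eta> * (H0 x $ i))"
      by (rule has_weak_grad_bounded_linear[OF bounded_linear_mult_right]) (use m[OF vw] in blast)
    moreover have "(\<lambda>x. \<chi> i. inverse \<eta> * (H0 x $ i)) = K0"
      by (simp add: K0_def vec_eq_iff fun_eq_iff inverse_eq_divide)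
    ultimately have g: "has_weak_grad (\<lambda>x. inverse \<eta> * w x) K0" by simp
    have w: "w \<in> L2_loc" using m[OF vw] by (simp add: H1_dot_def)
    have "(\<lambda>x. inverse \<eta> * w x) \<in> borel_measurable lebesgue"
      using g L1_loc_measurable unfolding has_weak_grad_def by blast
    moreover have "set_integrable lebesgue C (\<lambda>x. (norm (inverse \<eta> * w x))\<^sup>2)" if "compact C" for C
    proof -
      have "set_integrable lebesgue C (\<lambda>x. (norm (w x))\<^sup>2)" using w that by (simp add: L2_loc_def)
      then have "set_integrable lebesgue C (\<lambda>x. (inverse \<eta>)\<^sup>2 * (norm (w x))\<^sup>2)" by (rule set_integrable_mult_right)
      then show ?thesis by (simp add: power_mult_distrib)
    qed
    ultimately have h: "(\<lambda>x. inverse \<eta> * w x) \<in> H1_dot" using g K0L by (auto simp: H1_dot_def L2_loc_def)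
    have v: "v \<in> H1_dot" "has_weak_grad v F0" using m[OF vw] by auto
    show "?u v w \<in> H1_dot" "has_weak_grad (?u v w) ?G"
      by (rule H1_dot_complex(1)[OF v L(1) h g K0L], rule H1_dot_complex(2)[OF v L(1) h g K0L])
  qed
  \<comment> \<open>Every solution has the same gradient as the candidate; this one fact gives both
    uniqueness up to a constant and equality of the energies.\<close>
  have sol: "AE x in lebesgue. wgrad u x = ?G x" if s: "solution \<eta> R S f u" for u
  proof -
    have uH: "u \<in> H1_dot" using s by (simp add: solution_def)
    note g = H1_dot_wgrad[OF uH] and c = H1_dot_wgrad_complex[OF uH]
    let ?F = "\<lambda>x. vec_Re (wgrad u x)" and ?K = "\<lambda>x. vec_Im (wgrad u x)"
    note cL = grad_closure_L2[OF c(1)] grad_closure_L2[OF c(2)]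
    have eqs: "ip (\<lambda>x. coeff_A R S x *\<^sub>R ?F x) (grad \<phi>) - \<eta> * ip ?K (grad \<phi>) = - f \<phi>"
        "\<eta> * ip ?F (grad \<phi>) + ip (\<lambda>x. coeff_A R S x *\<^sub>R ?K x) (grad \<phi>) = 0" if "\<phi> \<in> test_functions" for \<phi>
      using s that solution_iff[OF assms(2) uH g] by blast+
    \<comment> \<open>Real and imaginary parts of the difference of gradients solve the homogeneous
      system, since the source cancels.\<close>
    define F where "F x = ?F x - F0 x" for x
    define K where "K x = ?K x - K0 x" for x
    have FG: "F \<in> grad_closure" using grad_closure_add_cmult[OF c(1) F0, of "-1"] by (simp add: F_def[abs_def])
    have KG: "K \<in> grad_closure" using grad_closure_add_cmult[OF c(2) K0G, of "-1"] by (simp add: K_def[abs_def])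
    note AL = L2_mult_bounded[OF Am coeff_A_bound]
    have d: "ip F H = ip ?F H - ip F0 H" "ip K H = ip ?K H - ip K0 H" if "H \<in> L2" for H
      unfolding F_def K_def by (rule ip_diff_left[OF cL(1) L(1) that], rule ip_diff_left[OF cL(2) K0L that])
    have "ip (\<lambda>x. coeff_A R S x *\<^sub>R F x) (grad \<phi>) - \<eta> * ip K (grad \<phi>) = 0"
      "\<eta> * ip F (grad \<phi>) + ip (\<lambda>x. coeff_A R S x *\<^sub>R K x) (grad \<phi>) = 0" if t: "\<phi> \<in> test_functions" for \<phi>
    proof -
      note gL = test_grad_L2[OF t]
      show "ip (\<lambda>x. coeff_A R S x *\<^sub>R F x) (grad \<phi>) - \<eta> * ip K (grad \<phi>) = 0"
        using eqs(1)[OF t] 1[OF t] ipK[of "grad \<phi>"]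
        unfolding ip_mult_swap d[OF gL] d[OF AL[OF gL]] by (simp add: right_diff_distrib)
      show "\<eta> * ip F (grad \<phi>) + ip (\<lambda>x. coeff_A R S x *\<^sub>R K x) (grad \<phi>) = 0"
        using eqs(2)[OF t] 2[OF t] ipAK[of "grad \<phi>"]
        unfolding ip_mult_swap d[OF gL] d[OF AL[OF gL]] by (simp add: right_diff_distrib)
    qed
    from optimality_system_unique[OF Am coeff_A_bound \<eta> FG KG this]
    have "AE x in lebesgue. F x = 0" "AE x in lebesgue. K x = 0" by blast+
    then show ?thesis
    proof eventually_elim
      case (elim x)
      then have "?F x = F0 x" "?K x = K0 x" by (simp_all add: F_def K_def)
      then show ?case using vec_Complex_Re_Im[of "wgrad u x"] by simp
    qed
  qed
  have "solution \<eta> R S f (?u v w)" if vw: "minimizer \<eta> R S f v w" for v w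
    unfolding solution_iff[OF assms(2) u[OF vw] GL] vec_Re_Complex vec_Im_Complex ipK ipAK
    using 1 2 by blast
  moreover have "eq_up_to_const u (?u v w)" if vw: "minimizer \<eta> R S f v w" and s: "solution \<eta> R S f u" for v w u
  proof (rule eq_up_to_constI[OF _ u(2)[OF vw] sol[OF s]])
    show "has_weak_grad u (wgrad u)" using s H1_dot_wgrad(1) by (auto simp: solution_def)
  qed
  moreover have "E_fun \<eta> u = I_fun \<eta> (v, w)" if vw: "minimizer \<eta> R S f v w" and s: "solution \<eta> R S f u" for v w u
  proof -
    have "u \<in> H1_dot" using s by (simp add: solution_def)
    note mu = L2_measurable[OF H1_dot_wgrad(2)[OF this]]
    have "ip (wgrad u) (wgrad u) = ip ?G ?G"
      by (rule ip_cong_AE[OF sol[OF s] sol[OF s] mu L2_measurable[OF GL] mu L2_measurable[OF GL]])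
    also have "\<dots> = (LINT x|lebesgue. (norm (F0 x))\<^sup>2 + (norm (K0 x))\<^sup>2)"
      unfolding ip_self norm_vec_Complex by (rule refl)
    also have "\<dots> = ip F0 F0 + ip K0 K0"
      unfolding ip_self by (rule Bochner_Integration.integral_add[OF L2_integrable[OF L(1)] L2_integrable[OF K0L]])
    \<comment> \<open>The factor \<eta>/2 in front then turns 1/\<eta>^2 into the 1/(2 \<eta>) of
      \<open>I_fun\<close>.\<close>
    also have "ip K0 K0 = ip H0 H0 / \<eta>\<^sup>2"
      unfolding K0_def ip_cmult_left ip_cmult_right by (simp add: power2_eq_square)
    finally have "E_fun \<eta> u = \<eta> / 2 * (ip F0 F0 + ip H0 H0 / \<eta>\<^sup>2)" by (simp add: E_fun_def ip_self)
    also have "\<dots> = I_fun \<eta> (v, w)" using m[OF vw] \<eta> by (simp add: field_simps power2_eq_square)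
    finally show ?thesis .
  qed
  moreover have "eq_up_to_const v' v \<and> eq_up_to_const w' w"
    if "minimizer \<eta> R S f v w" "minimizer \<eta> R S f v' w'" for v w v' w'
    using m[OF that(1)] m[OF that(2)] by (auto intro!: eq_up_to_constI)
  ultimately show ?thesis using m0 by blast
qed

end
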